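(* Let $G=(V,E)$ be a graph, let $u,v,w$ be distinct vertices of $G$, and let $G'=G-uv-uw-vw$. Then $G$ has an infinitesimally rigid, $\{u,v,w\}$-coincident realisation in $\mathbb{R}^2$ if and only if $G'$ is rigid in $\mathbb{R}^2$ and $G'/S$ is rigid in $\mathbb{R}^2$ for all $S\subseteq\{u,v,w\}$ with $|S|\ge 2$.
   Context: Graphs are finite and simple. A realisation of $G=(V,E)$ in $\mathbb{R}^2$ is a map $p:V\to\mathbb{R}^2$ (vertices may be mapped to the same point); the pair $(G,p)$ is a framework. Its rigidity matrix $R(G,p)$ is the $|E|\times 2|V|$ matrix in which the row of an edge $xy$ has $p(x)-p(y)$ in the two columns of $x$, $p(y)-p(x)$ in the two columns of $y$, and zeros elsewhere. When $|V|\ge 2$, $(G,p)$ is infinitesimally rigid if $\operatorname{rank} R(G,p)=2|V|-3$ (when $|V|=1$ it is infinitesimally rigid if the rank is $0$, which always holds). The realisation is generic if the coordinates of all the points $p(x)$, $x\in V$, are algebraically independent over $\mathbb{Q}$. The graph $G$ is rigid in $\mathbb{R}^2$ if some (equivalently every) generic realisation of $G$ in $\mathbb{R}^2$ is infinitesimally rigid. For $T\subseteq V$, a realisation $p$ of $G$ is $T$-coincident if $p(x)=p(y)$ for all $x,y\in T$. The graph $G-xy$ is obtained from $G$ by deleting the edge $xy$ if it is present (and $G-xy=G$ otherwise). The graph $G/S$ is obtained from $G$ by contracting the vertices in $S$ to a single vertex (the result is regarded as a simple graph: loops are removed and parallel edges identified). *)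

theory Defs
  imports
    "HOL-Analysis.Analysis"
    "HOL-Library.Function_Algebras"
    "HOL-Library.Poly_Mapping"
begin

section \<open>Finite simple graphs\<close>

record 'a sgraph =
  verts :: "'a set"
  edges :: "'a set set"

definition finite_simple_graph :: "'a sgraph \<Rightarrow> bool" where
  "finite_simple_graph G \<longleftrightarrow>
     finite (verts G) \<and> (\<forall>e\<in>edges G. e \<subseteq> verts G \<and> card e = 2)"

definition delete_edge :: "'a sgraph \<Rightarrow> 'a \<Rightarrow> 'a \<Rightarrow> 'a sgraph" where
  "delete_edge G x y = \<lparr>verts = verts G, edges = edges G - {{x, y}}\<rparr>"

text \<open>
  The vertices of the contraction \<open>G/S\<close> are sets of vertices of \<open>G\<close>: the new vertex is \<open>S\<close>
  itself and every vertex \<open>x \<notin> S\<close> becomes \<open>{x}\<close>. The condition \<^term>\<open>card e = 2\<close> removes loops;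
  parallel edges are identified because edges are sets of vertices.
\<close>

definition contract_vertex :: "'a set \<Rightarrow> 'a \<Rightarrow> 'a set" where
  "contract_vertex S x = (if x \<in> S then S else {x})"

definition contract :: "'a sgraph \<Rightarrow> 'a set \<Rightarrow> 'a set sgraph" where
  "contract G S =
     \<lparr>verts = contract_vertex S ` verts G,
      edges = {e \<in> (\<lambda>e. contract_vertex S ` e) ` edges G. card e = 2}\<rparr>"


section \<open>Rank of a matrix with arbitrary index sets\<close>

text \<open>
  A real matrix with rows indexed by \<open>R\<close> is a function \<open>M :: 'r \<Rightarrow> 'c \<Rightarrow> real\<close>; its rank is the
  dimension of the span of its rows in the vector space of functions \<open>'c \<Rightarrow> real\<close>.
\<close>

definition fun_scale :: "real \<Rightarrow> ('c \<Rightarrow> real) \<Rightarrow> 'c \<Rightarrow> real" where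
  "fun_scale a f = (\<lambda>c. a * f c)"

interpretation fun_space: vector_space "fun_scale :: real \<Rightarrow> ('c \<Rightarrow> real) \<Rightarrow> 'c \<Rightarrow> real"
  by unfold_locales (auto simp: fun_scale_def fun_eq_iff algebra_simps)

definition matrix_rank :: "'r set \<Rightarrow> ('r \<Rightarrow> 'c \<Rightarrow> real) \<Rightarrow> nat" where
  "matrix_rank R M = fun_space.dim (M ` R)"


section \<open>Infinitesimal rigidity\<close>

text \<open>
  A realisation is a total function \<open>p :: 'a \<Rightarrow> real ^ 2\<close>, of which only the values on the vertex set
  matter. In the row of an edge \<open>e\<close>, the entry at \<open>z \<in> e\<close> involves the other end
  \<^term>\<open>the_elem (e - {z})\<close> of \<open>e\<close>. The column index \<open>(z, i)\<close> ranges over the whole type; the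
  columns with \<open>z\<close> outside the vertex set are zero and do not affect the rank.
\<close>

definition rigidity_matrix :: "('a \<Rightarrow> real ^ 2) \<Rightarrow> 'a set \<Rightarrow> 'a \<times> 2 \<Rightarrow> real" where
  "rigidity_matrix p e = (\<lambda>(z, i). if z \<in> e then (p z - p (the_elem (e - {z}))) $ i else 0)"

lemma rigidity_matrix_edge:
  assumes "x \<noteq> y"
  shows "rigidity_matrix p {x, y} (z, i) =
    (if z = x then (p x - p y) $ i else if z = y then (p y - p x) $ i else 0)"
proof -
  have "{x, y} - {x} = {y}" "{x, y} - {y} = {x}"
    using assms by auto
  then show ?thesis
    using assms by (auto simp: rigidity_matrix_def)
qed

definition infinitesimally_rigid :: "'a sgraph \<Rightarrow> ('a \<Rightarrow> real ^ 2) \<Rightarrow> bool" where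
  "infinitesimally_rigid G p \<longleftrightarrow>
     matrix_rank (edges G) (rigidity_matrix p) =
       (if card (verts G) \<ge> 2 then 2 * card (verts G) - 3 else 0)"

definition coincident :: "'a set \<Rightarrow> ('a \<Rightarrow> real ^ 2) \<Rightarrow> bool" where
  "coincident T p \<longleftrightarrow> (\<forall>x\<in>T. \<forall>y\<in>T. p x = p y)"


section \<open>Generic realisations and rigid graphs\<close>

text \<open>
  A polynomial over the rationals in variables indexed by \<open>'i\<close> is a finitely supported function
  from monomials \<open>'i \<Rightarrow>\<^sub>0 nat\<close> to coefficients.
\<close>

definition poly_eval :: "('i \<Rightarrow> real) \<Rightarrow> (('i \<Rightarrow>\<^sub>0 nat) \<Rightarrow>\<^sub>0 rat) \<Rightarrow> real" where
  "poly_eval x f =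
     (\<Sum>m\<in>Poly_Mapping.keys f.
        of_rat (Poly_Mapping.lookup f m) *
        (\<Prod>i\<in>Poly_Mapping.keys m. x i ^ Poly_Mapping.lookup m i))"

text \<open>
  Independence of the family \<open>(x i)\<close> with \<open>i \<in> I\<close>, not of the set of its values: in particular,
  the family is dependent if two of its members are equal.
\<close>

definition algebraically_independent_over_rat :: "'i set \<Rightarrow> ('i \<Rightarrow> real) \<Rightarrow> bool" where
  "algebraically_independent_over_rat I x \<longleftrightarrow>
     (\<forall>f :: ('i \<Rightarrow>\<^sub>0 nat) \<Rightarrow>\<^sub>0 rat.
        (\<forall>m\<in>Poly_Mapping.keys f. Poly_Mapping.keys m \<subseteq> I) \<longrightarrow> poly_eval x f = 0 \<longrightarrow> f = 0)"

definition generic :: "'a sgraph \<Rightarrow> ('a \<Rightarrow> real ^ 2) \<Rightarrow> bool" where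
  "generic G p \<longleftrightarrow>
     algebraically_independent_over_rat (verts G \<times> (UNIV :: 2 set)) (\<lambda>(x, i). p x $ i)"

definition rigid :: "'a sgraph \<Rightarrow> bool" where
  "rigid G \<longleftrightarrow> (\<exists>p. generic G p \<and> infinitesimally_rigid G p)"

end

theory Submission
  imports Defs
begin

text \<open>
  Rotating all velocities by a right angle turns an infinitesimal motion of \<open>(G, p)\<close> into a parallel
  redrawing: a map \<open>z\<close> with \<open>z x - z y\<close> parallel to \<open>p x - p y\<close> for every edge \<open>xy\<close>. The trivial motions
  become the maps \<open>x \<mapsto> \<gamma> p x + \<tau>\<close>. A body of \<open>z\<close> is a set of at least two vertices of the form
  \<open>{x. z x = \<gamma> p x + \<tau>}\<close>; the ends of an edge between distinct points lie in a common body, so the bodies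
  cover the graph.

  \<^bold>\<open>Contractions rigid implies coincident rigid.\<close> Put \<open>T = {u, v, w}\<close>, choose \<open>p\<close> generically among
  the \<open>T\<close>-coincident realisations and suppose that it has a nontrivial redrawing \<open>z\<close>. Let \<open>S \<subseteq> T\<close> be a level set
  of \<open>z\<close> on \<open>T\<close> with at least two elements, if there is one. Then \<open>z\<close> and \<open>p\<close> live on \<open>G'/S\<close> (on \<open>G'\<close>
  itself if there is no such \<open>S\<close>), and there \<open>z\<close> separates the vertices that come from \<open>T\<close>. Lemma
  \<open>bodies_count\<close> shows that the bodies \<open>K\<close> of \<open>z\<close> on that graph with \<open>n\<close> vertices satisfy
  \<open>\<Sum>(2 |K| - 3) \<le> 2 n - 4\<close>. Since edges inside \<open>K\<close> contribute rank at most \<open>2 |K| - 3\<close> in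
  every realisation, that graph is not rigid, a contradiction.

  The count is proved by statics. A force system assigns a force in the plane to every incidence of a point with
  a body; it is balanced if the forces at each point cancel and the forces on each body
  have zero resultant and zero moment. If only the zero system is balanced, then comparing the number of unknowns with the
  number of independent conditions gives the count, because the two translations, the dilation \<open>p\<close> and
  \<open>z\<close> itself are four dependencies among the conditions.

  So the heart of the proof is \<open>balanced_eq_0\<close>: nonzero balanced systems do not exist. Genericity of
  \<open>p\<close> means that the rank of no such system of conditions can be raised by moving the points outside
  \<open>T\<close>. Differentiating in these directions yields a second equation for free: if the body \<open>i\<close> is
  scaled by \<open>\<gamma> i\<close>, then besides \<open>\<Sum>g i x = 0\<close> also \<open>\<Sum>\<gamma> i g i x = 0\<close> at each
  \<open>x\<close> outside \<open>T\<close>, and the numbers \<open>\<gamma> i\<close> of the bodies at \<open>x\<close> are distinct. In a minimal set of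
  incidences that carries a nonzero balanced system no force vanishes, so a point outside \<open>T\<close> lies in at
  least three bodies; if it lies in exactly three, all with two points, then these bodies lead to three
  different vertices of \<open>T\<close>. A discharging argument turns this into a lower bound for the number of incidences, and linear algebra then
  produces a nonzero balanced system in which one force does vanish. The bound \<open>|T| \<le> 3\<close> enters only here.

  \<^bold>\<open>Coincident rigid implies contractions rigid.\<close> Adding up the columns of the vertices in
  \<open>S\<close> maps the rows of \<open>G'\<close> to the rows of \<open>G'/S\<close> and lowers the rank by at most
  \<open>2 (|S| - 1)\<close>, which is exactly the difference of the two target ranks. Finally an infinitesimally rigid realisation
  may be replaced by a generic one, because the rank is lower semicontinuous and algebraically independent
  families are dense.
\<close>

section \<open>Rank of finite families of rows\<close>

text \<open>
  Independence is stated for the family of rows rather than for the set of row vectors, so that two equal rows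
  count as dependent.
\<close>

definition indep_rows :: "'r set \<Rightarrow> ('r \<Rightarrow> 'c \<Rightarrow> real) \<Rightarrow> bool" where
  "indep_rows B M \<longleftrightarrow> (\<forall>a. (\<forall>c. (\<Sum>r\<in>B. a r * M r c) = 0) \<longrightarrow> (\<forall>r\<in>B. a r = 0))"

lemma sum_fun_scale_apply: "(\<Sum>r\<in>B. fun_scale (a r) (M r)) c = (\<Sum>r\<in>B. a r * M r c)"
  by (induction B rule: infinite_finite_induct) (auto simp: fun_scale_def)

lemma in_span_rows_iff:
  assumes "finite B"
  shows "x \<in> fun_space.span (M ` B) \<longleftrightarrow> (\<exists>a. \<forall>c. x c = (\<Sum>r\<in>B. a r * M r c))"
proof
  assume "x \<in> fun_space.span (M ` B)"
  then show "\<exists>a. \<forall>c. x c = (\<Sum>r\<in>B. a r * M r c)"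
  proof (induction rule: fun_space.span_induct_alt)
    case base
    show ?case by (rule exI[of _ "\<lambda>_. 0"]) simp
  next
    case (step t x y)
    then obtain r a where r: "r \<in> B" "x = M r" and a: "\<forall>c. y c = (\<Sum>r\<in>B. a r * M r c)" by auto
    have "(\<Sum>r'\<in>B. (a r' + (if r' = r then t else 0)) * M r' c) = (\<Sum>r'\<in>B. a r' * M r' c) + t * M r c" for c
    proof -
      have "(\<Sum>r'\<in>B. (a r' + (if r' = r then t else 0)) * M r' c)
          = (\<Sum>r'\<in>B. a r' * M r' c + (if r' = r then t * M r' c else 0))"
        by (intro sum.cong) (auto simp: algebra_simps)
      then show ?thesis using assms r by (simp add: sum.distrib)
    qed
    then show ?case
      using a r by (intro exI[of _ "\<lambda>r'. a r' + (if r' = r then t else 0)"]) (simp add: fun_scale_def)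
  qed
next
  assume "\<exists>a. \<forall>c. x c = (\<Sum>r\<in>B. a r * M r c)"
  then obtain a where "\<forall>c. x c = (\<Sum>r\<in>B. a r * M r c)" by blast
  then have "x = (\<Sum>r\<in>B. fun_scale (a r) (M r))" by (auto simp: sum_fun_scale_apply)
  moreover have "(\<Sum>r\<in>B. fun_scale (a r) (M r)) \<in> fun_space.span (M ` B)"
    by (intro fun_space.span_sum fun_space.span_scale fun_space.span_base) auto
  ultimately show "x \<in> fun_space.span (M ` B)" by simp
qed

lemma indep_rows_imp:
  assumes "finite B" "indep_rows B M"
  shows "inj_on M B" "fun_space.independent (M ` B)"
proof -
  show inj: "inj_on M B"
  proof (rule inj_onI, rule ccontr)
    fix r s assume rs: "r \<in> B" "s \<in> B" "M r = M s" "r \<noteq> s"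
    let ?a = "\<lambda>x. if x = r then 1 else if x = s then -1 else (0::real)"
    have "(\<Sum>x\<in>B. ?a x * M x c) = 0" for c
    proof -
      have "(\<Sum>x\<in>B. ?a x * M x c) = (\<Sum>x\<in>{r,s}. ?a x * M x c)"
        using assms(1) rs by (intro sum.mono_neutral_right) auto
      then show ?thesis using rs by simp
    qed
    then have "\<forall>r\<in>B. ?a r = 0" using assms(2) unfolding indep_rows_def by (elim allE[of _ ?a]) blast
    then show False using rs(1) by auto
  qed
  show "fun_space.independent (M ` B)"
  proof (rule fun_space.independent_if_scalars_zero)
    fix f x assume *: "(\<Sum>x\<in>M ` B. fun_scale (f x) x) = 0" "x \<in> M ` B"
    then have "(\<Sum>r\<in>B. fun_scale (f (M r)) (M r)) = 0" by (simp add: sum.reindex[OF inj])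
    then have "(\<Sum>r\<in>B. f (M r) * M r c) = 0" for c
      by (metis sum_fun_scale_apply zero_fun_apply)
    then have "\<forall>r\<in>B. f (M r) = 0" using assms(2) unfolding indep_rows_def
      by (auto dest: spec[of _ "\<lambda>r. f (M r)"])
    then show "f x = 0" using * by auto
  qed (use assms in simp)
qed

lemma matrix_rank_le:
  assumes "finite D" "\<And>r. r \<in> R \<Longrightarrow> \<exists>a. \<forall>c. M r c = (\<Sum>d\<in>D. a d * N d c)"
  shows "matrix_rank R M \<le> card D"
proof -
  have "M ` R \<subseteq> fun_space.span (N ` D)"
    using assms by (auto simp: in_span_rows_iff)
  then have "fun_space.dim (M ` R) \<le> card (N ` D)"
    using assms(1) by (intro fun_space.dim_le_card) auto
  then show ?thesis unfolding matrix_rank_def using card_image_le[OF assms(1), of N] by linarith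
qed

lemma matrix_rank_basis:
  assumes "finite R"
  obtains B where "B \<subseteq> R" "card B = matrix_rank R M" "indep_rows B M"
    "\<And>r. r \<in> R \<Longrightarrow> \<exists>a. \<forall>c. M r c = (\<Sum>b\<in>B. a b * M b c)"
proof -
  obtain V where V: "V \<subseteq> M ` R" "fun_space.independent V" "M ` R \<subseteq> fun_space.span V"
    "card V = fun_space.dim (M ` R)"
    using fun_space.basis_exists by metis
  obtain B where B: "B \<subseteq> R" "inj_on M B" "V = M ` B"
    using V(1) by (meson subset_image_inj)
  have fB: "finite B" using B(1) assms finite_subset by blast
  have "indep_rows B M"
    unfolding indep_rows_def
  proof (intro allI impI ballI)
    fix a r assume a: "\<forall>c. (\<Sum>r\<in>B. a r * M r c) = 0" and r: "r \<in> B"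
    have "(\<Sum>v\<in>M ` B. fun_scale (a (the_inv_into B M v)) v) = (\<Sum>r\<in>B. fun_scale (a r) (M r))"
      using B(2) by (simp add: sum.reindex the_inv_into_f_f)
    also have "\<dots> = 0" using a by (auto simp: sum_fun_scale_apply)
    finally have "\<forall>v\<in>M ` B. a (the_inv_into B M v) = 0"
      using V(2) B(3) fun_space.dependent_finite[of "M ` B"] fB by auto
    then show "a r = 0" using r B(2) by (auto simp: the_inv_into_f_f)
  qed
  moreover have "\<exists>a. \<forall>c. M r c = (\<Sum>b\<in>B. a b * M b c)" if "r \<in> R" for r
    using V(3) B(3) that in_span_rows_iff[OF fB, of "M r" M] by blast
  moreover have "card B = matrix_rank R M"
    using V(4) B by (simp add: matrix_rank_def card_image)
  ultimately show ?thesis using B(1) that by blast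
qed

lemma indep_rows_card_le:
  assumes "finite B" "indep_rows B M" "finite D"
    "\<And>r. r \<in> B \<Longrightarrow> \<exists>a. \<forall>c. M r c = (\<Sum>d\<in>D. a d * N d c)"
  shows "card B \<le> card D"
proof -
  have "M ` B \<subseteq> fun_space.span (N ` D)"
    using assms(3,4) by (auto simp: in_span_rows_iff)
  then have "card (M ` B) \<le> card (N ` D)"
    using fun_space.independent_span_bound[of "N ` D" "M ` B"] indep_rows_imp[OF assms(1,2)] assms(3) by auto
  then show ?thesis using card_image_le[OF assms(3), of N] indep_rows_imp[OF assms(1,2)]
    by (simp add: card_image)
qed

lemma card_le_matrix_rank:
  assumes "finite R" "B \<subseteq> R" "indep_rows B M"
  shows "card B \<le> matrix_rank R M"
proof -
  obtain D where D: "D \<subseteq> R" "card D = matrix_rank R M" 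
    "\<And>r. r \<in> R \<Longrightarrow> \<exists>a. \<forall>c. M r c = (\<Sum>b\<in>D. a b * M b c)"
    using matrix_rank_basis[OF assms(1), of M] by metis
  have "card B \<le> card D"
    by (rule indep_rows_card_le[of B M D M]) (use assms D finite_subset in auto)
  then show ?thesis using D by simp
qed

lemma matrix_rank_le_if_spanned:
  assumes "finite R" "\<And>r. r \<in> Q \<Longrightarrow> \<exists>a. \<forall>c. N r c = (\<Sum>s\<in>R. a s * M s c)"
  shows "matrix_rank Q N \<le> matrix_rank R M"
proof -
  obtain D where D: "D \<subseteq> R" "card D = matrix_rank R M" 
    "\<And>r. r \<in> R \<Longrightarrow> \<exists>a. \<forall>c. M r c = (\<Sum>b\<in>D. a b * M b c)"
    using matrix_rank_basis[OF assms(1), of M] by metis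
  have fD: "finite D" using D assms finite_subset by blast
  have "M ` R \<subseteq> fun_space.span (M ` D)" using D(3) by (auto simp: in_span_rows_iff[OF fD])
  then have "fun_space.span (M ` R) \<subseteq> fun_space.span (M ` D)"
    by (simp add: fun_space.span_minimal)
  moreover have "N ` Q \<subseteq> fun_space.span (M ` R)" using assms by (auto simp: in_span_rows_iff)
  ultimately have "N r \<in> fun_space.span (M ` D)" if "r \<in> Q" for r using that by blast
  then have "matrix_rank Q N \<le> card D"
    by (intro matrix_rank_le[of D Q N M] fD) (simp add: in_span_rows_iff[OF fD])
  then show ?thesis using D by simp
qed

text \<open>
  Gaussian elimination: an equation with a nonzero coefficient eliminates one unknown from all the others.
  This counting principle replaces rank-nullity throughout. The equations form a set of coefficient functions,
  so that equations of several kinds can be collected in one union.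
\<close>

lemma homogeneous_system_nontrivial_solution:
  fixes E :: "('c \<Rightarrow> real) set"
  assumes "finite E" "finite C" "card E < card C"
  obtains y where "\<exists>c\<in>C. y c \<noteq> 0" "\<And>c. c \<notin> C \<Longrightarrow> y c = 0" "\<And>e. e \<in> E \<Longrightarrow> (\<Sum>c\<in>C. e c * y c) = 0"
proof -
  have "\<exists>y. (\<exists>c\<in>C. y c \<noteq> 0) \<and> (\<forall>c. c \<notin> C \<longrightarrow> y c = 0) \<and> (\<forall>e\<in>E. (\<Sum>c\<in>C. e c * y c) = 0)"
    if "finite E" "finite C" "card E \<le> n" "n < card C" for n and E :: "('c \<Rightarrow> real) set" and C
    using that
  proof (induction n arbitrary: E C)
    case 0
    then obtain c where "c \<in> C" by (metis card_gt_0_iff equals0I)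
    then show ?case using 0 by (intro exI[of _ "\<lambda>d. if d = c then 1 else 0"]) auto
  next
    case (Suc n)
    show ?case
    proof (cases "\<exists>r\<in>E. \<exists>d\<in>C. r d \<noteq> 0")
      case False
      obtain c where "c \<in> C" using Suc.prems by (metis card_gt_0_iff equals0I gr_zeroI not_less0)
      then show ?thesis using False by (intro exI[of _ "\<lambda>d. if d = c then 1 else 0"]) auto
    next
      case True
      then obtain r d where r: "r \<in> E" and d: "d \<in> C" "r d \<noteq> 0" by blast
      \<comment> \<open>The equation \<open>r\<close> is solved for the unknown \<open>d\<close>.\<close>
      let ?f = "\<lambda>e c. e c - e d * r c / r d"
      have "card (?f ` (E - {r})) \<le> card (E - {r})" using Suc.prems(1) by (intro card_image_le) simp
      also have "\<dots> \<le> n" using Suc.prems r by simp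
      finally have "card (?f ` (E - {r})) \<le> n" .
      moreover have "n < card (C - {d})" using Suc.prems d by simp
      ultimately obtain y where y: "\<exists>c\<in>C - {d}. y c \<noteq> 0" "\<forall>c. c \<notin> C - {d} \<longrightarrow> y c = 0"
        "\<forall>e\<in>?f ` (E - {r}). (\<Sum>c\<in>C - {d}. e c * y c) = 0"
        using Suc.IH[of "?f ` (E - {r})" "C - {d}"] Suc.prems by auto
      let ?s = "- (\<Sum>c\<in>C - {d}. r c * y c) / r d"
      let ?y = "y(d := ?s)"
      have sm: "(\<Sum>c\<in>C. e c * ?y c) = e d * ?s + (\<Sum>c\<in>C - {d}. e c * y c)" for e
        using d Suc.prems by (simp add: sum.remove[of C d])
      have "(\<Sum>c\<in>C. r c * ?y c) = 0" unfolding sm using d by simp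
      moreover have "(\<Sum>c\<in>C. e c * ?y c) = 0" if "e \<in> E - {r}" for e
      proof -
        have "0 = (\<Sum>c\<in>C - {d}. ?f e c * y c)" using y(3) that by auto
        also have "\<dots> = (\<Sum>c\<in>C - {d}. e c * y c - (e d / r d) * (r c * y c))"
          by (intro sum.cong) (auto simp: algebra_simps)
        also have "\<dots> = (\<Sum>c\<in>C - {d}. e c * y c) - e d / r d * (\<Sum>c\<in>C - {d}. r c * y c)"
          by (simp add: sum_subtractf sum_distrib_left)
        finally show ?thesis unfolding sm by simp
      qed
      moreover have "\<exists>c\<in>C. ?y c \<noteq> 0" using y(1) by auto
      moreover have "\<forall>c. c \<notin> C \<longrightarrow> ?y c = 0" using y(2) d by auto
      ultimately show ?thesis by (intro exI[of _ ?y]) blast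
    qed
  qed
  from this[of E C "card E"] assms that show ?thesis by auto
qed

section \<open>Rank under perturbation\<close>

text \<open>
  Gram-Schmidt orthogonalisation for the pairing \<open>\<Sum>c\<in>C. x c * y c\<close>.
\<close>

lemma orthogonal_residual:
  fixes M :: "'r \<Rightarrow> 'c \<Rightarrow> real"
  assumes "finite B" "finite C"
  obtains a where "\<And>e. e \<in> B \<Longrightarrow> (\<Sum>c\<in>C. (v c - (\<Sum>b\<in>B. a b * M b c)) * M e c) = 0"
proof -
  have "\<exists>a. \<forall>e\<in>B. (\<Sum>c\<in>C. (v c - (\<Sum>b\<in>B. a b * M b c)) * M e c) = 0"
    using assms(1)
  proof (induction B arbitrary: v)
    case empty
    then show ?case by simp
  next
    case (insert f B)
    obtain a where a: "\<forall>e\<in>B. (\<Sum>c\<in>C. (v c - (\<Sum>b\<in>B. a b * M b c)) * M e c) = 0"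
      using insert.IH by blast
    obtain d where d: "\<forall>e\<in>B. (\<Sum>c\<in>C. (M f c - (\<Sum>b\<in>B. d b * M b c)) * M e c) = 0"
      using insert.IH by blast
    define x where "x = (\<lambda>c. v c - (\<Sum>b\<in>B. a b * M b c))"
    define y where "y = (\<lambda>c. M f c - (\<Sum>b\<in>B. d b * M b c))"
    define q where "q = (\<Sum>c\<in>C. x c * y c) / (\<Sum>c\<in>C. y c * y c)"
    have xB: "(\<Sum>c\<in>C. x c * M e c) = 0" if "e \<in> B" for e using a that by (simp add: x_def)
    have yB: "(\<Sum>c\<in>C. y c * M e c) = 0" if "e \<in> B" for e using d that by (simp add: y_def)
    have q: "(\<Sum>c\<in>C. x c * y c) = q * (\<Sum>c\<in>C. y c * y c)"
    proof (cases "(\<Sum>c\<in>C. y c * y c) = 0")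
      case True
      then have "\<forall>c\<in>C. y c = 0" using assms(2) by (simp add: sum_nonneg_eq_0_iff)
      then show ?thesis by simp
    qed (simp add: q_def)
    have f_split: "M f c = y c + (\<Sum>b\<in>B. d b * M b c)" for c by (simp add: y_def)
    have span0: "(\<Sum>c\<in>C. w c * (\<Sum>b\<in>B. d b * M b c)) = 0" 
      if "\<And>e. e \<in> B \<Longrightarrow> (\<Sum>c\<in>C. w c * M e c) = 0" for w
    proof -
      have "(\<Sum>c\<in>C. w c * (\<Sum>b\<in>B. d b * M b c)) = (\<Sum>b\<in>B. d b * (\<Sum>c\<in>C. w c * M b c))"
        by (simp add: sum_distrib_left sum.swap[of _ C B] mult.left_commute)
      then show ?thesis using that by simp
    qed
    define w where "w = (\<lambda>c. x c - q * y c)"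
    have wB: "(\<Sum>c\<in>C. w c * M e c) = 0" if "e \<in> B" for e
    proof -
      have "(\<Sum>c\<in>C. w c * M e c) = (\<Sum>c\<in>C. x c * M e c) - q * (\<Sum>c\<in>C. y c * M e c)"
        by (simp add: w_def algebra_simps sum_subtractf sum_distrib_left)
      then show ?thesis using xB yB that by simp
    qed
    have wf: "(\<Sum>c\<in>C. w c * M f c) = 0"
    proof -
      have "(\<Sum>c\<in>C. w c * M f c) = (\<Sum>c\<in>C. w c * y c) + (\<Sum>c\<in>C. w c * (\<Sum>b\<in>B. d b * M b c))"
        by (simp add: f_split algebra_simps sum.distrib)
      also have "\<dots> = (\<Sum>c\<in>C. w c * y c)" using span0[of w] wB by simp
      also have "\<dots> = (\<Sum>c\<in>C. x c * y c) - q * (\<Sum>c\<in>C. y c * y c)"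
        by (simp add: w_def algebra_simps sum_subtractf sum_distrib_left)
      finally show ?thesis using q by simp
    qed
    define a' where "a' = (\<lambda>b. if b = f then q else a b - q * d b)"
    have "v c - (\<Sum>b\<in>insert f B. a' b * M b c) = w c" for c
    proof -
      have "(\<Sum>b\<in>B. a' b * M b c) = (\<Sum>b\<in>B. a b * M b c) - q * (\<Sum>b\<in>B. d b * M b c)"
      proof -
        have "(\<Sum>b\<in>B. a' b * M b c) = (\<Sum>b\<in>B. a b * M b c - q * (d b * M b c))"
          using insert.hyps by (intro sum.cong) (auto simp: a'_def algebra_simps)
        then show ?thesis by (simp add: sum_subtractf sum_distrib_left)
      qed
      then show ?thesis using insert.hyps
        by (simp add: w_def x_def y_def a'_def algebra_simps)
    qed
    then show ?case using wB wf by (intro exI[of _ a']) simp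
  qed
  then show ?thesis using that by blast
qed

text \<open>
  Up to scaling, the dual vector of the row \<open>f\<close> is its residual with respect to the other rows; it is nonzero
  because the rows are independent.
\<close>

lemma dual_family:
  fixes M :: "'r \<Rightarrow> 'c \<Rightarrow> real"
  assumes "finite B" "finite C" "indep_rows B M" "\<And>r c. r \<in> B \<Longrightarrow> c \<notin> C \<Longrightarrow> M r c = 0" "f \<in> B"
  shows "\<exists>y. \<forall>e\<in>B. (\<Sum>c\<in>C. M e c * y c) = (if e = f then 1 else 0)"
proof -
  obtain a where a: "\<And>e. e \<in> B - {f} \<Longrightarrow> (\<Sum>c\<in>C. (M f c - (\<Sum>b\<in>B - {f}. a b * M b c)) * M e c) = 0"
    using orthogonal_residual[of "B - {f}" C "M f" M] assms by auto
  define w where "w = (\<lambda>c. M f c - (\<Sum>b\<in>B - {f}. a b * M b c))"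
  have wB: "(\<Sum>c\<in>C. M e c * w c) = 0" if "e \<in> B - {f}" for e
    using a[OF that] by (simp add: w_def mult.commute)
  have ww: "(\<Sum>c\<in>C. M f c * w c) = (\<Sum>c\<in>C. w c * w c)"
  proof -
    have "(\<Sum>c\<in>C. M f c * w c) = (\<Sum>c\<in>C. w c * w c) + (\<Sum>c\<in>C. w c * (\<Sum>b\<in>B - {f}. a b * M b c))"
      by (simp add: w_def algebra_simps flip: sum.distrib)
    also have "(\<Sum>c\<in>C. w c * (\<Sum>b\<in>B - {f}. a b * M b c)) = (\<Sum>b\<in>B - {f}. a b * (\<Sum>c\<in>C. M b c * w c))"
      by (simp add: sum_distrib_left sum.swap[of _ C "B - {f}"] mult.left_commute mult.commute)
    finally show ?thesis using wB by simp
  qed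
  have "(\<Sum>c\<in>C. w c * w c) \<noteq> 0"
  proof
    assume "(\<Sum>c\<in>C. w c * w c) = 0"
    then have 0: "\<forall>c\<in>C. w c = 0" using assms(2) by (simp add: sum_nonneg_eq_0_iff)
    have "(\<Sum>b\<in>B. (if b = f then 1 else - a b) * M b c) = 0" for c
    proof -
      have "(\<Sum>b\<in>B. (if b = f then 1 else - a b) * M b c) = w c"
        using assms(1,5) by (simp add: sum.remove[of B f] w_def sum_negf)
      also have "\<dots> = 0" 
      proof (cases "c \<in> C")
        case False
        then show ?thesis using assms(4,5) by (auto simp: w_def intro!: sum.neutral)
      qed (use 0 in simp)
      finally show ?thesis .
    qed
    then have "\<forall>b\<in>B. (if b = f then 1 else - a b) = 0"
      using assms(3) unfolding indep_rows_def by (elim allE[of _ "\<lambda>b. if b = f then 1 else - a b"]) blast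
    then show False using assms(5) by auto
  qed
  then show ?thesis using wB ww
    by (intro exI[of _ "\<lambda>c. w c / (\<Sum>c\<in>C. w c * w c)"]) (auto simp: sum_divide_distrib[symmetric])
qed

text \<open>
  Pairing a maximal independent family of rows with its dual family gives the identity matrix. For a nearby
  matrix the same pairing is diagonally dominant, so the corresponding rows stay independent.
\<close>

lemma matrix_rank_lower_semicontinuous:
  fixes M :: "'r \<Rightarrow> 'c \<Rightarrow> real"
  assumes "finite R" "finite C" "\<And>r c. r \<in> R \<Longrightarrow> c \<notin> C \<Longrightarrow> M r c = 0"
  obtains \<delta> where "\<delta> > 0"
    "\<And>M'. (\<And>r c. r \<in> R \<Longrightarrow> c \<in> C \<Longrightarrow> \<bar>M' r c - M r c\<bar> \<le> \<delta>) \<Longrightarrow> matrix_rank R M \<le> matrix_rank R M'"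
proof -
  obtain B where B: "B \<subseteq> R" "card B = matrix_rank R M" "indep_rows B M"
    using matrix_rank_basis[OF assms(1), of M] by metis
  have fB: "finite B" using B assms finite_subset by blast
  have "\<forall>f\<in>B. \<exists>y. \<forall>e\<in>B. (\<Sum>c\<in>C. M e c * y c) = (if e = f then 1 else 0)"
    using dual_family[OF fB assms(2) B(3)] assms(3) B(1) by blast
  then obtain Y where Y: "\<And>f e. f \<in> B \<Longrightarrow> e \<in> B \<Longrightarrow> (\<Sum>c\<in>C. M e c * Y f c) = (if e = f then 1 else 0)"
    by metis
  \<comment> \<open>\<open>\<delta>\<close> keeps the sum of the errors in each row of the paired matrix below 1.\<close>
  define K where "K = (\<Sum>f\<in>B. \<Sum>c\<in>C. \<bar>Y f c\<bar>)"
  define \<delta> where "\<delta> = 1 / (2 * (real (card B) + 1) * (K + 1))"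
  have K0: "K \<ge> 0" unfolding K_def by (intro sum_nonneg) auto
  have d0: "\<delta> > 0" using K0 by (simp add: \<delta>_def)
  have dK: "real (card B) * (\<delta> * K) < 1"
  proof -
    have "\<delta> * ((real (card B) + 1) * (K + 1)) = 1/2"
    proof -
      have "(real (card B) + 1) * (K + 1) \<noteq> 0" using K0 by auto
      then show ?thesis by (simp add: \<delta>_def mult.assoc)
    qed
    moreover have "real (card B) * K \<le> (real (card B) + 1) * (K + 1)" using K0 by (intro mult_mono) auto
    ultimately have "\<delta> * (real (card B) * K) \<le> 1/2" using d0 by (metis mult_left_mono less_imp_le)
    then show ?thesis by (simp add: mult.left_commute)
  qed
  have "matrix_rank R M \<le> matrix_rank R M'"
    if close: "\<And>r c. r \<in> R \<Longrightarrow> c \<in> C \<Longrightarrow> \<bar>M' r c - M r c\<bar> \<le> \<delta>" for M'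
  proof -
    have "indep_rows B M'" unfolding indep_rows_def
    proof (intro allI impI, rule ccontr)
      fix a assume a: "\<forall>c. (\<Sum>r\<in>B. a r * M' r c) = 0" and nz: "\<not> (\<forall>r\<in>B. a r = 0)"
      then have ne: "B \<noteq> {}" by auto
      define m where "m = Max ((\<lambda>r. \<bar>a r\<bar>) ` B)"
      have "m \<in> (\<lambda>r. \<bar>a r\<bar>) ` B" unfolding m_def using fB ne by (intro Max_in) auto
      \<comment> \<open>The row with the largest coefficient cannot be cancelled by the errors.\<close>
      then obtain f where f: "f \<in> B" "\<bar>a f\<bar> = m" by auto
      have le: "\<bar>a r\<bar> \<le> m" if "r \<in> B" for r unfolding m_def using fB that by (intro Max_ge) auto
      have m0: "m > 0" using nz le by (metis abs_ge_zero abs_le_zero_iff less_le order_antisym_conv order_trans)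
      have KY: "(\<Sum>c\<in>C. \<bar>Y f c\<bar>) \<le> K" unfolding K_def
        using f fB by (intro member_le_sum) (auto intro: sum_nonneg)
      have "0 = (\<Sum>c\<in>C. (\<Sum>r\<in>B. a r * M' r c) * Y f c)" using a by simp
      also have "\<dots> = (\<Sum>r\<in>B. a r * (\<Sum>c\<in>C. M' r c * Y f c))"
        by (simp add: sum_distrib_left sum_distrib_right sum.swap[of _ C B] mult.assoc)
      also have "\<dots> = (\<Sum>r\<in>B. a r * (\<Sum>c\<in>C. M r c * Y f c)) + (\<Sum>r\<in>B. a r * (\<Sum>c\<in>C. (M' r c - M r c) * Y f c))"
        by (simp add: sum_distrib_left algebra_simps flip: sum.distrib)
      also have "(\<Sum>r\<in>B. a r * (\<Sum>c\<in>C. M r c * Y f c)) = (\<Sum>r\<in>B. if r = f then a r else 0)"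
        using Y f by (intro sum.cong) auto
      also have "\<dots> = a f" using f fB by simp
      finally have "\<bar>a f\<bar> = \<bar>\<Sum>r\<in>B. a r * (\<Sum>c\<in>C. (M' r c - M r c) * Y f c)\<bar>" by linarith
      also have "\<dots> \<le> (\<Sum>r\<in>B. \<bar>a r * (\<Sum>c\<in>C. (M' r c - M r c) * Y f c)\<bar>)" by (rule sum_abs)
      also have "\<dots> \<le> (\<Sum>r\<in>B. m * (\<delta> * K))"
      proof (intro sum_mono)
        fix r assume r: "r \<in> B"
        have "\<bar>\<Sum>c\<in>C. (M' r c - M r c) * Y f c\<bar> \<le> (\<Sum>c\<in>C. \<bar>(M' r c - M r c) * Y f c\<bar>)" by (rule sum_abs)
        also have "\<dots> \<le> (\<Sum>c\<in>C. \<delta> * \<bar>Y f c\<bar>)"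
          using close r B(1) by (intro sum_mono) (auto simp: abs_mult intro!: mult_right_mono)
        also have "\<dots> \<le> \<delta> * K" using KY d0 by (simp add: sum_distrib_left[symmetric])
        finally show "\<bar>a r * (\<Sum>c\<in>C. (M' r c - M r c) * Y f c)\<bar> \<le> m * (\<delta> * K)"
          using le[OF r] by (auto simp: abs_mult intro!: mult_mono)
      qed
      also have "\<dots> = m * (real (card B) * (\<delta> * K))" by (simp add: algebra_simps)
      also have "\<dots> < m" using dK m0 by simp
      finally show False using f by simp
    qed
    then show ?thesis using card_le_matrix_rank[OF assms(1) B(1)] B(2) by metis
  qed
  with d0 that show ?thesis by blast
qed

lemma matrix_rank_pencil_ge:
  fixes M N :: "'r \<Rightarrow> 'c \<Rightarrow> real"
  assumes "finite R" "finite C" "\<And>r c. r \<in> R \<Longrightarrow> c \<notin> C \<Longrightarrow> M r c = 0"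
  shows "\<forall>\<^sub>F t in at 0. matrix_rank R M \<le> matrix_rank R (\<lambda>r c. M r c + t * N r c)"
proof -
  obtain \<delta> where d: "\<delta> > 0"
    "\<And>M'. (\<And>r c. r \<in> R \<Longrightarrow> c \<in> C \<Longrightarrow> \<bar>M' r c - M r c\<bar> \<le> \<delta>) \<Longrightarrow> matrix_rank R M \<le> matrix_rank R M'"
    using matrix_rank_lower_semicontinuous[of R C M] assms by metis
  have "\<forall>\<^sub>F t in at (0::real). \<forall>x\<in>R \<times> C. \<bar>t * N (fst x) (snd x)\<bar> < \<delta>"
  proof (intro eventually_ball_finite ballI)
    fix x
    have "((\<lambda>t::real. \<bar>t * N (fst x) (snd x)\<bar>) \<longlongrightarrow> \<bar>0 * N (fst x) (snd x)\<bar>) (at 0)"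
      by (intro tendsto_intros)
    then show "\<forall>\<^sub>F t in at (0::real). \<bar>t * N (fst x) (snd x)\<bar> < \<delta>" using d(1) by (auto dest: order_tendstoD)
  qed (use assms in simp)
  then show ?thesis
  proof eventually_elim
    case (elim t)
    then show ?case by (intro d(2)) force
  qed
qed

text \<open>
  If the rank of \<open>M + t N\<close> does not exceed that of \<open>M\<close> near \<open>t = 0\<close>, then \<open>N\<close> pairs the left kernel of
  \<open>M\<close> with the right kernel of \<open>M\<close> to zero. The reason: for \<open>t \<noteq> 0\<close> the row combination
  \<open>l (M + t N) / t = l N\<close> lies in the row space and does not depend on \<open>t\<close>; in the limit it is independent of the rows
  of \<open>M\<close>, because \<open>z\<close> annihilates those but not \<open>l N\<close>.
\<close>

lemma matrix_rank_pencil_gt: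
  fixes M N :: "'r \<Rightarrow> 'c \<Rightarrow> real"
  assumes "finite R" "finite C"
    and M0: "\<And>r c. r \<in> R \<Longrightarrow> c \<notin> C \<Longrightarrow> M r c = 0" and N0: "\<And>r c. r \<in> R \<Longrightarrow> c \<notin> C \<Longrightarrow> N r c = 0"
    and left: "\<And>c. (\<Sum>r\<in>R. l r * M r c) = 0"
    and right: "\<And>r. r \<in> R \<Longrightarrow> (\<Sum>c\<in>C. M r c * z c) = 0"
    and nz: "(\<Sum>r\<in>R. l r * (\<Sum>c\<in>C. N r c * z c)) \<noteq> 0"
  shows "\<forall>\<^sub>F t in at 0. matrix_rank R M < matrix_rank R (\<lambda>r c. M r c + t * N r c)"
proof -
  define n where "n = (\<lambda>c. \<Sum>r\<in>R. l r * N r c)"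
  \<comment> \<open>The row \<open>None\<close> is the additional row \<open>l N\<close>.\<close>
  define R' where "R' = insert None (Some ` R)"
  define M' where "M' = (\<lambda>r c. case r of None \<Rightarrow> n c | Some r \<Rightarrow> M r c)"
  define N' where "N' = (\<lambda>r c. case r of None \<Rightarrow> (0::real) | Some r \<Rightarrow> N r c)"
  have fR': "finite R'" using assms by (simp add: R'_def)
  have M'0: "M' r c = 0" if "r \<in> R'" "c \<notin> C" for r c
    using that M0 N0 by (auto simp: R'_def M'_def n_def)
  obtain B where B: "B \<subseteq> R" "card B = matrix_rank R M" "indep_rows B M"
    using matrix_rank_basis[OF assms(1), of M] by metis
  have fB: "finite B" using B assms finite_subset by blast
  have nzn: "(\<Sum>c\<in>C. n c * z c) \<noteq> 0"
  proof -
    have "(\<Sum>c\<in>C. n c * z c) = (\<Sum>r\<in>R. l r * (\<Sum>c\<in>C. N r c * z c))"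
      by (simp add: n_def sum_distrib_left sum_distrib_right sum.swap[of _ C R] mult.assoc)
    then show ?thesis using nz by simp
  qed
  have sumB': "(\<Sum>r\<in>insert None (Some ` B). a r * M' r c) = a None * n c + (\<Sum>r\<in>B. a (Some r) * M r c)" for a c
    using fB by (simp add: M'_def sum.reindex)
  have "indep_rows (insert None (Some ` B)) M'" unfolding indep_rows_def
  proof (intro allI impI)
    fix a assume "\<forall>c. (\<Sum>r\<in>insert None (Some ` B). a r * M' r c) = 0"
    then have a: "a None * n c + (\<Sum>r\<in>B. a (Some r) * M r c) = 0" for c by (simp add: sumB')
    have "0 = (\<Sum>c\<in>C. (a None * n c + (\<Sum>r\<in>B. a (Some r) * M r c)) * z c)" using a by simp
    also have "\<dots> = a None * (\<Sum>c\<in>C. n c * z c) + (\<Sum>r\<in>B. a (Some r) * (\<Sum>c\<in>C. M r c * z c))"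
      by (simp add: sum_distrib_left sum_distrib_right sum.swap[of _ C B] mult.assoc sum.distrib distrib_right)
    also have "\<dots> = a None * (\<Sum>c\<in>C. n c * z c)" using right B(1) by (simp add: subset_iff)
    finally have N: "a None = 0" using nzn by simp
    then have "\<forall>c. (\<Sum>r\<in>B. a (Some r) * M r c) = 0" using a by simp
    then have "\<forall>r\<in>B. a (Some r) = 0"
      using B(3) unfolding indep_rows_def by (elim allE[of _ "\<lambda>r. a (Some r)"]) blast
    then show "\<forall>r\<in>insert None (Some ` B). a r = 0" using N by auto
  qed
  then have "card (insert None (Some ` B)) \<le> matrix_rank R' M'"
    using B(1) fR' by (intro card_le_matrix_rank) (auto simp: R'_def)
  then have big: "matrix_rank R M < matrix_rank R' M'"
    using fB B(2) by (simp add: card_image)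
  have "\<forall>\<^sub>F t in at 0. matrix_rank R' M' \<le> matrix_rank R' (\<lambda>r c. M' r c + t * N' r c)"
    using matrix_rank_pencil_ge[OF fR' assms(2) M'0] .
  moreover have "\<forall>\<^sub>F t in at (0::real). t \<noteq> 0" by (simp add: eventually_at_filter)
  ultimately show ?thesis
  proof eventually_elim
    case (elim t)
    have "matrix_rank R' (\<lambda>r c. M' r c + t * N' r c) \<le> matrix_rank R (\<lambda>r c. M r c + t * N r c)"
    proof (rule matrix_rank_le_if_spanned[OF assms(1)])
      fix r assume r: "r \<in> R'"
      show "\<exists>a. \<forall>c. M' r c + t * N' r c = (\<Sum>s\<in>R. a s * (M s c + t * N s c))"
      proof (cases r)
        case None
        have "(\<Sum>s\<in>R. (l s / t) * (M s c + t * N s c)) = n c" for c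
        proof -
          have "(\<Sum>s\<in>R. (l s / t) * (M s c + t * N s c)) = (\<Sum>s\<in>R. l s * M s c / t + l s * N s c)"
            using elim(2) by (intro sum.cong) (auto simp: field_simps)
          also have "\<dots> = (\<Sum>s\<in>R. l s * M s c) / t + n c"
            by (simp add: n_def sum.distrib sum_divide_distrib)
          finally have "(\<Sum>s\<in>R. (l s / t) * (M s c + t * N s c)) = (\<Sum>s\<in>R. l s * M s c) / t + n c" .
          then show ?thesis using left by simp
        qed
        then show ?thesis using None by (intro exI[of _ "\<lambda>s. l s / t"]) (simp add: M'_def N'_def)
      next
        case (Some s)
        then have "s \<in> R" using r by (auto simp: R'_def)
        have "(\<Sum>x\<in>R. (if x = s then 1 else 0) * (M x c + t * N x c)) = M s c + t * N s c" for c
        proof -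
          have "(\<Sum>x\<in>R. (if x = s then 1 else 0) * (M x c + t * N x c)) = (\<Sum>x\<in>R. if x = s then M x c + t * N x c else 0)"
            by (intro sum.cong) auto
          then show ?thesis using assms(1) \<open>s \<in> R\<close> by simp
        qed
        then show ?thesis using Some by (intro exI[of _ "\<lambda>x. if x = s then 1 else 0"]) (simp add: M'_def N'_def)
      qed
    qed
    then show ?case using big elim(1) by linarith
  qed
qed

section \<open>Force systems on bodies\<close>

text \<open>
  Rotation by a right angle, which exchanges infinitesimal motions and parallel redrawings.
\<close>

definition perp :: "real ^ 2 \<Rightarrow> real ^ 2" where
  "perp a = (\<chi> i. if i = 1 then - a $ 2 else a $ 1)"

definition cross2 :: "real ^ 2 \<Rightarrow> real ^ 2 \<Rightarrow> real" where
  "cross2 a b = a $ 1 * b $ 2 - a $ 2 * b $ 1"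

lemma perp_nth [simp]: "perp a $ 1 = - a $ 2" "perp a $ 2 = a $ 1"
  by (simp_all add: perp_def)

lemma inner_2: "(a :: real ^ 2) \<bullet> b = a $ 1 * b $ 1 + a $ 2 * b $ 2"
  by (simp add: inner_vec_def sum_2)

lemma vec_eq_2: "(a :: real ^ 2) = b \<longleftrightarrow> a $ 1 = b $ 1 \<and> a $ 2 = b $ 2"
  by (simp add: vec_eq_iff forall_2)

text \<open>
  \<open>Inc\<close> is a set of incidences \<open>(i, x)\<close> of bodies and points, and \<open>g i x\<close> is the force exerted by the body \<open>i\<close> at the
  point \<open>x\<close>. As everything is rotated by a right angle, the moment of a force is its inner product with
  the position vector.
\<close>

definition balanced :: "('i \<times> 'a) set \<Rightarrow> ('a \<Rightarrow> real ^ 2) \<Rightarrow> ('i \<Rightarrow> 'a \<Rightarrow> real ^ 2) \<Rightarrow> bool" where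
  "balanced Inc p g \<longleftrightarrow>
     (\<forall>i x. (i, x) \<notin> Inc \<longrightarrow> g i x = 0) \<and>
     (\<forall>x. (\<Sum>i\<in>fst ` Inc. g i x) = 0) \<and>
     (\<forall>i. (\<Sum>x\<in>snd ` Inc. g i x) = 0) \<and>
     (\<forall>i. (\<Sum>x\<in>snd ` Inc. g i x \<bullet> p x) = 0)"

text \<open>
  The kernel of this matrix describes the redrawings that act on each body as a dilation: the row of
  \<open>((i, x), l)\<close> is the \<open>l\<close>-th coordinate of \<open>y x + \<tau> i + \<gamma> i p x = 0\<close> with unknowns \<open>y\<close>, \<open>\<tau>\<close> and
  \<open>\<gamma>\<close>. Its left kernel consists of the balanced force systems. The matrix is affine in \<open>p\<close>, with linear part
  \<open>body_matrix_linear\<close>.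
\<close>

definition body_matrix :: "('a \<Rightarrow> real ^ 2) \<Rightarrow> ('i \<times> 'a) \<times> 2 \<Rightarrow> 'a \<times> 2 + 'i \<times> 2 + 'i \<Rightarrow> real" where
  "body_matrix p = (\<lambda>((i, x), l) c. case c of
      Inl y \<Rightarrow> if y = (x, l) then 1 else 0
    | Inr (Inl j) \<Rightarrow> if j = (i, l) then 1 else 0
    | Inr (Inr j) \<Rightarrow> if j = i then p x $ l else 0)"

definition body_matrix_linear :: "('a \<Rightarrow> real ^ 2) \<Rightarrow> ('i \<times> 'a) \<times> 2 \<Rightarrow> 'a \<times> 2 + 'i \<times> 2 + 'i \<Rightarrow> real" where
  "body_matrix_linear k = (\<lambda>((i, x), l) c. case c of
      Inr (Inr j) \<Rightarrow> if j = i then k x $ l else 0 | _ \<Rightarrow> 0)"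

lemma body_matrix_shift:
  "body_matrix (\<lambda>x. p x + t *\<^sub>R k x) = (\<lambda>r c. body_matrix p r c + t * body_matrix_linear k r c)"
  by (auto simp: body_matrix_def body_matrix_linear_def fun_eq_iff split: sum.splits)

definition body_columns :: "('i \<times> 'a) set \<Rightarrow> ('a \<times> 2 + 'i \<times> 2 + 'i) set" where
  "body_columns Inc = (snd ` Inc \<times> UNIV) <+> (fst ` Inc \<times> UNIV) <+> (fst ` Inc)"

lemma finite_body_columns: "finite Inc \<Longrightarrow> finite (body_columns Inc)"
  by (simp add: body_columns_def)

lemma body_matrix_eq_0:
  assumes "r \<in> Inc \<times> UNIV" "c \<notin> body_columns Inc"
  shows "body_matrix p r c = 0" "body_matrix_linear p r c = 0"
  using assms
  by (force simp: body_matrix_def body_matrix_linear_def body_columns_def split: sum.splits)+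

lemma sum_body_columns:
  assumes "finite Inc"
  shows "(\<Sum>c\<in>body_columns Inc. f c) = (\<Sum>y\<in>snd ` Inc \<times> UNIV. f (Inl y)) +
    (\<Sum>j\<in>fst ` Inc \<times> UNIV. f (Inr (Inl j))) + (\<Sum>j\<in>fst ` Inc. f (Inr (Inr j)))"
  using assms by (simp add: body_columns_def sum.Plus add.assoc)

lemma sum_delta_mult:
  fixes f :: "'b \<Rightarrow> real"
  assumes "finite A" "a \<in> A"
  shows "(\<Sum>x\<in>A. (if x = a then v else 0) * f x) = v * f a"
proof -
  have "(\<Sum>x\<in>A. (if x = a then v else 0) * f x) = (\<Sum>x\<in>A. if x = a then v * f x else 0)"
    by (intro sum.cong) auto
  then show ?thesis using assms by simp
qed

lemma sum_body_matrix_row: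
  assumes "finite Inc" "(i, x) \<in> Inc"
  shows "(\<Sum>c\<in>body_columns Inc. body_matrix p ((i, x), l) c * f c) =
      f (Inl (x, l)) + f (Inr (Inl (i, l))) + p x $ l * f (Inr (Inr i))"
    and "(\<Sum>c\<in>body_columns Inc. body_matrix_linear p ((i, x), l) c * f c) = p x $ l * f (Inr (Inr i))"
proof -
  have i: "i \<in> fst ` Inc" and x: "x \<in> snd ` Inc" using assms by force+
  show "(\<Sum>c\<in>body_columns Inc. body_matrix p ((i, x), l) c * f c) =
      f (Inl (x, l)) + f (Inr (Inl (i, l))) + p x $ l * f (Inr (Inr i))"
    using assms i x unfolding sum_body_columns[OF assms(1)]
    by (simp add: body_matrix_def sum_delta_mult)
  show "(\<Sum>c\<in>body_columns Inc. body_matrix_linear p ((i, x), l) c * f c) = p x $ l * f (Inr (Inr i))"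
    using assms i x unfolding sum_body_columns[OF assms(1)]
    by (simp add: body_matrix_linear_def sum_delta_mult)
qed

lemma sum_incidence:
  fixes f :: "'i \<Rightarrow> 'a \<Rightarrow> 'b :: comm_monoid_add"
  assumes "finite Inc" "\<And>i x. (i, x) \<notin> Inc \<Longrightarrow> f i x = 0"
  shows "(\<Sum>(i, x)\<in>Inc. f i x) = (\<Sum>i\<in>fst ` Inc. \<Sum>x\<in>snd ` Inc. f i x)"
    and "(\<Sum>(i, x)\<in>Inc. f i x) = (\<Sum>x\<in>snd ` Inc. \<Sum>i\<in>fst ` Inc. f i x)"
proof -
  have "(\<Sum>(i, x)\<in>Inc. f i x) = (\<Sum>(i, x)\<in>fst ` Inc \<times> snd ` Inc. f i x)"
    using assms by (intro sum.mono_neutral_left) (auto intro: rev_image_eqI)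
  then show "(\<Sum>(i, x)\<in>Inc. f i x) = (\<Sum>i\<in>fst ` Inc. \<Sum>x\<in>snd ` Inc. f i x)"
    by (simp add: sum.cartesian_product)
  then show "(\<Sum>(i, x)\<in>Inc. f i x) = (\<Sum>x\<in>snd ` Inc. \<Sum>i\<in>fst ` Inc. f i x)"
    by (simp add: sum.swap[of _ "fst ` Inc"])
qed

lemma balanced_left_kernel:
  assumes "finite Inc" "balanced Inc p g"
  shows "(\<Sum>r\<in>Inc \<times> UNIV. g (fst (fst r)) (snd (fst r)) $ snd r * body_matrix p r c) = 0"
proof -
  have g0: "g i x = 0" if "(i, x) \<notin> Inc" for i x using assms(2) that by (simp add: balanced_def)
  have *: "(\<Sum>r\<in>Inc \<times> UNIV. g (fst (fst r)) (snd (fst r)) $ snd r * body_matrix p r c) =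
    (\<Sum>(i, x)\<in>Inc. \<Sum>l\<in>UNIV. g i x $ l * body_matrix p ((i, x), l) c)"
    by (simp add: sum.cartesian_product' case_prod_beta)
  consider y m where "c = Inl (y, m)" | j m where "c = Inr (Inl (j, m))" | j where "c = Inr (Inr j)"
    by (metis sum.exhaust surj_pair)
  then show ?thesis
  proof cases
    case 1
    have "(\<Sum>l\<in>UNIV. g i x $ l * body_matrix p ((i, x), l) c) = (if x = y then g i x $ m else 0)" for i x
    proof -
      have "(\<Sum>l\<in>UNIV. g i x $ l * body_matrix p ((i, x), l) c) =
          (\<Sum>l\<in>UNIV. if l = m then (if x = y then g i x $ l else 0) else 0)"
        by (intro sum.cong) (auto simp: body_matrix_def 1)
      then show ?thesis by simp
    qed
    then have "(\<Sum>(i, x)\<in>Inc. \<Sum>l\<in>UNIV. g i x $ l * body_matrix p ((i, x), l) c) =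
        (\<Sum>(i, x)\<in>Inc. if x = y then g i x $ m else 0)" by simp
    also have "\<dots> = (\<Sum>x\<in>snd ` Inc. \<Sum>i\<in>fst ` Inc. if x = y then g i x $ m else 0)"
      by (rule sum_incidence(2)[OF assms(1)]) (use g0 in auto)
    also have "\<dots> = (\<Sum>x\<in>snd ` Inc. if x = y then (\<Sum>i\<in>fst ` Inc. g i x) $ m else 0)"
      by (intro sum.cong) auto
    also have "\<dots> = 0" using assms(2) by (intro sum.neutral) (simp add: balanced_def)
    finally show ?thesis using * by simp
  next
    case 2
    have "(\<Sum>l\<in>UNIV. g i x $ l * body_matrix p ((i, x), l) c) = (if i = j then g i x $ m else 0)" for i x
    proof -
      have "(\<Sum>l\<in>UNIV. g i x $ l * body_matrix p ((i, x), l) c) =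
          (\<Sum>l\<in>UNIV. if l = m then (if i = j then g i x $ l else 0) else 0)"
        by (intro sum.cong) (auto simp: body_matrix_def 2)
      then show ?thesis by simp
    qed
    then have "(\<Sum>(i, x)\<in>Inc. \<Sum>l\<in>UNIV. g i x $ l * body_matrix p ((i, x), l) c) =
        (\<Sum>(i, x)\<in>Inc. if i = j then g i x $ m else 0)" by simp
    also have "\<dots> = (\<Sum>i\<in>fst ` Inc. \<Sum>x\<in>snd ` Inc. if i = j then g i x $ m else 0)"
      by (rule sum_incidence(1)[OF assms(1)]) (use g0 in auto)
    also have "\<dots> = (\<Sum>i\<in>fst ` Inc. if i = j then (\<Sum>x\<in>snd ` Inc. g i x) $ m else 0)"
      by (intro sum.cong) auto
    also have "\<dots> = 0" using assms(2) by (intro sum.neutral) (simp add: balanced_def)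
    finally show ?thesis using * by simp
  next
    case 3
    have "(\<Sum>l\<in>UNIV. g i x $ l * body_matrix p ((i, x), l) c) = (if i = j then g i x \<bullet> p x else 0)" for i x
      by (auto simp: body_matrix_def 3 inner_vec_def intro!: sum.cong)
    then have "(\<Sum>(i, x)\<in>Inc. \<Sum>l\<in>UNIV. g i x $ l * body_matrix p ((i, x), l) c) =
        (\<Sum>(i, x)\<in>Inc. if i = j then g i x \<bullet> p x else 0)" by simp
    also have "\<dots> = (\<Sum>i\<in>fst ` Inc. \<Sum>x\<in>snd ` Inc. if i = j then g i x \<bullet> p x else 0)"
      by (rule sum_incidence(1)[OF assms(1)]) (use g0 in auto)
    also have "\<dots> = (\<Sum>i\<in>fst ` Inc. if i = j then (\<Sum>x\<in>snd ` Inc. g i x \<bullet> p x) else 0)"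
      by (intro sum.cong) auto
    also have "\<dots> = 0" using assms(2) by (intro sum.neutral) (simp add: balanced_def)
    finally show ?thesis using * by simp
  qed
qed

text \<open>
  The first-order condition for a realisation at which the rank cannot be raised in the direction \<open>k\<close>,
  applied to the balanced system \<open>g\<close> in the left kernel and to the redrawing \<open>z\<close> in the right kernel.
\<close>

lemma unimprovable_rank_imp_orthogonal:
  assumes "finite Inc" "balanced Inc p g"
    and z: "\<And>i x. (i, x) \<in> Inc \<Longrightarrow> z x = \<gamma> i *\<^sub>R p x + \<tau> i"
    and max: "\<not> (\<forall>\<^sub>F t in at 0. matrix_rank (Inc \<times> UNIV) (body_matrix p)
      < matrix_rank (Inc \<times> UNIV) (body_matrix (\<lambda>x. p x + t *\<^sub>R k x)))"
  shows "(\<Sum>(i, x)\<in>Inc. \<gamma> i * (g i x \<bullet> k x)) = 0"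
proof (rule ccontr)
  assume nz: "(\<Sum>(i, x)\<in>Inc. \<gamma> i * (g i x \<bullet> k x)) \<noteq> 0"
  define f where "f = (\<lambda>c. case c of Inl y \<Rightarrow> z (fst y) $ snd y
      | Inr (Inl j) \<Rightarrow> - \<tau> (fst j) $ snd j | Inr (Inr j) \<Rightarrow> - \<gamma> j)"
  have "(\<Sum>c\<in>body_columns Inc. body_matrix p r c * f c) = 0" if "r \<in> Inc \<times> UNIV" for r
  proof -
    obtain i x l where rr: "r = ((i, x), l)" by (metis surj_pair)
    then have r: "r = ((i, x), l)" "(i, x) \<in> Inc" using that by auto
    show ?thesis using z[OF r(2)] by (simp add: r sum_body_matrix_row[OF assms(1) r(2)] f_def)
  qed
  moreover have "(\<Sum>r\<in>Inc \<times> UNIV. g (fst (fst r)) (snd (fst r)) $ snd r *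
      (\<Sum>c\<in>body_columns Inc. body_matrix_linear k r c * f c)) \<noteq> 0"
  proof -
    have "(\<Sum>r\<in>Inc \<times> UNIV. g (fst (fst r)) (snd (fst r)) $ snd r *
        (\<Sum>c\<in>body_columns Inc. body_matrix_linear k r c * f c)) =
        (\<Sum>r\<in>Inc \<times> UNIV. g (fst (fst r)) (snd (fst r)) $ snd r *
        (k (snd (fst r)) $ snd r * - \<gamma> (fst (fst r))))"
      by (intro sum.cong refl) (auto simp: sum_body_matrix_row(2)[OF assms(1)] f_def)
    also have "\<dots> = (\<Sum>r\<in>Inc. \<Sum>l\<in>UNIV. g (fst r) (snd r) $ l * (k (snd r) $ l * - \<gamma> (fst r)))"
      by (simp add: sum.cartesian_product' case_prod_beta)
    also have "\<dots> = (\<Sum>r\<in>Inc. - (\<gamma> (fst r) * (g (fst r) (snd r) \<bullet> k (snd r))))"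
      by (intro sum.cong refl) (simp add: inner_2 sum_2 algebra_simps)
    also have "\<dots> = - (\<Sum>(i, x)\<in>Inc. \<gamma> i * (g i x \<bullet> k x))"
      by (simp add: sum_negf case_prod_beta)
    finally show ?thesis using nz by simp
  qed
  ultimately have "\<forall>\<^sub>F t in at 0. matrix_rank (Inc \<times> UNIV) (body_matrix p)
      < matrix_rank (Inc \<times> UNIV) (\<lambda>r c. body_matrix p r c + t * body_matrix_linear k r c)"
    using assms(1) balanced_left_kernel[OF assms(1,2)]
    by (intro matrix_rank_pencil_gt[where C = "body_columns Inc" and z = f
          and l = "\<lambda>r. g (fst (fst r)) (snd (fst r)) $ snd r"])
      (auto simp: finite_body_columns body_matrix_eq_0)
  then show False using max by (simp add: body_matrix_shift)
qed

text \<open>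
  There are two unknowns for each incidence and \<open>2 n + 3 b\<close> conditions for \<open>n\<close> points and \<open>b\<close> bodies, among
  which there are four dependencies: the total force (two coordinates), and the total work along \<open>p\<close>
  and along \<open>z\<close>, can be summed over the points or over the bodies. The last two are independent of each other
  because two bodies have different scaling factors. The set \<open>Q\<close> allows for extra conditions on one of the
  forces.
\<close>

lemma exists_balanced:
  fixes Inc :: "('i \<times> 'a) set" and p z :: "'a \<Rightarrow> real ^ 2" and Q :: "(real ^ 2) set"
  assumes "finite Inc" and z: "\<And>i x. (i, x) \<in> Inc \<Longrightarrow> z x = \<gamma> i *\<^sub>R p x + \<tau> i"
    and i12: "i1 \<in> fst ` Inc" "i2 \<in> fst ` Inc" "\<gamma> i1 \<noteq> \<gamma> i2"
    and "finite Q" "(i0, x0) \<in> Inc"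
    and count: "2 * card (snd ` Inc) + 3 * card (fst ` Inc) + card Q < 2 * card Inc + 4"
  obtains g where "balanced Inc p g" "\<exists>i x. g i x \<noteq> 0" "\<And>q. q \<in> Q \<Longrightarrow> g i0 x0 \<bullet> q = 0"
proof -
  let ?I = "fst ` Inc" and ?X = "snd ` Inc"
  have fI: "finite ?I" "finite ?X" using assms(1) by auto
  define eV where "eV = (\<lambda>(x, l) ((i :: 'i, y :: 'a), m :: 2). if y = x \<and> m = l then 1 else (0 :: real))"
  define eS where "eS = (\<lambda>(j, l) ((i :: 'i, y :: 'a), m :: 2). if i = j \<and> m = l then 1 else (0 :: real))"
  define eM where "eM = (\<lambda>j ((i :: 'i, y :: 'a), m :: 2). if i = j then p y $ m else 0)"
  define eQ where "eQ = (\<lambda>q ((i :: 'i, y :: 'a), m :: 2). if (i, y) = (i0, x0) then (q :: real ^ 2) $ m else 0)"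
  \<comment> \<open>The resultant on \<open>i1\<close> and the moments on \<open>i1\<close> and \<open>i2\<close> are left out; they vanish
    by the four dependencies.\<close>
  define E where "E = eV ` (?X \<times> UNIV) \<union> eS ` ((?I - {i1}) \<times> UNIV) \<union> eM ` (?I - {i1, i2}) \<union> eQ ` Q"
  have fE: "finite E" using fI assms by (simp add: E_def)
  have ne: "i1 \<noteq> i2" using i12 by auto
  have "card {i1, i2} \<le> card ?I" using i12 fI by (intro card_mono) auto
  then have b2: "2 \<le> card ?I" using ne by simp
  have "card E \<le> card (eV ` (?X \<times> UNIV)) + card (eS ` ((?I - {i1}) \<times> UNIV)) + card (eM ` (?I - {i1, i2})) + card (eQ ` Q)"
    unfolding E_def by (intro order_trans[OF card_Un_le] add_mono order_refl)
  also have "\<dots> \<le> card (?X \<times> (UNIV :: 2 set)) + card ((?I - {i1}) \<times> (UNIV :: 2 set)) + card (?I - {i1, i2}) + card Q"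
    using fI assms(6) by (intro add_mono card_image_le) auto
  also have "\<dots> = 2 * card ?X + 2 * (card ?I - 1) + (card ?I - 2) + card Q"
    using i12 ne fI by (simp add: card_cartesian_product card_Diff_subset)
  also have "\<dots> < 2 * card Inc" using count b2 by linarith
  also have "\<dots> = card (Inc \<times> (UNIV :: 2 set))" by (simp add: card_cartesian_product)
  finally have "card E < card (Inc \<times> (UNIV :: 2 set))" .
  with fE assms(1) obtain y where y: "\<exists>c\<in>Inc \<times> UNIV. y c \<noteq> 0" "\<And>c. c \<notin> Inc \<times> UNIV \<Longrightarrow> y c = 0"
    "\<And>e. e \<in> E \<Longrightarrow> (\<Sum>c\<in>Inc \<times> UNIV. e c * y c) = 0"
    using homogeneous_system_nontrivial_solution[of E "Inc \<times> (UNIV :: 2 set)"] by auto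
  define g :: "'i \<Rightarrow> 'a \<Rightarrow> real ^ 2" where "g = (\<lambda>i x. \<chi> l. y ((i, x), l))"
  have g0: "g i x = 0" if "(i, x) \<notin> Inc" for i x using that y(2) by (simp add: g_def vec_eq_iff)
  have sumE: "(\<Sum>c\<in>Inc \<times> UNIV. e c * y c) = (\<Sum>(i, x)\<in>Inc. \<Sum>l\<in>UNIV. e ((i, x), l) * g i x $ l)" for e
    by (simp add: sum.cartesian_product' case_prod_beta g_def)
  have V: "(\<Sum>i\<in>?I. g i x) = 0" for x
  proof (cases "x \<in> ?X")
    case True
    have "(\<Sum>i\<in>?I. g i x) $ l = 0" for l
    proof -
      have "eV (x, l) \<in> E" using True by (auto simp: E_def)
      then have "0 = (\<Sum>(i, y)\<in>Inc. \<Sum>m\<in>UNIV. eV (x, l) ((i, y), m) * g i y $ m)" using y(3) sumE by metis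
      also have "\<dots> = (\<Sum>(i, y)\<in>Inc. if y = x then g i y $ l else 0)"
      proof (intro sum.cong refl, clarify)
        fix i y
        have "(\<Sum>m\<in>UNIV. eV (x, l) ((i, y), m) * g i y $ m) = (\<Sum>m\<in>UNIV. if m = l then (if y = x then g i y $ m else 0) else 0)"
          by (intro sum.cong) (auto simp: eV_def)
        then show "(\<Sum>m\<in>UNIV. eV (x, l) ((i, y), m) * g i y $ m) = (if y = x then g i y $ l else 0)" by simp
      qed
      also have "\<dots> = (\<Sum>y\<in>?X. \<Sum>i\<in>?I. if y = x then g i y $ l else 0)"
        by (rule sum_incidence(2)[OF assms(1)]) (use g0 in auto)
      also have "\<dots> = (\<Sum>y\<in>?X. if y = x then (\<Sum>i\<in>?I. g i x) $ l else 0)" by (intro sum.cong) auto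
      also have "\<dots> = (\<Sum>i\<in>?I. g i x) $ l" using True fI by simp
      finally show ?thesis by simp
    qed
    then show ?thesis by (simp add: vec_eq_iff)
  next
    case False
    then have "g i x = 0" for i using g0 by force
    then show ?thesis by simp
  qed
  have S': "(\<Sum>x\<in>?X. g i x) = 0" if "i \<in> ?I - {i1}" for i
  proof -
    have "(\<Sum>x\<in>?X. g i x) $ l = 0" for l
    proof -
      have "eS (i, l) \<in> E" using that by (auto simp: E_def)
      then have "0 = (\<Sum>(j, y)\<in>Inc. \<Sum>m\<in>UNIV. eS (i, l) ((j, y), m) * g j y $ m)" using y(3) sumE by metis
      also have "\<dots> = (\<Sum>(j, y)\<in>Inc. if j = i then g j y $ l else 0)"
      proof (intro sum.cong refl, clarify)
        fix j y
        have "(\<Sum>m\<in>UNIV. eS (i, l) ((j, y), m) * g j y $ m) = (\<Sum>m\<in>UNIV. if m = l then (if j = i then g j y $ m else 0) else 0)"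
          by (intro sum.cong) (auto simp: eS_def)
        then show "(\<Sum>m\<in>UNIV. eS (i, l) ((j, y), m) * g j y $ m) = (if j = i then g j y $ l else 0)" by simp
      qed
      also have "\<dots> = (\<Sum>j\<in>?I. \<Sum>y\<in>?X. if j = i then g j y $ l else 0)"
        by (rule sum_incidence(1)[OF assms(1)]) (use g0 in auto)
      also have "\<dots> = (\<Sum>j\<in>?I. if j = i then (\<Sum>x\<in>?X. g i x) $ l else 0)" by (intro sum.cong) auto
      also have "\<dots> = (\<Sum>x\<in>?X. g i x) $ l" using that fI by simp
      finally show ?thesis by simp
    qed
    then show ?thesis by (simp add: vec_eq_iff)
  qed
  have M': "(\<Sum>x\<in>?X. g i x \<bullet> p x) = 0" if "i \<in> ?I - {i1, i2}" for i
  proof -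
    have "eM i \<in> E" using that by (auto simp: E_def)
    then have "0 = (\<Sum>(j, y)\<in>Inc. \<Sum>m\<in>UNIV. eM i ((j, y), m) * g j y $ m)" using y(3) sumE by metis
    also have "\<dots> = (\<Sum>(j, y)\<in>Inc. if j = i then g j y \<bullet> p y else 0)"
      by (intro sum.cong refl) (auto simp: eM_def inner_vec_def mult.commute)
    also have "\<dots> = (\<Sum>j\<in>?I. \<Sum>y\<in>?X. if j = i then g j y \<bullet> p y else 0)"
      by (rule sum_incidence(1)[OF assms(1)]) (use g0 in auto)
    also have "\<dots> = (\<Sum>j\<in>?I. if j = i then (\<Sum>x\<in>?X. g i x \<bullet> p x) else 0)" by (intro sum.cong) auto
    also have "\<dots> = (\<Sum>x\<in>?X. g i x \<bullet> p x)" using that fI by simp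
    finally show ?thesis by simp
  qed
  \<comment> \<open>Total force: the resultant on \<open>i1\<close> vanishes as well.\<close>
  have "(\<Sum>i\<in>?I. \<Sum>x\<in>?X. g i x) = 0" using V by (subst sum.swap) simp
  then have S1: "(\<Sum>x\<in>?X. g i1 x) = 0" using S' i12 fI by (simp add: sum.remove[of ?I i1])
  have S: "(\<Sum>x\<in>?X. g i x) = 0" for i
  proof (cases "i \<in> ?I")
    case False
    then have "g i x = 0" for x using g0 by force
    then show ?thesis by simp
  qed (use S1 S' in auto)
  define m where "m = (\<lambda>i. \<Sum>x\<in>?X. g i x \<bullet> p x)"
  have split: "(\<Sum>i\<in>?I. f i) = f i1 + f i2" if "\<And>i. i \<in> ?I - {i1, i2} \<Longrightarrow> f i = 0" for f :: "'i \<Rightarrow> real"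
  proof -
    have "(\<Sum>i\<in>?I. f i) = (\<Sum>i\<in>{i1, i2}. f i)" using that i12 fI by (intro sum.mono_neutral_right) auto
    then show ?thesis using ne by simp
  qed
  \<comment> \<open>Work along \<open>p\<close> and along \<open>z\<close>: two equations for the two omitted moments.\<close>
  have "(\<Sum>i\<in>?I. m i) = (\<Sum>x\<in>?X. (\<Sum>i\<in>?I. g i x) \<bullet> p x)"
    unfolding m_def by (subst sum.swap) (simp add: inner_sum_left)
  then have m1: "m i1 + m i2 = 0" using V split[of m] M' by (simp add: m_def)
  have "(\<Sum>i\<in>?I. \<gamma> i * m i) = (\<Sum>i\<in>?I. \<gamma> i * m i + (\<Sum>x\<in>?X. g i x) \<bullet> \<tau> i)" using S by simp
  also have "\<dots> = (\<Sum>i\<in>?I. \<Sum>x\<in>?X. g i x \<bullet> (\<gamma> i *\<^sub>R p x + \<tau> i))"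
    by (simp add: m_def inner_sum_left inner_add_right sum_distrib_left sum.distrib)
  also have "\<dots> = (\<Sum>i\<in>?I. \<Sum>x\<in>?X. g i x \<bullet> z x)"
  proof (intro sum.cong refl)
    fix i x show "g i x \<bullet> (\<gamma> i *\<^sub>R p x + \<tau> i) = g i x \<bullet> z x"
      using z[of i x] g0[of i x] by (cases "(i, x) \<in> Inc") auto
  qed
  also have "\<dots> = (\<Sum>x\<in>?X. (\<Sum>i\<in>?I. g i x) \<bullet> z x)"
    by (subst sum.swap) (simp add: inner_sum_left)
  finally have m2: "\<gamma> i1 * m i1 + \<gamma> i2 * m i2 = 0"
    using V split[of "\<lambda>i. \<gamma> i * m i"] M' by (simp add: m_def)
  have "(\<gamma> i1 - \<gamma> i2) * m i1 = 0" using m1 m2 by algebra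
  then have "m i1 = 0" using i12 by simp
  then have m0: "m i1 = 0" "m i2 = 0" using m1 by auto
  have M: "(\<Sum>x\<in>?X. g i x \<bullet> p x) = 0" for i
  proof (cases "i \<in> ?I")
    case False
    then have "g i x = 0" for x using g0 by force
    then show ?thesis by simp
  qed (use m0 M' in \<open>auto simp: m_def\<close>)
  have "balanced Inc p g" unfolding balanced_def using g0 V S M by blast
  moreover have "\<exists>i x. g i x \<noteq> 0"
  proof -
    obtain i x l where "y ((i, x), l) \<noteq> 0" using y(1) by auto
    then have "g i x $ l \<noteq> 0" by (simp add: g_def)
    then show ?thesis by (metis zero_index)
  qed
  moreover have "g i0 x0 \<bullet> q = 0" if "q \<in> Q" for q
  proof -
    have "eQ q \<in> E" using that by (auto simp: E_def)
    then have "0 = (\<Sum>(j, y)\<in>Inc. \<Sum>m\<in>UNIV. eQ q ((j, y), m) * g j y $ m)" using y(3) sumE by metis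
    also have "\<dots> = (\<Sum>r\<in>Inc. if r = (i0, x0) then g i0 x0 \<bullet> q else 0)"
    proof (intro sum.cong refl)
      fix r
      show "(case r of (j, y) \<Rightarrow> \<Sum>m\<in>UNIV. eQ q ((j, y), m) * g j y $ m) = (if r = (i0, x0) then g i0 x0 \<bullet> q else 0)"
      proof (cases "r = (i0, x0)")
        case False
        then show ?thesis by (cases r) (auto simp: eQ_def intro!: sum.neutral)
      qed (simp add: eQ_def inner_vec_def mult.commute)
    qed
    also have "\<dots> = g i0 x0 \<bullet> q" using assms(1,7) by simp
    finally show ?thesis by simp
  qed
  ultimately show ?thesis using that by blast
qed

lemma balanced_subset:
  assumes "finite Inc" "balanced Inc p g" "Inc' \<subseteq> Inc" "\<And>i x. (i, x) \<notin> Inc' \<Longrightarrow> g i x = 0"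
  shows "balanced Inc' p g"
proof -
  have I: "(\<Sum>i\<in>fst ` Inc'. g i x) = (\<Sum>i\<in>fst ` Inc. g i x)" for x
  proof (intro sum.mono_neutral_left ballI)
    fix i assume "i \<in> fst ` Inc - fst ` Inc'"
    then show "g i x = 0" using assms(4) by force
  qed (use assms(1,3) in auto)
  have 0: "g i x = 0" if "x \<in> snd ` Inc - snd ` Inc'" for i x using that assms(4) by force
  have S: "(\<Sum>x\<in>snd ` Inc'. g i x) = (\<Sum>x\<in>snd ` Inc. g i x)" for i
    using assms(1,3) 0 by (intro sum.mono_neutral_left) auto
  have M: "(\<Sum>x\<in>snd ` Inc'. g i x \<bullet> p x) = (\<Sum>x\<in>snd ` Inc. g i x \<bullet> p x)" for i
    using assms(1,3) 0 by (intro sum.mono_neutral_left) auto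
  show ?thesis unfolding balanced_def I S M
    using assms(2,4) unfolding balanced_def by blast
qed

section \<open>Generic coincident realisations\<close>

text \<open>
  If every score can only grow under a small move, then maximising the sum of all scores maximises them
  simultaneously in the weak sense needed here: no score can be raised by arbitrarily small moves in a fixed
  direction. This replaces an argument with Zariski-dense open sets.
\<close>

lemma exists_unimprovable:
  fixes s :: "'j \<Rightarrow> 'p \<Rightarrow> nat" and move :: "real \<Rightarrow> 'k \<Rightarrow> 'p \<Rightarrow> 'p"
  assumes "finite J" "p0 \<in> W"
    and "\<And>j p. j \<in> J \<Longrightarrow> p \<in> W \<Longrightarrow> s j p \<le> N"
    and "\<And>p k t. p \<in> W \<Longrightarrow> k \<in> D \<Longrightarrow> move t k p \<in> W"
    and "\<And>j p k. j \<in> J \<Longrightarrow> p \<in> W \<Longrightarrow> k \<in> D \<Longrightarrow> \<forall>\<^sub>F t in at 0. s j p \<le> s j (move t k p)"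
  obtains p where "p \<in> W" "\<And>j k. j \<in> J \<Longrightarrow> k \<in> D \<Longrightarrow> \<not> (\<forall>\<^sub>F t in at 0. s j p < s j (move t k p))"
proof -
  define S where "S = (\<lambda>p. \<Sum>j\<in>J. s j p)"
  have "S p \<le> card J * N" if "p \<in> W" for p
    unfolding S_def using sum_bounded_above[of J "\<lambda>j. s j p" N] assms(3) that by simp
  then obtain p where p: "p \<in> W" "\<And>q. q \<in> W \<Longrightarrow> S q \<le> S p"
    using ex_has_greatest_nat[of "\<lambda>p. p \<in> W" p0 S "Suc (card J * N)"] assms(2)
    by (metis le_imp_less_Suc)
  have "\<not> (\<forall>\<^sub>F t in at 0. s j p < s j (move t k p))" if j: "j \<in> J" and k: "k \<in> D" for j k
  proof
    assume "\<forall>\<^sub>F t in at 0. s j p < s j (move t k p)"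
    moreover have "\<forall>\<^sub>F t in at (0::real). \<forall>i\<in>J. s i p \<le> s i (move t k p)"
    proof (intro eventually_ball_finite ballI)
      fix i assume "i \<in> J"
      then show "\<forall>\<^sub>F t in at (0::real). s i p \<le> s i (move t k p)"
        using assms(5) p(1) k by blast
    qed (rule assms(1))
    ultimately have "\<forall>\<^sub>F t in at (0::real). S p < S (move t k p)"
    proof eventually_elim
      case (elim t)
      then show ?case unfolding S_def by (intro sum_strict_mono_ex1[OF assms(1)]) (use j in blast)+
    qed
    then obtain t where "S p < S (move t k p)"
      using eventually_happens'[OF at_neq_bot] by blast
    then show False using p assms(4)[OF p(1) k, of t] by (meson not_less)
  qed
  with p(1) that show ?thesis by blast
qed

definition general_position :: "'a set \<Rightarrow> 'a set \<Rightarrow> ('a \<Rightarrow> real ^ 2) \<Rightarrow> bool" where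
  "general_position V T p \<longleftrightarrow>
     (\<forall>x\<in>V - T. \<forall>y\<in>V. x \<noteq> y \<longrightarrow> p x \<noteq> p y) \<and>
     (\<forall>x\<in>V - T. \<forall>y\<in>V. \<forall>y'\<in>V. x \<noteq> y \<and> x \<noteq> y' \<and> y \<noteq> y' \<and> \<not> (y \<in> T \<and> y' \<in> T) \<longrightarrow>
        cross2 (p y - p x) (p y' - p x) \<noteq> 0)"

text \<open>
  The equation that genericity adds to the balance of forces. Bodies are indexed by sets of vertices, so that
  only finitely many incidence sets have to be considered.
\<close>

definition force_generic :: "'a set \<Rightarrow> 'a set \<Rightarrow> ('a \<Rightarrow> real ^ 2) \<Rightarrow> bool" where
  "force_generic V T p \<longleftrightarrow>
     (\<forall>Inc g z \<gamma> \<tau>. Inc \<subseteq> Pow V \<times> V \<and> balanced Inc p g \<and> (\<forall>(i, x)\<in>Inc. z x = \<gamma> i *\<^sub>R p x + \<tau> i) \<longrightarrow>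
        (\<forall>x\<in>V - T. (\<Sum>i\<in>fst ` Inc. \<gamma> i *\<^sub>R g i x) = 0))"

lemma force_genericD:
  assumes "force_generic V T p" "Inc \<subseteq> Pow V \<times> V" "balanced Inc p g"
    and "\<forall>(i, x)\<in>Inc. z x = \<gamma> i *\<^sub>R p x + \<tau> i" and "x \<in> V - T"
  shows "(\<Sum>i\<in>fst ` Inc. \<gamma> i *\<^sub>R g i x) = 0"
  using assms(1)[unfolded force_generic_def, THEN spec, THEN spec, THEN spec, THEN spec, THEN spec,
      THEN mp, THEN bspec, OF _ assms(5)] assms(2-4)
  by blast

lemma eventually_neq_at_0:
  fixes f :: "real \<Rightarrow> 'b :: t2_space"
  assumes "isCont f 0" "f 0 \<noteq> c"
  shows "\<forall>\<^sub>F t in at 0. f t \<noteq> c"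
  using assms tendsto_imp_eventually_ne unfolding isCont_def by blast

text \<open>
  The scores are the ranks of the body matrices of all incidence sets, and the truth values of the
  conditions of general position. The admissible directions are themselves coincident on \<open>T\<close>; in
  particular a single vertex outside \<open>T\<close> may be moved.
\<close>

lemma exists_generic_coincident:
  fixes V T :: "'a set"
  assumes "finite V"
  obtains p where "coincident T p" "general_position V T p" "force_generic V T p"
proof -
  define s :: "('a set \<times> 'a) set + 'a \<times> 'a + 'a \<times> 'a \<times> 'a \<Rightarrow> ('a \<Rightarrow> real ^ 2) \<Rightarrow> nat" where
    "s = (\<lambda>j p. case j of Inl Inc \<Rightarrow> matrix_rank (Inc \<times> UNIV) (body_matrix p)
      | Inr (Inl (x, y)) \<Rightarrow> of_bool (p x \<noteq> p y)
      | Inr (Inr (x, y, y')) \<Rightarrow> of_bool (cross2 (p y - p x) (p y' - p x) \<noteq> 0))"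
  define J where "J = Pow (Pow V \<times> V) <+> (V \<times> V) <+> (V \<times> V \<times> V)"
  define move where "move = (\<lambda>(t :: real) k p (x :: 'a). p x + t *\<^sub>R k x :: real ^ 2)"
  define W where "W = Collect (coincident T :: ('a \<Rightarrow> real ^ 2) \<Rightarrow> bool)"
  have fJ: "finite J" using assms by (simp add: J_def)
  have fInc: "finite Inc" if "Inc \<subseteq> Pow V \<times> V" for Inc
    using assms that by (meson finite_Pow_iff finite_SigmaI finite_subset)
  obtain p where p: "p \<in> W" and opt: "\<And>j k. j \<in> J \<Longrightarrow> k \<in> W \<Longrightarrow> \<not> (\<forall>\<^sub>F t in at 0. s j p < s j (move t k p))"
  proof (rule exists_unimprovable[of J "\<lambda>_. 0" W s "card ((Pow V \<times> V) \<times> (UNIV :: 2 set)) + 1" W move])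
    show "finite J" by fact
    show "(\<lambda>_. 0) \<in> W" by (simp add: W_def coincident_def)
    show "move t k p \<in> W" if "p \<in> W" "k \<in> W" for p k t
      proof -
      have "p x + t *\<^sub>R k x = p y + t *\<^sub>R k y" if "x \<in> T" "y \<in> T" for x y
      proof -
        have "p x = p y" "k x = k y"
          using \<open>p \<in> W\<close> \<open>k \<in> W\<close> that unfolding W_def coincident_def by blast+
        then show ?thesis by simp
      qed
      then show ?thesis unfolding W_def coincident_def move_def by blast
    qed
    show "s j p \<le> card ((Pow V \<times> V) \<times> (UNIV :: 2 set)) + 1" if "j \<in> J" for j p
    proof (cases j)
      case (Inl Inc)
      then have I: "Inc \<subseteq> Pow V \<times> V" using that by (auto simp: J_def)
      have "s j p \<le> card (Inc \<times> (UNIV :: 2 set))" unfolding s_def Inl sum.case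
      proof (rule matrix_rank_le)
        show "finite (Inc \<times> (UNIV :: 2 set))" using fInc[OF I] by simp
        show "\<exists>a. \<forall>c. body_matrix p r c = (\<Sum>d\<in>Inc \<times> UNIV. a d * body_matrix p d c)"
          if "r \<in> Inc \<times> UNIV" for r
          using that fInc[OF I] by (intro exI[of _ "\<lambda>d. if d = r then 1 else 0"]) (simp add: sum_delta_mult)
      qed
      also have "\<dots> \<le> card ((Pow V \<times> V) \<times> (UNIV :: 2 set))"
        using I assms by (intro card_mono) auto
      finally show ?thesis by simp
    next
      case (Inr i)
      then show ?thesis by (cases i) (auto simp: s_def split: prod.splits)
    qed
    show "\<forall>\<^sub>F t in at 0. s j p \<le> s j (move t k p)" if "j \<in> J" "p \<in> W" "k \<in> W" for j p k
    proof -
      consider Inc where "j = Inl Inc" "Inc \<subseteq> Pow V \<times> V" | x y where "j = Inr (Inl (x, y))"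
        | x y y' where "j = Inr (Inr (x, y, y'))"
        using \<open>j \<in> J\<close> unfolding J_def by (elim PlusE) auto
      then show ?thesis
      proof cases
        case 1
        then show ?thesis
          using matrix_rank_pencil_ge[of "Inc \<times> UNIV" "body_columns Inc" "body_matrix p" "body_matrix_linear k"]
            fInc[OF 1(2)]
          by (simp add: s_def move_def body_matrix_shift finite_body_columns body_matrix_eq_0)
      next
        case 2
        show ?thesis
        proof (cases "p x = p y")
          case False
          have "\<forall>\<^sub>F t in at (0::real). (move t k p x - move t k p y) \<noteq> 0"
            unfolding move_def by (rule eventually_neq_at_0) (use False in \<open>auto intro!: continuous_intros\<close>)
          then show ?thesis by eventually_elim (auto simp: s_def 2)
        qed (simp add: s_def 2)
      next
        case 3
        show ?thesis
        proof (cases "cross2 (p y - p x) (p y' - p x) = 0")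
          case False
          have "\<forall>\<^sub>F t in at (0::real). cross2 (move t k p y - move t k p x) (move t k p y' - move t k p x) \<noteq> 0"
            unfolding move_def
            by (rule eventually_neq_at_0) (use False in \<open>auto simp: cross2_def intro!: continuous_intros\<close>)
          then show ?thesis by eventually_elim (auto simp: s_def 3)
        qed (simp add: s_def 3)
      qed
    qed
  qed blast
  have t0: "\<forall>\<^sub>F t in at (0::real). t \<noteq> 0" by (simp add: eventually_at_filter)
  have single: "(\<lambda>v. if v = x then d else 0) \<in> W" if "x \<notin> T" for x d
    using that by (auto simp: W_def coincident_def)
  have pair: "p x \<noteq> p y" if "x \<in> V - T" "y \<in> V" "x \<noteq> y" for x y
  proof
    assume eq: "p x = p y"
    let ?k = "\<lambda>v. if v = x then axis 1 1 else (0 :: real ^ 2)"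
    have "\<forall>\<^sub>F t in at (0::real). s (Inr (Inl (x, y))) p < s (Inr (Inl (x, y))) (move t ?k p)"
      using t0 by eventually_elim (use eq that(3) in \<open>auto simp: s_def move_def\<close>)
    moreover have "Inr (Inl (x, y)) \<in> J" using that by (auto simp: J_def)
    ultimately show False using opt single that by blast
  qed
  have triple: "cross2 (p y - p x) (p y' - p x) \<noteq> 0"
    if x: "x \<in> V - T" and y: "y \<in> V" "y' \<in> V" "x \<noteq> y" "x \<noteq> y'" "y \<noteq> y'" "\<not> (y \<in> T \<and> y' \<in> T)" for x y y'
  proof
    assume eq: "cross2 (p y - p x) (p y' - p x) = 0"
    \<comment> \<open>Moving \<open>x\<close> at right angles to the line through \<open>p y\<close> and \<open>p y'\<close> takes it off that line.\<close>
    let ?d = "perp (p y' - p y)"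
    let ?k = "\<lambda>v. if v = x then ?d else 0"
    have ne: "p y \<noteq> p y'" using pair[of y y'] pair[of y' y] y by auto
    have "cross2 (p y - (p x + t *\<^sub>R ?d)) (p y' - (p x + t *\<^sub>R ?d)) = t * ((p y' - p y) \<bullet> (p y' - p y))" for t
      using eq by (simp add: cross2_def inner_2 algebra_simps)
    note * = this
    from t0 have "\<forall>\<^sub>F t in at (0::real). s (Inr (Inr (x, y, y'))) p < s (Inr (Inr (x, y, y'))) (move t ?k p)"
    proof eventually_elim
      case (elim t)
      then show ?case using eq y ne *[of t] by (simp add: s_def move_def)
    qed
    moreover have "Inr (Inr (x, y, y')) \<in> J" using x y by (auto simp: J_def)
    ultimately show False using opt single x by blast
  qed
  have "force_generic V T p" unfolding force_generic_def
  proof (intro allI impI ballI, elim conjE)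
    fix Inc g z \<gamma> \<tau> x
    assume I: "Inc \<subseteq> Pow V \<times> V" and g: "balanced Inc p g" and z: "\<forall>(i, x)\<in>Inc. z x = \<gamma> i *\<^sub>R p x + \<tau> i"
      and x: "x \<in> V - T"
    have "(\<Sum>i\<in>fst ` Inc. \<gamma> i *\<^sub>R g i x) \<bullet> d = 0" for d
    proof -
      let ?k = "\<lambda>v. if v = x then d else 0"
      have "Inl Inc \<in> J" using I by (auto simp: J_def)
      have "\<not> (\<forall>\<^sub>F t in at 0. s (Inl Inc) p < s (Inl Inc) (move t ?k p))"
        using opt[OF \<open>Inl Inc \<in> J\<close> single[of x d]] x by blast
      then have "(\<Sum>(i, y)\<in>Inc. \<gamma> i * (g i y \<bullet> ?k y)) = 0"
        using z by (intro unimprovable_rank_imp_orthogonal[OF fInc[OF I] g, of z \<gamma> \<tau> ?k]) (auto simp: s_def move_def)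
      also have "(\<Sum>(i, y)\<in>Inc. \<gamma> i * (g i y \<bullet> ?k y)) = (\<Sum>y\<in>snd ` Inc. \<Sum>i\<in>fst ` Inc. \<gamma> i * (g i y \<bullet> ?k y))"
        by (rule sum_incidence(2)[OF fInc[OF I]]) (use g in \<open>auto simp: balanced_def\<close>)
      also have "\<dots> = (\<Sum>y\<in>snd ` Inc. if y = x then (\<Sum>i\<in>fst ` Inc. \<gamma> i *\<^sub>R g i y) \<bullet> d else 0)"
        by (intro sum.cong) (auto simp: inner_sum_left)
      also have "\<dots> = (if x \<in> snd ` Inc then (\<Sum>i\<in>fst ` Inc. \<gamma> i *\<^sub>R g i x) \<bullet> d else 0)"
        using fInc[OF I] by simp
      finally show ?thesis
      proof (cases "x \<in> snd ` Inc")
        case False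
        then have "g i x = 0" for i using g by (force simp: balanced_def)
        then show ?thesis by simp
      qed simp
    qed
    then show "(\<Sum>i\<in>fst ` Inc. \<gamma> i *\<^sub>R g i x) = 0" by (metis inner_eq_zero_iff)
  qed
  moreover have "general_position V T p"
    unfolding general_position_def using pair triple by blast
  moreover have "coincident T p" using p by (simp add: W_def)
  ultimately show ?thesis using that by blast
qed

section \<open>Vanishing of balanced force systems\<close>

lemma cross2_eq_0_if_orthogonal:
  assumes "h \<noteq> 0" "h \<bullet> a = 0" "h \<bullet> b = 0"
  shows "cross2 a b = 0"
proof -
  have "h $ 1 * cross2 a b = 0" "h $ 2 * cross2 a b = 0"
    using assms(2,3) unfolding cross2_def inner_2 by algebra+
  then show ?thesis using assms(1) by (auto simp: vec_eq_2)
qed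

text \<open>
  A hypothetical minimal counterexample to \<open>balanced_eq_0\<close>: \<open>Inc\<close> carries a nonzero balanced system,
  and minimality is expressed by saying that no force of any nonzero balanced system vanishes.
\<close>

locale critical_bodies =
  fixes V T :: "'a set" and p z :: "'a \<Rightarrow> real ^ 2" and Inc :: "('a set \<times> 'a) set"
    and \<gamma> :: "'a set \<Rightarrow> real" and \<tau> :: "'a set \<Rightarrow> real ^ 2" and g :: "'a set \<Rightarrow> 'a \<Rightarrow> real ^ 2"
  assumes fin: "finite V" "finite T" and T3: "card T \<le> 3"
    and coinc: "coincident T p" and gp: "general_position V T p" and fg: "force_generic V T p"
    and Inc: "Inc \<subseteq> Pow V \<times> V"
    and z: "\<And>i x. (i, x) \<in> Inc \<Longrightarrow> z x = \<gamma> i *\<^sub>R p x + \<tau> i"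
    and dist: "\<And>i j x. (i, x) \<in> Inc \<Longrightarrow> (j, x) \<in> Inc \<Longrightarrow> i \<noteq> j \<Longrightarrow> \<gamma> i \<noteq> \<gamma> j"
    and injT: "inj_on z T"
    and bal: "balanced Inc p g" and nz: "\<exists>i x. g i x \<noteq> 0"
    and crit: "\<And>g i x. balanced Inc p g \<Longrightarrow> \<exists>i x. g i x \<noteq> 0 \<Longrightarrow> (i, x) \<in> Inc \<Longrightarrow> g i x \<noteq> 0"
begin

definition points where "points i = {x. (i, x) \<in> Inc}"
definition bodies_at where "bodies_at x = {i. (i, x) \<in> Inc}"
definition weight :: "'a set \<Rightarrow> real" where "weight i = 2 - 3 / card (points i)"
text \<open>
  A body with \<open>k\<close> points sends \<open>2 - 3/k\<close> to each of them, \<open>2 k - 3\<close> altogether, and each point pays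
  \<open>2\<close>. The charges therefore sum to \<open>2 |Inc| - 3 b - 2 n\<close>, the quantity in \<open>exists_balanced\<close>.
\<close>

definition charge where "charge x = (\<Sum>i\<in>bodies_at x. weight i) - 2"

lemma finite_Inc: "finite Inc"
  using Inc fin by (meson finite_Pow_iff finite_SigmaI finite_subset)

lemma points_subset: "points i \<subseteq> snd ` Inc" and bodies_at_subset: "bodies_at x \<subseteq> fst ` Inc"
  by (force simp: points_def bodies_at_def)+

lemma finite_points [simp]: "finite (points i)" and finite_bodies_at [simp]: "finite (bodies_at x)"
  using points_subset bodies_at_subset finite_Inc by (meson finite_imageI finite_subset)+

lemma mem_V: "(i, x) \<in> Inc \<Longrightarrow> x \<in> V"
  using Inc by auto

lemma balanced_sums:
  assumes "balanced Inc p h"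
  shows "(\<Sum>i\<in>bodies_at x. h i x) = 0" "(\<Sum>x\<in>points i. h i x) = 0" "(\<Sum>x\<in>points i. h i x \<bullet> p x) = 0"
proof -
  have h0: "h i x = 0" if "(i, x) \<notin> Inc" for i x using assms that by (simp add: balanced_def)
  have "(\<Sum>i\<in>bodies_at x. h i x) = (\<Sum>i\<in>fst ` Inc. h i x)"
    using h0 bodies_at_subset finite_Inc by (intro sum.mono_neutral_left) (auto simp: bodies_at_def)
  then show "(\<Sum>i\<in>bodies_at x. h i x) = 0" using assms by (simp add: balanced_def)
  have "(\<Sum>x\<in>points i. h i x) = (\<Sum>x\<in>snd ` Inc. h i x)"
    using h0 points_subset finite_Inc by (intro sum.mono_neutral_left) (auto simp: points_def)
  then show "(\<Sum>x\<in>points i. h i x) = 0" using assms by (simp add: balanced_def)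
  have "(\<Sum>x\<in>points i. h i x \<bullet> p x) = (\<Sum>x\<in>snd ` Inc. h i x \<bullet> p x)"
    using h0 points_subset finite_Inc by (intro sum.mono_neutral_left) (auto simp: points_def)
  then show "(\<Sum>x\<in>points i. h i x \<bullet> p x) = 0" using assms by (simp add: balanced_def)
qed

lemma weighted_sum:
  assumes "x \<in> V - T"
  shows "(\<Sum>i\<in>bodies_at x. \<gamma> i *\<^sub>R g i x) = 0"
proof -
  have g0: "g i x = 0" if "(i, x) \<notin> Inc" for i x using bal that by (simp add: balanced_def)
  have "(\<Sum>i\<in>fst ` Inc. \<gamma> i *\<^sub>R g i x) = 0"
    using fg Inc bal z assms unfolding force_generic_def by blast
  moreover have "(\<Sum>i\<in>bodies_at x. \<gamma> i *\<^sub>R g i x) = (\<Sum>i\<in>fst ` Inc. \<gamma> i *\<^sub>R g i x)"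
    using g0 bodies_at_subset finite_Inc by (intro sum.mono_neutral_left) (auto simp: bodies_at_def)
  ultimately show ?thesis by simp
qed

lemma g_nonzero: "(i, x) \<in> Inc \<Longrightarrow> g i x \<noteq> 0"
  using crit bal nz by blast

lemma body_meets_T_once:
  assumes "(i, x) \<in> Inc" "(i, y) \<in> Inc" "x \<in> T" "y \<in> T"
  shows "x = y"
proof -
  have "p x = p y" using coinc assms(3,4) unfolding coincident_def by blast
  then have "z x = z y" using z[OF assms(1)] z[OF assms(2)] by simp
  then show ?thesis using injT assms(3,4) by (auto dest: inj_onD)
qed

lemma body_points_distinct:
  assumes "(i, x) \<in> Inc" "(i, y) \<in> Inc" "x \<noteq> y"
  shows "p x \<noteq> p y"
proof -
  have "x \<notin> T \<or> y \<notin> T" using body_meets_T_once assms by blast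
  then show ?thesis using gp mem_V assms unfolding general_position_def by (metis Diff_iff)
qed

lemma bodies_meet_once:
  assumes "(i, x) \<in> Inc" "(i, y) \<in> Inc" "(j, x) \<in> Inc" "(j, y) \<in> Inc" "i \<noteq> j"
  shows "x = y"
proof (rule ccontr)
  assume "x \<noteq> y"
  then have ne: "p x \<noteq> p y" using body_points_distinct assms by blast
  have 1: "z x - z y = \<gamma> i *\<^sub>R (p x - p y)"
    using z[OF assms(1)] z[OF assms(2)] by (simp add: algebra_simps)
  have 2: "z x - z y = \<gamma> j *\<^sub>R (p x - p y)"
    using z[OF assms(3)] z[OF assms(4)] by (simp add: algebra_simps)
  have "(\<gamma> i - \<gamma> j) *\<^sub>R (p x - p y) = 0"
    unfolding scaleR_left_diff_distrib 1[symmetric] 2[symmetric] by simp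
  then show False using ne dist[OF assms(1,3,5)] by simp
qed

lemma card_points: "i \<in> fst ` Inc \<Longrightarrow> 2 \<le> card (points i)"
proof (rule ccontr)
  assume i: "i \<in> fst ` Inc" and "\<not> 2 \<le> card (points i)"
  then have "points i \<noteq> {}" "card (points i) \<le> 1" by (auto simp: points_def)
  then obtain x where x: "points i = {x}" by (metis card_1_singletonE card_0_eq finite_points le_antisym One_nat_def Suc_leI gr_zeroI)
  then have "g i x = 0" using balanced_sums(2)[OF bal, of i] by simp
  then show False using g_nonzero x by (auto simp: points_def)
qed

text \<open>
  The two forces on a body with two points are opposite, and by the moment condition they are perpendicular
  to the line that joins the points (they would act along it before the rotation).
\<close>

lemma two_body_force:
  assumes "balanced Inc p h" "points i = {x, y}" "x \<noteq> y"
  shows "h i x \<bullet> (p x - p y) = 0"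
proof -
  have "h i x + h i y = 0" "h i x \<bullet> p x + h i y \<bullet> p y = 0"
    using balanced_sums(2,3)[OF assms(1), of i] assms(2,3) by auto
  then have "h i y = - h i x" by (simp add: add_eq_0_iff)
  then show ?thesis using \<open>h i x \<bullet> p x + h i y \<bullet> p y = 0\<close> by (simp add: inner_diff_right)
qed

lemma two_body:
  assumes "(i, x) \<in> Inc" "card (points i) = 2"
  obtains y where "points i = {x, y}" "x \<noteq> y" "(i, y) \<in> Inc"
proof -
  have "x \<in> points i" using assms by (simp add: points_def)
  then obtain y where "points i = {x, y}" "x \<noteq> y" using assms(2)
    by (metis card_2_iff doubleton_eq_iff insertE singletonD)
  then show ?thesis using that by (auto simp: points_def)
qed

lemma weight_ge: "i \<in> fst ` Inc \<Longrightarrow> 1 / 2 \<le> weight i" "i \<in> fst ` Inc \<Longrightarrow> card (points i) \<noteq> 2 \<Longrightarrow> 1 \<le> weight i"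
proof -
  assume i: "i \<in> fst ` Inc"
  then have c: "2 \<le> card (points i)" by (rule card_points)
  then show "1 / 2 \<le> weight i" by (simp add: weight_def field_simps)
  assume "card (points i) \<noteq> 2"
  then have "3 \<le> card (points i)" using c by simp
  then show "1 \<le> weight i" by (simp add: weight_def field_simps)
qed

lemma noncollinear:
  assumes "x \<in> V" "y \<in> V" "y' \<in> V" "x \<noteq> y" "x \<noteq> y'" "y \<noteq> y'"
    and "\<not> (x \<in> T \<and> y \<in> T)" "\<not> (x \<in> T \<and> y' \<in> T)" "\<not> (y \<in> T \<and> y' \<in> T)"
  shows "cross2 (p y - p x) (p y' - p x) \<noteq> 0"
proof (cases "x \<in> T")
  case False
  then show ?thesis using gp assms unfolding general_position_def by blast
next
  case True
  then have "cross2 (p x - p y) (p y' - p y) \<noteq> 0"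
    using gp assms unfolding general_position_def by (metis Diff_iff)
  moreover have "cross2 (p y - p x) (p y' - p x) = - cross2 (p x - p y) (p y' - p y)"
    by (simp add: cross2_def algebra_simps)
  ultimately show ?thesis by simp
qed

text \<open>
  Parallel forces of two two-point bodies at \<open>x\<close> force \<open>x\<close> and the two other ends to be collinear, which in general
  position happens only if these ends have the same image, that is, if both belong to \<open>T\<close>.
\<close>

lemma parallel_two_bodies:
  assumes "(i, x) \<in> Inc" "(j, x) \<in> Inc" "i \<noteq> j" "card (points i) = 2" "card (points j) = 2"
    and par: "\<And>d. g j x \<bullet> d = 0 \<Longrightarrow> g i x \<bullet> d = 0"
  obtains y y' where "points i = {x, y}" "points j = {x, y'}" "y \<in> T" "y' \<in> T" "y \<noteq> y'" "x \<notin> T"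
proof -
  obtain y where y: "points i = {x, y}" "x \<noteq> y" "(i, y) \<in> Inc" using two_body assms by blast
  obtain y' where y': "points j = {x, y'}" "x \<noteq> y'" "(j, y') \<in> Inc" using two_body assms by blast
  have ne: "y \<noteq> y'" using bodies_meet_once y y' assms by blast
  have "g i x \<bullet> (p x - p y) = 0" using two_body_force[OF bal] y by blast
  moreover have "g i x \<bullet> (p x - p y') = 0" using two_body_force[OF bal] y' par by blast
  ultimately have "cross2 (p x - p y) (p x - p y') = 0"
    using cross2_eq_0_if_orthogonal g_nonzero assms(1) by blast
  then have "cross2 (p y - p x) (p y' - p x) = 0" by (simp add: cross2_def algebra_simps)
  then have *: "(x \<in> T \<and> y \<in> T) \<or> (x \<in> T \<and> y' \<in> T) \<or> (y \<in> T \<and> y' \<in> T)"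
    using noncollinear[of x y y'] mem_V y y' assms ne by blast
  then have "y \<in> T \<and> y' \<in> T" "x \<notin> T" using body_meets_T_once y y' assms by blast+
  then show ?thesis using that y y' ne by blast
qed

text \<open>
  Claws are the only points outside \<open>T\<close> whose charge can be negative.
\<close>

definition claw where "claw x \<longleftrightarrow> x \<in> V - T \<and> card T = 3 \<and> (\<forall>u\<in>T. \<exists>i. (i, x) \<in> Inc \<and> (i, u) \<in> Inc)"

lemma card_bodies_at:
  assumes "x \<in> snd ` Inc"
  shows "2 \<le> card (bodies_at x)"
proof (rule ccontr)
  assume "\<not> 2 \<le> card (bodies_at x)"
  then have "bodies_at x \<noteq> {}" "card (bodies_at x) \<le> 1" using assms by (auto simp: bodies_at_def)
  then obtain i where i: "bodies_at x = {i}" by (metis card_1_singletonE card_0_eq finite_bodies_at le_antisym One_nat_def Suc_leI gr_zeroI)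
  then have "g i x = 0" using balanced_sums(1)[OF bal, of x] by simp
  then show False using g_nonzero i by (auto simp: bodies_at_def)
qed

lemma sum_weight_ge: "I \<subseteq> bodies_at x \<Longrightarrow> real (card I) / 2 \<le> (\<Sum>i\<in>I. weight i)"
  using sum_bounded_below[of I "1 / 2" weight] weight_ge(1) bodies_at_subset by (force simp: subset_iff)

text \<open>
  If there are only two bodies at \<open>x\<close>, their forces are opposite, hence parallel, so at most one of them has two points and
  the other sends charge at least 1.
\<close>

lemma charge_ge_in_T:
  assumes "x \<in> snd ` Inc" "x \<in> T"
  shows "- (1 / 2) \<le> charge x"
proof (cases "3 \<le> card (bodies_at x)")
  case True
  then have "3 / 2 \<le> (\<Sum>i\<in>bodies_at x. weight i)" using sum_weight_ge[of "bodies_at x" x] by simp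
  then show ?thesis by (simp add: charge_def)
next
  case False
  then have "card (bodies_at x) = 2" using card_bodies_at[OF assms(1)] by simp
  then obtain i j where ij: "bodies_at x = {i, j}" "i \<noteq> j" by (metis card_2_iff)
  then have I: "(i, x) \<in> Inc" "(j, x) \<in> Inc" by (auto simp: bodies_at_def)
  then have "i \<in> fst ` Inc" "j \<in> fst ` Inc" by force+
  moreover have "\<not> (card (points i) = 2 \<and> card (points j) = 2)"
  proof
    assume "card (points i) = 2 \<and> card (points j) = 2"
    moreover have "g i x + g j x = 0" using balanced_sums(1)[OF bal, of x] ij by simp
    then have "g i x = - g j x" by (simp add: eq_neg_iff_add_eq_0)
    ultimately show False using parallel_two_bodies[OF I ij(2)] assms(2) by auto
  qed
  ultimately have "1 / 2 \<le> weight i" "1 / 2 \<le> weight j" "1 \<le> weight i \<or> 1 \<le> weight j" using weight_ge by blast+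
  moreover have "charge x = weight i + weight j - 2" using ij by (simp add: charge_def)
  ultimately show ?thesis by linarith
qed

text \<open>
  With two bodies the two equations at \<open>x\<close> would make the forces zero, and four bodies send enough charge.
  With three bodies the equations make the three forces parallel. If each body has two points, their other ends
  therefore lie in \<open>T\<close>, and \<open>x\<close> is a claw; otherwise some body sends charge at least 1.
\<close>

lemma charge_ge_outside_T:
  assumes "x \<in> snd ` Inc" "x \<notin> T"
  shows "(if claw x then - (1 / 2) else 0) \<le> charge x"
proof -
  have xV: "x \<in> V - T" using assms mem_V by auto
  have D3: "3 \<le> card (bodies_at x)"
  proof (rule ccontr)
    assume "\<not> 3 \<le> card (bodies_at x)"
    then have "card (bodies_at x) = 2" using card_bodies_at[OF assms(1)] by simp
    then obtain i j where ij: "bodies_at x = {i, j}" "i \<noteq> j" by (metis card_2_iff)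
    then have I: "(i, x) \<in> Inc" "(j, x) \<in> Inc" by (auto simp: bodies_at_def)
    have "g i x + g j x = 0" "\<gamma> i *\<^sub>R g i x + \<gamma> j *\<^sub>R g j x = 0"
      using balanced_sums(1)[OF bal, of x] weighted_sum[OF xV] ij by auto
    then have "g j x = - g i x" "\<gamma> i *\<^sub>R g i x + \<gamma> j *\<^sub>R g j x = 0" by (auto simp: add_eq_0_iff)
    then have "(\<gamma> i - \<gamma> j) *\<^sub>R g i x = 0" by (simp add: scaleR_left_diff_distrib)
    then show False using dist[OF I ij(2)] g_nonzero[OF I(1)] by simp
  qed
  have low: "- (1 / 2) \<le> charge x" using sum_weight_ge[of "bodies_at x" x] D3 by (simp add: charge_def)
  show ?thesis
  proof (cases "4 \<le> card (bodies_at x)")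
    case True
    then show ?thesis using sum_weight_ge[of "bodies_at x" x] by (auto simp: charge_def)
  next
    case False
    then have "card (bodies_at x) = 3" using D3 by simp
    then obtain i j k where ijk: "bodies_at x = {i, j, k}" "i \<noteq> j" "i \<noteq> k" "j \<noteq> k"
      by (auto simp: card_3_iff)
    then have I: "(i, x) \<in> Inc" "(j, x) \<in> Inc" "(k, x) \<in> Inc" by (auto simp: bodies_at_def)
    then have fst: "i \<in> fst ` Inc" "j \<in> fst ` Inc" "k \<in> fst ` Inc" by force+
    show ?thesis
    proof (cases "card (points i) = 2 \<and> card (points j) = 2 \<and> card (points k) = 2")
      case False
      then have "1 \<le> weight i \<or> 1 \<le> weight j \<or> 1 \<le> weight k" using weight_ge(2) fst by blast
      moreover have "1 / 2 \<le> weight i" "1 / 2 \<le> weight j" "1 / 2 \<le> weight k" using weight_ge(1) fst by blast+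
      moreover have "charge x = weight i + weight j + weight k - 2" using ijk by (simp add: charge_def)
      ultimately have "0 \<le> charge x" by linarith
      then show ?thesis by simp
    next
      case True
      have s: "g i x + g j x + g k x = 0" "\<gamma> i *\<^sub>R g i x + \<gamma> j *\<^sub>R g j x + \<gamma> k *\<^sub>R g k x = 0"
        using balanced_sums(1)[OF bal, of x] weighted_sum[OF xV] ijk by (auto simp: add.assoc)
      have dot: "g i x \<bullet> d + g j x \<bullet> d + g k x \<bullet> d = 0"
        "\<gamma> i * (g i x \<bullet> d) + \<gamma> j * (g j x \<bullet> d) + \<gamma> k * (g k x \<bullet> d) = 0" for d
        using arg_cong[OF s(1), of "\<lambda>v. v \<bullet> d"] arg_cong[OF s(2), of "\<lambda>v. v \<bullet> d"]
        by (simp_all add: inner_add_left)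
      have par_ij: "g i x \<bullet> d = 0" if "g j x \<bullet> d = 0" for d
      proof -
        have "(\<gamma> i - \<gamma> k) * (g i x \<bullet> d) = 0" using dot[of d] that by algebra
        then show ?thesis using dist I ijk by simp
      qed
      have par_ik: "g i x \<bullet> d = 0" if "g k x \<bullet> d = 0" for d
      proof -
        have "(\<gamma> i - \<gamma> j) * (g i x \<bullet> d) = 0" using dot[of d] that by algebra
        then show ?thesis using dist I ijk by simp
      qed
      have par_jk: "g j x \<bullet> d = 0" if "g k x \<bullet> d = 0" for d
      proof -
        have "(\<gamma> j - \<gamma> i) * (g j x \<bullet> d) = 0" using dot[of d] that by algebra
        then show ?thesis using dist I ijk by simp
      qed
      obtain a b where a: "points i = {x, a}" "points j = {x, b}" "a \<in> T" "b \<in> T" "a \<noteq> b"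
        using parallel_two_bodies[OF I(1,2) ijk(2) _ _ par_ij] True by metis
      obtain a' c where c: "points i = {x, a'}" "points k = {x, c}" "a' \<in> T" "c \<in> T" "a' \<noteq> c"
        using parallel_two_bodies[OF I(1,3) ijk(3) _ _ par_ik] True by metis
      obtain b' c' where b: "points j = {x, b'}" "points k = {x, c'}" "b' \<in> T" "c' \<in> T" "b' \<noteq> c'"
        using parallel_two_bodies[OF I(2,3) ijk(4) _ _ par_jk] True by metis
      have eq: "a' = a" "b' = b" "c' = c" using a(1,2) b(1,2) c(1,2) a(3,4) c(3,4) b(3,4) assms(2) by (metis doubleton_eq_iff)+
      have "card {a, b, c} = 3" using a(5) b(5) c(5) unfolding eq by simp
      moreover have sub: "{a, b, c} \<subseteq> T" using a(3,4) c(4) by simp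
      ultimately have "card T = 3" "T = {a, b, c}"
        using T3 card_mono[OF fin(2) sub] card_subset_eq[OF fin(2) sub] by auto
      moreover have "(i, a) \<in> Inc" "(j, b) \<in> Inc" "(k, c) \<in> Inc"
        using a(1,2) c(2) by (auto simp: points_def)
      ultimately have "claw x" unfolding claw_def using xV I by blast
      then show ?thesis using low by simp
    qed
  qed
qed

text \<open>
  Two edges of a claw at \<open>x\<close> make \<open>z v - z u\<close> a multiple of \<open>p x - p u\<close>, for \<open>u\<close> and \<open>v\<close> in \<open>T\<close>.
  As \<open>z\<close> separates \<open>u\<close> from \<open>v\<close>, this determines the line through \<open>p u\<close> and \<open>p x\<close>, which contains the
  image of only one vertex outside \<open>T\<close>.
\<close>

lemma claw_unique:
  assumes "claw x" "claw x'"
  shows "x = x'"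
proof (rule ccontr)
  assume ne: "x \<noteq> x'"
  have "card T = 3" using assms by (simp add: claw_def)
  then obtain u v where uv: "u \<in> T" "v \<in> T" "u \<noteq> v" by (auto simp: card_3_iff)
  have puv: "p u = p v" using coinc uv unfolding coincident_def by blast
  have *: "\<exists>c. z v - z u = c *\<^sub>R (p x - p u) \<and> x \<in> V - T \<and> u \<in> V" if claw: "claw x" for x
  proof -
    obtain i where i: "(i, x) \<in> Inc" "(i, u) \<in> Inc" using claw uv by (auto simp: claw_def)
    obtain j where j: "(j, x) \<in> Inc" "(j, v) \<in> Inc" using claw uv by (auto simp: claw_def)
    have "z v - z u = (\<gamma> i - \<gamma> j) *\<^sub>R (p x - p u)"
      using z[OF i(1)] z[OF i(2)] z[OF j(1)] z[OF j(2)] puv by (simp add: algebra_simps)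
    then show ?thesis using i mem_V claw by (auto simp: claw_def)
  qed
  obtain c where c: "z v - z u = c *\<^sub>R (p x - p u)" "x \<in> V - T" "u \<in> V" using *[OF assms(1)] by blast
  obtain c' where c': "z v - z u = c' *\<^sub>R (p x' - p u)" "x' \<in> V - T" using *[OF assms(2)] by blast
  have "z v - z u \<noteq> 0" using injT uv by (auto dest: inj_onD)
  then have "c \<noteq> 0" "c' \<noteq> 0" using c c' by auto
  moreover have "c * c' * cross2 (p x - p u) (p x' - p u) = cross2 (c *\<^sub>R (p x - p u)) (c' *\<^sub>R (p x' - p u))"
    by (simp add: cross2_def algebra_simps)
  moreover have "cross2 (c *\<^sub>R (p x - p u)) (c' *\<^sub>R (p x' - p u)) = 0"
    using c(1) c'(1) by (metis cross2_def mult.commute right_minus_eq)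
  ultimately have "cross2 (p x - p u) (p x' - p u) = 0" by simp
  moreover have "cross2 (p x - p u) (p x' - p u) \<noteq> 0"
    using noncollinear[of u x x'] c c' uv ne by blast
  ultimately show False by blast
qed

lemma sum_charge:
  "(\<Sum>x\<in>snd ` Inc. charge x) = 2 * real (card Inc) - 3 * real (card (fst ` Inc)) - 2 * real (card (snd ` Inc))"
proof -
  define f where "f = (\<lambda>i x. if (i, x) \<in> Inc then weight i else 0)"
  have "(\<Sum>x\<in>snd ` Inc. \<Sum>i\<in>bodies_at x. weight i) = (\<Sum>x\<in>snd ` Inc. \<Sum>i\<in>fst ` Inc. f i x)"
    using bodies_at_subset finite_Inc by (intro sum.cong sum.mono_neutral_cong_left) (auto simp: f_def bodies_at_def)
  also have "\<dots> = (\<Sum>i\<in>fst ` Inc. \<Sum>x\<in>snd ` Inc. f i x)" by (rule sum.swap)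
  also have "\<dots> = (\<Sum>i\<in>fst ` Inc. \<Sum>x\<in>points i. weight i)"
    using points_subset finite_Inc by (intro sum.cong sum.mono_neutral_cong_right) (auto simp: f_def points_def)
  also have "\<dots> = (\<Sum>i\<in>fst ` Inc. 2 * real (card (points i)) - 3)"
    using card_points by (intro sum.cong) (force simp: weight_def field_simps)+
  also have "\<dots> = 2 * (\<Sum>i\<in>fst ` Inc. real (card (points i))) - 3 * real (card (fst ` Inc))"
    by (simp add: sum_subtractf sum_distrib_left)
  also have "(\<Sum>i\<in>fst ` Inc. real (card (points i))) = real (card Inc)"
  proof -
    have "Inc = Sigma (fst ` Inc) points" by (force simp: points_def)
    then have "card Inc = (\<Sum>i\<in>fst ` Inc. card (points i))"
      using card_SigmaI[of "fst ` Inc" points] finite_Inc by simp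
    then show ?thesis by simp
  qed
  finally show ?thesis by (simp add: charge_def sum_subtractf)
qed

text \<open>
  Only the points of \<open>T\<close>, at most three, and at most one claw can have negative charge, and not less than
  \<open>-1/2\<close> each.
\<close>

lemma sum_charge_ge: "- 2 \<le> (\<Sum>x\<in>snd ` Inc. charge x)"
proof -
  let ?X = "snd ` Inc"
  have fX: "finite ?X" using finite_Inc by simp
  have "(\<Sum>x\<in>?X. (if x \<in> T then - (1 / 2) else 0) + (if claw x then - (1 / 2) else 0)) \<le> (\<Sum>x\<in>?X. charge x)"
  proof (rule sum_mono)
    fix x assume x: "x \<in> ?X"
    show "(if x \<in> T then - (1 / 2) else 0) + (if claw x then - (1 / 2) else 0) \<le> charge x"
      using charge_ge_in_T[OF x] charge_ge_outside_T[OF x] by (cases "x \<in> T") (auto simp: claw_def)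
  qed
  moreover have "(\<Sum>x\<in>?X. if x \<in> T then - (1 / 2) else 0 :: real) = - real (card (?X \<inter> T)) / 2"
    using fX by (simp add: sum.If_cases Int_def)
  moreover have "(\<Sum>x\<in>?X. if claw x then - (1 / 2) else 0 :: real) = - real (card (?X \<inter> Collect claw)) / 2"
    using fX by (simp add: sum.If_cases Int_def)
  moreover have "card (?X \<inter> T) \<le> 3" using T3 card_mono[OF fin(2), of "?X \<inter> T"] by simp
  moreover have "card (?X \<inter> Collect claw) \<le> 1"
    using claw_unique by (intro card_le_Suc0_iff_eq[THEN iffD2, folded One_nat_def]) (use fX in auto)
  ultimately show ?thesis by (simp add: sum.distrib)
qed

lemma exists_balanced_z:
  assumes "i1 \<in> fst ` Inc" "i2 \<in> fst ` Inc" "\<gamma> i1 \<noteq> \<gamma> i2" "finite Q" "(i0, x0) \<in> Inc"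
    and "2 * card (snd ` Inc) + 3 * card (fst ` Inc) + card Q < 2 * card Inc + 4"
  shows "\<exists>h. balanced Inc p h \<and> (\<exists>i x. h i x \<noteq> 0) \<and> (\<forall>q\<in>Q. h i0 x0 \<bullet> q = 0)"
  by (rule exists_balanced[of Inc z \<gamma> p \<tau> i1 i2 Q i0 x0]) (use finite_Inc z assms in blast)+

text \<open>
  The charge bound leaves room for extra conditions in \<open>exists_balanced\<close>: one if the total is at least
  \<open>-2\<close>, two if it is at least 0. Two conditions kill a force; one is enough on a body with two
  points, where the direction of the force is already known.
\<close>

lemma no_critical_bodies: False
proof -
  obtain i0 x0 where ix: "(i0, x0) \<in> Inc" using nz bal unfolding balanced_def by blast
  have "2 \<le> card (bodies_at x0)" using card_bodies_at ix by force
  then obtain i1 i2 where i12: "i1 \<in> bodies_at x0" "i2 \<in> bodies_at x0" "i1 \<noteq> i2"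
    using card_le_Suc0_iff_eq[of "bodies_at x0"] by fastforce
  then have i: "i1 \<in> fst ` Inc" "i2 \<in> fst ` Inc" "\<gamma> i1 \<noteq> \<gamma> i2"
    using dist[of i1 x0 i2] by (force simp: bodies_at_def)+
  show False
  proof (cases "\<exists>i\<in>fst ` Inc. card (points i) = 2")
    case True
    then obtain i x where ix: "(i, x) \<in> Inc" "card (points i) = 2" by auto
    obtain y where y: "points i = {x, y}" "x \<noteq> y" "(i, y) \<in> Inc" using two_body ix by blast
    let ?d = "p x - p y"
    have "2 * card (snd ` Inc) + 3 * card (fst ` Inc) + card {perp ?d} < 2 * card Inc + 4"
      using sum_charge_ge unfolding sum_charge by simp
    then obtain h where h: "balanced Inc p h" "\<exists>i x. h i x \<noteq> 0" "h i x \<bullet> perp ?d = 0"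
      using exists_balanced_z[OF i _ ix(1), of "{perp ?d}"] by auto
    have "h i x \<bullet> ?d = 0" using two_body_force[OF h(1) y(1,2)] .
    moreover have "?d \<noteq> 0" using body_points_distinct ix y by simp
    then have "?d $ 1 * ?d $ 1 + ?d $ 2 * ?d $ 2 \<noteq> 0" by (metis inner_2 inner_eq_zero_iff)
    moreover have "(?d $ 1 * ?d $ 1 + ?d $ 2 * ?d $ 2) * h i x $ 1 = ?d $ 1 * (h i x \<bullet> ?d) - ?d $ 2 * (h i x \<bullet> perp ?d)"
      "(?d $ 1 * ?d $ 1 + ?d $ 2 * ?d $ 2) * h i x $ 2 = ?d $ 2 * (h i x \<bullet> ?d) + ?d $ 1 * (h i x \<bullet> perp ?d)"
      by (simp_all add: inner_2 algebra_simps)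
    ultimately have "h i x = 0" using h(3) unfolding vec_eq_2 by auto
    then show False using crit[OF h(1,2) ix(1)] by simp
  next
    case False
    have "0 \<le> charge x" if "x \<in> snd ` Inc" for x
    proof -
      have "1 \<le> weight i" if "i \<in> bodies_at x" for i
        using weight_ge(2)[of i] False bodies_at_subset[of x] that by blast
      then have "real (card (bodies_at x)) * 1 \<le> (\<Sum>i\<in>bodies_at x. weight i)" by (rule sum_bounded_below)
      then show ?thesis using card_bodies_at[OF that] by (simp add: charge_def)
    qed
    then have "0 \<le> (\<Sum>x\<in>snd ` Inc. charge x)" by (intro sum_nonneg) auto
    then have "2 * card (snd ` Inc) + 3 * card (fst ` Inc) \<le> 2 * card Inc" unfolding sum_charge by simp
    moreover have "card {axis 1 1, axis 2 1 :: real ^ 2} \<le> 2" by (simp add: card_insert_if)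
    ultimately have "2 * card (snd ` Inc) + 3 * card (fst ` Inc) + card {axis 1 1, axis 2 1 :: real ^ 2} < 2 * card Inc + 4"
      by linarith
    then obtain h where h: "balanced Inc p h" "\<exists>i x. h i x \<noteq> 0"
        "h i0 x0 \<bullet> axis 1 1 = 0" "h i0 x0 \<bullet> axis 2 1 = 0"
      using exists_balanced_z[OF i _ ix, of "{axis 1 1, axis 2 1}"] by auto
    have "h i0 x0 = 0" using h(3,4) by (simp add: vec_eq_2 inner_axis)
    then show False using crit[OF h(1,2) ix] by simp
  qed
qed

end

text \<open>
  Otherwise a minimal set of incidences that carries a nonzero balanced system would be critical.
\<close>

theorem balanced_eq_0:
  fixes V T :: "'a set"
  assumes "finite V" "finite T" "card T \<le> 3"
    and "coincident T p" "general_position V T p" "force_generic V T p"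
    and "Inc \<subseteq> Pow V \<times> V"
    and "\<And>i x. (i, x) \<in> Inc \<Longrightarrow> z x = \<gamma> i *\<^sub>R p x + \<tau> i"
    and "\<And>i j x. (i, x) \<in> Inc \<Longrightarrow> (j, x) \<in> Inc \<Longrightarrow> i \<noteq> j \<Longrightarrow> \<gamma> i \<noteq> \<gamma> j"
    and "inj_on z T" and "balanced Inc p g"
  shows "g i x = 0"
proof -
  have "finite Inc" using assms(1,7) by (meson finite_Pow_iff finite_SigmaI finite_subset)
  then have "\<forall>g i x. balanced Inc p g \<longrightarrow> g i x = 0" using assms(7-9)
  proof (induction Inc rule: finite_psubset_induct)
    case (psubset Inc)
    show ?case
    proof (rule ccontr)
      assume "\<not> ?thesis"
      then obtain g where g: "balanced Inc p g" "\<exists>i x. g i x \<noteq> 0" by blast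
      have crit: "h i x \<noteq> 0" if h: "balanced Inc p h" "\<exists>i x. h i x \<noteq> 0" and ix: "(i, x) \<in> Inc" for h i x
      proof
        assume 0: "h i x = 0"
        let ?Inc = "Inc - {(i, x)}"
        have "balanced ?Inc p h"
          using 0 h(1) by (intro balanced_subset[OF psubset.hyps h(1)]) (auto simp: balanced_def)
        moreover have "?Inc \<subset> Inc" using ix by blast
        ultimately have "h j y = 0" for j y
          using psubset.IH[of ?Inc] psubset.prems by blast
        then show False using h(2) by blast
      qed
      interpret critical_bodies V T p z Inc \<gamma> \<tau> g
      proof unfold_locales
        show "finite V" "finite T" "card T \<le> 3" "coincident T p" "general_position V T p"
          "force_generic V T p" "inj_on z T" by fact+
        show "Inc \<subseteq> Pow V \<times> V" by (rule psubset.prems(1))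
        show "z x = \<gamma> i *\<^sub>R p x + \<tau> i" if "(i, x) \<in> Inc" for i x using psubset.prems(2) that .
        show "\<gamma> i \<noteq> \<gamma> j" if "(i, x) \<in> Inc" "(j, x) \<in> Inc" "i \<noteq> j" for i j x
          using psubset.prems(3) that .
        show "balanced Inc p g" "\<exists>i x. g i x \<noteq> 0" by fact+
        show "h i x \<noteq> 0" if "balanced Inc p h" "\<exists>i x. h i x \<noteq> 0" "(i, x) \<in> Inc" for h i x
          using crit that .
      qed
      show False by (rule no_critical_bodies)
    qed
  qed
  then show ?thesis using assms(11) by blast
qed

section \<open>The bodies of a parallel redrawing\<close>

definition bodies :: "'a set \<Rightarrow> ('a \<Rightarrow> real ^ 2) \<Rightarrow> ('a \<Rightarrow> real ^ 2) \<Rightarrow> 'a set set" where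
  "bodies V p z = {K. (\<exists>\<gamma> \<tau>. K = {x \<in> V. z x = \<gamma> *\<^sub>R p x + \<tau>}) \<and> 2 \<le> card K}"

text \<open>
  If two bodies are scaled differently, the count is what \<open>exists_balanced\<close> and \<open>balanced_eq_0\<close> leave over.
  If all bodies are scaled by the same factor, they are disjoint, and the count is elementary.
\<close>

lemma bodies_count:
  fixes V T :: "'a set"
  assumes "finite V" "finite T" "card T \<le> 3" "2 \<le> card V"
    and "coincident T p" "general_position V T p" "force_generic V T p"
    and "inj_on z T"
    and nontriv: "\<nexists>\<gamma> \<tau>. \<forall>x\<in>V. z x = \<gamma> *\<^sub>R p x + \<tau>"
  shows "(\<Sum>K\<in>bodies V p z. 2 * card K - 3) \<le> 2 * card V - 4"
proof -
  let ?B = "bodies V p z"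
  have sub: "K \<subseteq> V" and K2: "2 \<le> card K" if "K \<in> ?B" for K
    using that by (auto simp: bodies_def)
  have finB: "finite ?B" using sub assms(1) by (meson PowI finite_Pow_iff finite_subset subsetI)
  have finK: "finite K" if "K \<in> ?B" for K using sub[OF that] assms(1) finite_subset by blast
  have ne: "K \<noteq> V" if "K \<in> ?B" for K
  proof
    assume "K = V"
    then have "\<exists>\<gamma> \<tau>. V = {x \<in> V. z x = \<gamma> *\<^sub>R p x + \<tau>}" using that by (simp add: bodies_def)
    then show False using nontriv by blast
  qed
  obtain \<gamma> \<tau> where K: "\<And>K. K \<in> ?B \<Longrightarrow> K = {x \<in> V. z x = \<gamma> K *\<^sub>R p x + \<tau> K}"
  proof -
    have "\<forall>K\<in>?B. \<exists>c. K = {x \<in> V. z x = fst c *\<^sub>R p x + snd c}"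
    proof
      fix K assume "K \<in> ?B"
      then obtain \<gamma> \<tau> where "K = {x \<in> V. z x = \<gamma> *\<^sub>R p x + \<tau>}" unfolding bodies_def by blast
      then show "\<exists>c. K = {x \<in> V. z x = fst c *\<^sub>R p x + snd c}" by (intro exI[of _ "(\<gamma>, \<tau>)"]) simp
    qed
    from bchoice[OF this] obtain c where c: "\<forall>K\<in>?B. K = {x \<in> V. z x = fst (c K) *\<^sub>R p x + snd (c K)}" ..
    show ?thesis
    proof (rule that)
      show "K = {x \<in> V. z x = (fst \<circ> c) K *\<^sub>R p x + (snd \<circ> c) K}" if "K \<in> ?B" for K
        using bspec[OF c that] by (simp only: o_apply)
    qed
  qed
  have zK: "z x = \<gamma> K *\<^sub>R p x + \<tau> K" if "K \<in> ?B" "x \<in> K" for K x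
    using K[OF that(1)] that(2) by blast
  \<comment> \<open>Distinct bodies through a common point have distinct scaling factors.\<close>
  have same: "K = L" if "K \<in> ?B" "L \<in> ?B" "x \<in> K" "x \<in> L" "\<gamma> K = \<gamma> L" for K L x
  proof -
    have "\<tau> K = \<tau> L" using zK[OF that(1,3)] zK[OF that(2,4)] that(5) by simp
    then show ?thesis using K[OF that(1)] K[OF that(2)] that(5) by simp
  qed
  have sum_eq: "(\<Sum>K\<in>?B. 2 * card K - 3) + 3 * card ?B = 2 * (\<Sum>K\<in>?B. card K)"
  proof -
    have "(\<Sum>K\<in>?B. 2 * card K - 3) + 3 * card ?B = (\<Sum>K\<in>?B. (2 * card K - 3) + 3)"
      by (simp add: sum.distrib del: sum_constant) simp
    also have "\<dots> = (\<Sum>K\<in>?B. 2 * card K)" using K2 by (intro sum.cong) fastforce+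
    finally show ?thesis by (simp add: sum_distrib_left)
  qed
  show ?thesis
  proof (cases "\<exists>K1\<in>?B. \<exists>K2\<in>?B. \<gamma> K1 \<noteq> \<gamma> K2")
    case True
    then obtain K1 K2 where K12: "K1 \<in> ?B" "K2 \<in> ?B" "\<gamma> K1 \<noteq> \<gamma> K2" by blast
    define Inc where "Inc = Sigma ?B (\<lambda>K. K)"
    have fI: "finite Inc" using finB finK by (simp add: Inc_def)
    have zI: "z x = \<gamma> i *\<^sub>R p x + \<tau> i" if "(i, x) \<in> Inc" for i x using zK that by (auto simp: Inc_def)
    have "fst ` Inc = ?B"
    proof
      show "?B \<subseteq> fst ` Inc"
      proof
        fix K assume "K \<in> ?B"
        moreover from this obtain x where "x \<in> K" using K2[of K] by fastforce
        ultimately show "K \<in> fst ` Inc" unfolding Inc_def by force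
      qed
    qed (auto simp: Inc_def)
    moreover have "snd ` Inc \<subseteq> V" unfolding Inc_def using sub by fastforce
    then have "card (snd ` Inc) \<le> card V" using assms(1) by (rule card_mono[rotated])
    moreover have "card Inc = (\<Sum>K\<in>?B. card K)" using finB finK by (simp add: Inc_def)
    moreover have "\<not> 2 * card (snd ` Inc) + 3 * card (fst ` Inc) + card {} < 2 * card Inc + 4"
    proof
      assume lt: "2 * card (snd ` Inc) + 3 * card (fst ` Inc) + card {} < 2 * card Inc + 4"
      have i12: "K1 \<in> fst ` Inc" "K2 \<in> fst ` Inc" using K12 \<open>fst ` Inc = ?B\<close> by auto
      then obtain x where x: "(K1, x) \<in> Inc" by auto
      obtain g where g: "balanced Inc p g" "\<exists>i x. g i x \<noteq> 0"
        by (rule exists_balanced[of Inc z \<gamma> p \<tau> K1 K2 "{}" K1 x]) (use fI zI i12 K12 lt x in auto)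
      have "g i x = 0" for i x
      proof (rule balanced_eq_0[of V T p Inc z \<gamma> \<tau> g])
        show "Inc \<subseteq> Pow V \<times> V" using sub by (auto simp: Inc_def)
        show "\<gamma> i \<noteq> \<gamma> j" if "(i, x) \<in> Inc" "(j, x) \<in> Inc" "i \<noteq> j" for i j x
          using same that by (auto simp: Inc_def)
      qed (use assms zI g in auto)
      then show False using g(2) by blast
    qed
    ultimately show ?thesis using sum_eq by simp
  next
    case False
    \<comment> \<open>One body misses a vertex, and two or more disjoint bodies lose at least 6 from \<open>2 |V|\<close>.\<close>
    then have disj: "K \<inter> L = {}" if "K \<in> ?B" "L \<in> ?B" "K \<noteq> L" for K L using same that by blast
    then have "card (\<Union>?B) = (\<Sum>K\<in>?B. card K)" using finK
      by (intro card_Union_disjoint) (auto simp: pairwise_def disjnt_def)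
    moreover have "card (\<Union>?B) \<le> card V" using sub assms(1) by (intro card_mono) auto
    ultimately have le: "(\<Sum>K\<in>?B. card K) \<le> card V" by simp
    consider "card ?B = 0" | "card ?B = 1" | "2 \<le> card ?B" by linarith
    then show ?thesis
    proof cases
      case 1
      then show ?thesis using finB by simp
    next
      case 2
      then obtain K where "?B = {K}" by (metis card_1_singletonE)
      moreover have "card K < card V" using sub ne assms(1) calculation by (intro psubset_card_mono) auto
      ultimately show ?thesis by simp
    next
      case 3
      then show ?thesis using sum_eq le by linarith
    qed
  qed
qed

section \<open>Rank bounds for rigidity matrices\<close>

lemma rigidity_matrix_outside: "v \<notin> e \<Longrightarrow> rigidity_matrix q e (v, l) = 0"
  by (simp add: rigidity_matrix_def)

lemma sum_rigidity_row:
  assumes "finite K" "x \<in> K" "y \<in> K" "x \<noteq> y"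
  shows "(\<Sum>c\<in>K \<times> UNIV. rigidity_matrix q {x, y} c * F (fst c) $ snd c) = (q x - q y) \<bullet> (F x - F y)"
proof -
  have "(\<Sum>c\<in>K \<times> UNIV. rigidity_matrix q {x, y} c * F (fst c) $ snd c) =
      (\<Sum>v\<in>K. \<Sum>l\<in>UNIV. rigidity_matrix q {x, y} (v, l) * F v $ l)"
    by (simp add: sum.cartesian_product')
  also have "\<dots> = (\<Sum>v\<in>{x, y}. \<Sum>l\<in>UNIV. rigidity_matrix q {x, y} (v, l) * F v $ l)"
    using assms by (intro sum.mono_neutral_right) (auto simp: rigidity_matrix_edge intro!: sum.neutral)
  also have "\<dots> = (q x - q y) \<bullet> F x + (q y - q x) \<bullet> F y"
    using assms(4) by (simp add: rigidity_matrix_edge inner_vec_def)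
  finally show ?thesis by (simp add: inner_diff_left inner_diff_right)
qed

lemma perp_coordinate:
  assumes "d \<noteq> 0"
  obtains l where "perp d $ l \<noteq> 0"
  using assms that[of 1] that[of 2] by (auto simp: vec_eq_2)

text \<open>
  A stress on \<open>K\<close> has to satisfy \<open>2 |K|\<close> equilibrium conditions, of which three follow from the others by
  pairing with translations and a rotation.
\<close>

lemma indep_rigidity_rows_card:
  assumes "finite K" "2 \<le> card K" "\<And>e. e \<in> B \<Longrightarrow> e \<subseteq> K \<and> card e = 2"
    and ind: "indep_rows B (rigidity_matrix q)"
  shows "card B \<le> 2 * card K - 3"
proof (rule ccontr)
  assume "\<not> card B \<le> 2 * card K - 3"
  then have big: "2 * card K - 3 < card B" by simp
  have "B \<subseteq> Pow K" using assms(3) by blast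
  then have finB: "finite B" using assms(1) finite_subset by auto
  have edge: "\<exists>x y. e = {x, y} \<and> x \<noteq> y \<and> x \<in> K \<and> y \<in> K" if "e \<in> B" for e
    using assms(3)[OF that] by (auto simp: card_2_iff)
  show False
  proof (cases "\<exists>a\<in>K. \<exists>b\<in>K. q a \<noteq> q b")
    case False
    obtain e where e: "e \<in> B" using big by fastforce
    obtain x y where xy: "e = {x, y}" "x \<noteq> y" "x \<in> K" "y \<in> K" using edge[OF e] by blast
    then have "q x = q y" using False by blast
    then have "rigidity_matrix q e c = 0" for c
      using xy(2) unfolding xy(1) by (cases c) (simp add: rigidity_matrix_edge)
    then have "\<forall>c. (\<Sum>r\<in>B. (if r = e then 1 else 0) * rigidity_matrix q r c) = 0"
      using finB e by (simp add: sum_delta_mult)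
    then have "\<forall>r\<in>B. (if r = e then 1 else 0) = (0 :: real)"
      using ind unfolding indep_rows_def by (elim allE[of _ "\<lambda>r. if r = e then 1 else 0"]) blast
    then show False using e by auto
  next
    case True
    then obtain a b where ab: "a \<in> K" "b \<in> K" "q b - q a \<noteq> 0" by (metis right_minus_eq)
    then have "a \<noteq> b" by auto
    obtain l0 where l0: "perp (q b - q a) $ l0 \<noteq> 0" using perp_coordinate ab by blast
    \<comment> \<open>The three redundant equilibrium conditions; \<open>l0\<close> is a coordinate in which the rotation about
      \<open>q a\<close> moves \<open>q b\<close>.\<close>
    define X where "X = {(a, 1), (a, 2), (b, l0)}"
    define E where "E = (\<lambda>c e. rigidity_matrix q e c) ` (K \<times> UNIV - X)"
    have finE: "finite E" using assms(1) by (simp add: E_def)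
    have "card X = 3" using \<open>a \<noteq> b\<close> by (auto simp: X_def)
    moreover have "X \<subseteq> K \<times> UNIV" using ab by (auto simp: X_def)
    ultimately have "card (K \<times> UNIV - X) = 2 * card K - 3"
      using assms(1) by (simp add: card_Diff_subset finite_subset card_cartesian_product X_def)
    then have "card E < card B" using big assms(1) card_image_le[of "K \<times> UNIV - X" "\<lambda>c e. rigidity_matrix q e c"]
      by (simp add: E_def)
    then obtain y where y: "\<exists>e\<in>B. y e \<noteq> 0" "\<And>e. e \<notin> B \<Longrightarrow> y e = 0"
      "\<And>f. f \<in> E \<Longrightarrow> (\<Sum>e\<in>B. f e * y e) = 0"
      by (rule homogeneous_system_nontrivial_solution[OF finE finB]) blast
    define h where "h = (\<lambda>c. \<Sum>e\<in>B. y e * rigidity_matrix q e c)"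
    have h0: "h c = 0" if "c \<notin> X" for c
    proof (cases "fst c \<in> K")
      case True
      then have "c \<in> K \<times> UNIV - X" using that by (cases c) auto
      then have "(\<lambda>e. rigidity_matrix q e c) \<in> E" unfolding E_def by blast
      from y(3)[OF this] show ?thesis by (simp add: h_def mult.commute)
    next
      case False
      have "rigidity_matrix q e c = 0" if "e \<in> B" for e
        using False assms(3)[OF that] by (cases c) (auto intro: rigidity_matrix_outside)
      then show ?thesis by (simp add: h_def)
    qed
    \<comment> \<open>Pairing the resulting forces with a trivial motion \<open>F\<close>.\<close>
    have test: "(\<Sum>c\<in>X. h c * F (fst c) $ snd c) = 0"
      if F: "\<And>x y. x \<in> K \<Longrightarrow> y \<in> K \<Longrightarrow> (q x - q y) \<bullet> (F x - F y) = 0" for F :: "'a \<Rightarrow> real ^ 2"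
    proof -
      have "(\<Sum>c\<in>X. h c * F (fst c) $ snd c) = (\<Sum>c\<in>K \<times> UNIV. h c * F (fst c) $ snd c)"
        using \<open>X \<subseteq> K \<times> UNIV\<close> assms(1) h0 by (intro sum.mono_neutral_left) auto
      also have "\<dots> = (\<Sum>e\<in>B. y e * (\<Sum>c\<in>K \<times> UNIV. rigidity_matrix q e c * F (fst c) $ snd c))"
        by (simp add: h_def sum_distrib_left sum_distrib_right sum.swap[of _ "K \<times> UNIV" B] mult.assoc)
      also have "\<dots> = 0"
      proof (intro sum.neutral ballI)
        fix e assume "e \<in> B"
        then obtain x z where "e = {x, z}" "x \<noteq> z" "x \<in> K" "z \<in> K" using edge by blast
        then show "y e * (\<Sum>c\<in>K \<times> UNIV. rigidity_matrix q e c * F (fst c) $ snd c) = 0"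
          using sum_rigidity_row[OF assms(1), of x z q F] F by simp
      qed
      finally show ?thesis .
    qed
    have sumX: "(\<Sum>c\<in>X. f c) = f (a, 1) + f (a, 2) + f (b, l0)" for f :: "'a \<times> 2 \<Rightarrow> real"
      using \<open>a \<noteq> b\<close> by (simp add: X_def)
    have "(\<Sum>c\<in>X. h c * perp (q (fst c) - q a) $ snd c) = 0"
      by (rule test) (simp add: inner_2 algebra_simps)
    then have "h (b, l0) = 0" using l0 unfolding sumX by simp
    moreover have "h (a, 1) = 0" "h (a, 2) = 0"
      using test[of "\<lambda>_. axis 1 1"] test[of "\<lambda>_. axis 2 1"] calculation unfolding sumX by (simp_all add: axis_def)
    ultimately have "h c = 0" for c using h0[of c] by (auto simp: X_def)
    then have "\<forall>e\<in>B. y e = 0" using ind unfolding indep_rows_def h_def by blast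
    then show False using y(1) by blast
  qed
qed

lemma indep_rows_subset:
  assumes "finite B" "indep_rows B M" "A \<subseteq> B"
  shows "indep_rows A M"
  unfolding indep_rows_def
proof (intro allI impI)
  fix a assume a: "\<forall>c. (\<Sum>r\<in>A. a r * M r c) = 0"
  have "(\<Sum>r\<in>B. (if r \<in> A then a r else 0) * M r c) = (\<Sum>r\<in>A. a r * M r c)" for c
    using assms(1,3) by (intro sum.mono_neutral_cong_right) auto
  then have "\<forall>r\<in>B. (if r \<in> A then a r else 0) = 0"
    using a assms(2) unfolding indep_rows_def by (elim allE[of _ "\<lambda>r. if r \<in> A then a r else 0"]) simp
  then show "\<forall>r\<in>A. a r = 0" using assms(3) by (metis subsetD)
qed

lemma rigidity_rank_cover_bound:
  assumes "finite E" "\<And>e. e \<in> E \<Longrightarrow> card e = 2" "finite \<B>" "\<And>K. K \<in> \<B> \<Longrightarrow> 2 \<le> card K"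
    and cover: "\<And>e. e \<in> E \<Longrightarrow> \<exists>K\<in>\<B>. e \<subseteq> K"
  shows "matrix_rank E (rigidity_matrix q) \<le> (\<Sum>K\<in>\<B>. 2 * card K - 3)"
proof -
  obtain B where B: "B \<subseteq> E" "card B = matrix_rank E (rigidity_matrix q)" "indep_rows B (rigidity_matrix q)"
    using matrix_rank_basis[OF assms(1), of "rigidity_matrix q"] by metis
  have finB: "finite B" using B(1) assms(1) finite_subset by blast
  have "B = (\<Union>K\<in>\<B>. {e \<in> B. e \<subseteq> K})" using cover B(1) by blast
  then have "card B \<le> (\<Sum>K\<in>\<B>. card {e \<in> B. e \<subseteq> K})" using card_UN_le[OF assms(3)] by metis
  also have "\<dots> \<le> (\<Sum>K\<in>\<B>. 2 * card K - 3)"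
  proof (rule sum_mono)
    fix K assume K: "K \<in> \<B>"
    then have "finite K" using assms(4)[OF K] card.infinite by fastforce
    then show "card {e \<in> B. e \<subseteq> K} \<le> 2 * card K - 3"
      using K assms(2,4) B(1) finB
      by (intro indep_rigidity_rows_card[where q = q] indep_rows_subset[OF finB B(3)]) auto
  qed
  finally show ?thesis using B(2) by simp
qed

lemma finite_edges: "finite_simple_graph G \<Longrightarrow> finite (edges G)"
  by (rule finite_subset[of _ "Pow (verts G)"]) (auto simp: finite_simple_graph_def)

lemma edgeE:
  assumes "finite_simple_graph G" "e \<in> edges G"
  obtains x y where "e = {x, y}" "x \<noteq> y" "x \<in> verts G" "y \<in> verts G"
proof -
  have e: "e \<subseteq> verts G" "card e = 2" using assms by (auto simp: finite_simple_graph_def)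
  from e(2) obtain x y where "e = {x, y}" "x \<noteq> y" unfolding card_2_iff by blast
  then show ?thesis using that e(1) by blast
qed

lemma rigidity_rank_le:
  assumes "finite_simple_graph G" "2 \<le> card (verts G)"
  shows "matrix_rank (edges G) (rigidity_matrix q) \<le> 2 * card (verts G) - 3"
  using rigidity_rank_cover_bound[of "edges G" "{verts G}" q] assms finite_edges[OF assms(1)]
  by (simp add: finite_simple_graph_def)

text \<open>
  Below the maximal rank there are fewer than \<open>2 n\<close> equations even if \<open>a\<close> is pinned, together with one
  coordinate of \<open>b\<close>. The pins exclude the trivial motions, so a nonzero solution is nontrivial.
\<close>

lemma exists_nontrivial_redrawing:
  assumes G: "finite_simple_graph G"
    and small: "matrix_rank (edges G) (rigidity_matrix p) < 2 * card (verts G) - 3"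
    and ab: "a \<in> verts G" "b \<in> verts G" "p a \<noteq> p b"
  obtains z where "\<And>x y. {x, y} \<in> edges G \<Longrightarrow> x \<noteq> y \<Longrightarrow> cross2 (p x - p y) (z x - z y) = 0"
    "\<nexists>\<gamma> \<tau>. \<forall>x\<in>verts G. z x = \<gamma> *\<^sub>R p x + \<tau>"
proof -
  let ?V = "verts G"
  have fV: "finite ?V" using G by (simp add: finite_simple_graph_def)
  have ne: "a \<noteq> b" "p b - p a \<noteq> 0" using ab by auto
  obtain l0 where l0: "perp (p b - p a) $ l0 \<noteq> 0" using perp_coordinate ne by blast
  obtain B where B: "B \<subseteq> edges G" "card B = matrix_rank (edges G) (rigidity_matrix p)"
    and span: "\<And>r. r \<in> edges G \<Longrightarrow> \<exists>f. \<forall>c. rigidity_matrix p r c = (\<Sum>b\<in>B. f b * rigidity_matrix p b c)"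
    using matrix_rank_basis[OF finite_edges[OF G], of "rigidity_matrix p"] by metis
  have finB: "finite B" using B(1) finite_edges[OF G] finite_subset by blast
  define X where "X = {(a, 1), (a, 2), (b, l0)}"
  define u where "u = (\<lambda>c d :: 'a \<times> 2. if d = c then 1 else 0 :: real)"
  have X: "X \<subseteq> ?V \<times> UNIV" using ab by (auto simp: X_def)
  define E where "E = rigidity_matrix p ` B \<union> u ` X"
  have finE: "finite E" using finB by (simp add: E_def X_def)
  have finV: "finite (?V \<times> (UNIV :: 2 set))" using fV by simp
  have "card E \<le> card (rigidity_matrix p ` B) + card (u ` X)" unfolding E_def by (rule card_Un_le)
  also have "\<dots> \<le> card B + card X" using finB by (intro add_mono card_image_le) (auto simp: X_def)
  also have "card X \<le> 3" by (simp add: X_def card_insert_if)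
  also have "card B + 3 < 2 * card ?V" using small B(2) by simp
  finally have "card E < card (?V \<times> (UNIV :: 2 set))" by (simp add: card_cartesian_product)
  then obtain y where y: "\<exists>c\<in>?V \<times> UNIV. y c \<noteq> 0" "\<And>c. c \<notin> ?V \<times> UNIV \<Longrightarrow> y c = 0"
    "\<And>e. e \<in> E \<Longrightarrow> (\<Sum>c\<in>?V \<times> UNIV. e c * y c) = 0"
    by (rule homogeneous_system_nontrivial_solution[OF finE finV]) blast
  define m :: "'a \<Rightarrow> real ^ 2" where "m = (\<lambda>x. \<chi> l. y (x, l))"
  have my: "y c = m (fst c) $ snd c" for c by (simp add: m_def)
  have zero: "m (fst c) $ snd c = 0" if "c \<in> X" for c
  proof -
    have "u c \<in> E" using that by (simp add: E_def)
    then have "(\<Sum>d\<in>?V \<times> UNIV. u c d * y d) = 0" by (rule y(3))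
    moreover have "(\<Sum>d\<in>?V \<times> UNIV. u c d * y d) = y c"
      using X that fV unfolding u_def by (subst sum_delta_mult) auto
    ultimately show ?thesis by (simp add: my)
  qed
  have ma: "m a = 0" using zero[of "(a, 1)"] zero[of "(a, 2)"] by (simp add: X_def vec_eq_2)
  have mb: "m b $ l0 = 0" using zero[of "(b, l0)"] by (simp add: X_def)
  have motion: "(p x - p y) \<bullet> (m x - m y) = 0" if e: "{x, y} \<in> edges G" "x \<noteq> y" for x y
  proof -
    have xy: "x \<in> ?V" "y \<in> ?V" using e G by (auto simp: finite_simple_graph_def)
    obtain f where f: "\<And>c. rigidity_matrix p {x, y} c = (\<Sum>b\<in>B. f b * rigidity_matrix p b c)"
      using span e(1) by blast
    have "(p x - p y) \<bullet> (m x - m y) = (\<Sum>c\<in>?V \<times> UNIV. rigidity_matrix p {x, y} c * m (fst c) $ snd c)"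
      using sum_rigidity_row[OF fV xy e(2)] by simp
    also have "\<dots> = (\<Sum>c\<in>?V \<times> UNIV. (\<Sum>b\<in>B. f b * rigidity_matrix p b c) * m (fst c) $ snd c)"
      by (simp only: f)
    also have "\<dots> = (\<Sum>b\<in>B. f b * (\<Sum>c\<in>?V \<times> UNIV. rigidity_matrix p b c * m (fst c) $ snd c))"
      by (simp add: sum_distrib_left sum_distrib_right sum.swap[of _ "?V \<times> UNIV" B] mult.assoc)
    also have "\<dots> = 0" using y(3) unfolding my E_def by (intro sum.neutral) auto
    finally show ?thesis .
  qed
  show ?thesis
  proof (rule that[of "\<lambda>x. perp (m x)"])
    show "cross2 (p x - p y) (perp (m x) - perp (m y)) = 0" if "{x, y} \<in> edges G" "x \<noteq> y" for x y
      using motion[OF that] by (simp add: cross2_def inner_2 algebra_simps)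
    show "\<nexists>\<gamma> \<tau>. \<forall>x\<in>?V. perp (m x) = \<gamma> *\<^sub>R p x + \<tau>"
    proof
      assume "\<exists>\<gamma> \<tau>. \<forall>x\<in>?V. perp (m x) = \<gamma> *\<^sub>R p x + \<tau>"
      then obtain \<gamma> \<tau> where gt: "\<And>x. x \<in> ?V \<Longrightarrow> perp (m x) = \<gamma> *\<^sub>R p x + \<tau>" by blast
      have "perp (m a) = 0" using ma by (simp add: vec_eq_2)
      then have tau: "\<tau> = - (\<gamma> *\<^sub>R p a)" using gt[OF ab(1)] by (simp add: add_eq_0_iff)
      have "perp (perp (m b)) $ l0 = 0" using mb exhaust_2[of l0] by auto
      moreover have "perp (perp (m b)) $ l0 = \<gamma> * perp (p b - p a) $ l0"
      proof -
        have eq: "perp (m b) = \<gamma> *\<^sub>R (p b - p a)" using gt[OF ab(2)] unfolding tau by (simp add: algebra_simps)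
        show ?thesis unfolding eq using exhaust_2[of l0] by (auto simp: algebra_simps)
      qed
      ultimately have "\<gamma> = 0" using l0 by simp
      then have "perp (m x) = 0" if "x \<in> ?V" for x using gt[OF that] tau by simp
      then have "m x = 0" if "x \<in> ?V" for x using that by (auto simp: vec_eq_2)
      then show False using y(1) unfolding my by auto
    qed
  qed
qed

section \<open>Existence of a rigid coincident realisation\<close>

lemma parallel_imp_scaleR:
  assumes "a \<noteq> 0" "cross2 a b = 0"
  obtains c where "b = c *\<^sub>R a"
proof -
  have *: "a $ 1 * b $ 2 = a $ 2 * b $ 1" using assms(2) by (simp add: cross2_def)
  show ?thesis
  proof (cases "a $ 1 = 0")
    case True
    then have "a $ 2 \<noteq> 0" using assms(1) by (simp add: vec_eq_2)
    then have "b = (b $ 2 / a $ 2) *\<^sub>R a" using True * by (simp add: vec_eq_2)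
    then show ?thesis by (rule that)
  next
    case False
    then have "b = (b $ 1 / a $ 1) *\<^sub>R a" using * by (simp add: vec_eq_2 field_simps)
    then show ?thesis by (rule that)
  qed
qed

text \<open>
  The redrawing \<open>z\<close> of \<open>V\<close> is transported to a graph \<open>H\<close> that arises from identifying vertices with equal
  \<open>p\<close> and \<open>z\<close>: \<open>\<phi>\<close> picks representatives and \<open>\<pi>\<close> names the vertices of \<open>H\<close>. The bodies of \<open>z\<close> on the representatives cover \<open>H\<close>.
  The realisation \<open>q\<close> of \<open>H\<close> is arbitrary and unrelated to \<open>p\<close>.
\<close>

lemma redrawing_obstructs_rigidity:
  fixes V T V' :: "'a set" and \<pi> :: "'a \<Rightarrow> 'b"
  assumes V: "finite V" "finite T" "card T \<le> 3"
    and p: "coincident T p" "general_position V T p" "force_generic V T p"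
    and nontriv: "\<nexists>\<gamma> \<tau>. \<forall>x\<in>V. z x = \<gamma> *\<^sub>R p x + \<tau>"
    and V': "V' \<subseteq> V" "2 \<le> card V'" "inj_on z (T \<inter> V')"
    and \<phi>: "\<And>x. x \<in> V \<Longrightarrow> \<phi> x \<in> V' \<and> p (\<phi> x) = p x \<and> z (\<phi> x) = z x"
    and H: "finite_simple_graph H" "verts H = \<pi> ` V'" "inj_on \<pi> V'"
    and edge: "\<And>e. e \<in> edges H \<Longrightarrow> \<exists>a\<in>V. \<exists>b\<in>V. e = {\<pi> (\<phi> a), \<pi> (\<phi> b)} \<and> p a \<noteq> p b \<and> cross2 (p a - p b) (z a - z b) = 0"
  shows "\<not> infinitesimally_rigid H q"
proof
  assume rig: "infinitesimally_rigid H q"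
  have fV': "finite V'" using V(1) V'(1) finite_subset by blast
  let ?B = "bodies V' p z"
  have sub: "K \<subseteq> V'" if "K \<in> ?B" for K using that by (auto simp: bodies_def)
  have fB: "finite ?B" using sub fV' by (meson PowI finite_Pow_iff finite_subset subsetI)
  have "(\<Sum>K\<in>?B. 2 * card K - 3) \<le> 2 * card V' - 4"
  proof (rule bodies_count[where T = "T \<inter> V'"])
    show "card (T \<inter> V') \<le> 3" using V(2,3) card_mono[of T "T \<inter> V'"] by auto
    show "coincident (T \<inter> V') p" using p(1) unfolding coincident_def by blast
    show "general_position V' (T \<inter> V') p" using p(2) V'(1) unfolding general_position_def by blast
    show "force_generic V' (T \<inter> V') p" unfolding force_generic_def
    proof (intro allI impI ballI, elim conjE)
      fix Inc g z \<gamma> \<tau> x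
      assume "Inc \<subseteq> Pow V' \<times> V'" "balanced Inc p g" "\<forall>(i, x)\<in>Inc. z x = \<gamma> i *\<^sub>R p x + \<tau> i" "x \<in> V' - T \<inter> V'"
      note I = this
      have "Inc \<subseteq> Pow V \<times> V" using I(1) V'(1) by blast
      moreover have "x \<in> V - T" using I(4) V'(1) by blast
      ultimately show "(\<Sum>i\<in>fst ` Inc. \<gamma> i *\<^sub>R g i x) = 0" using force_genericD[OF p(3)] I(2,3) by blast
    qed
    show "\<nexists>\<gamma> \<tau>. \<forall>x\<in>V'. z x = \<gamma> *\<^sub>R p x + \<tau>"
    proof
      assume "\<exists>\<gamma> \<tau>. \<forall>x\<in>V'. z x = \<gamma> *\<^sub>R p x + \<tau>"
      then obtain \<gamma> \<tau> where "\<And>x. x \<in> V' \<Longrightarrow> z x = \<gamma> *\<^sub>R p x + \<tau>" by blast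
      then have "z x = \<gamma> *\<^sub>R p x + \<tau>" if "x \<in> V" for x using \<phi>[OF that] by metis
      then show False using nontriv by blast
    qed
  qed (use fV' V V' in auto)
  moreover have "matrix_rank (edges H) (rigidity_matrix q) \<le> (\<Sum>K\<in>image \<pi> ` ?B. 2 * card K - 3)"
  proof (rule rigidity_rank_cover_bound)
    show "finite (edges H)" using finite_edges[OF H(1)] .
    show "card e = 2" if "e \<in> edges H" for e using H(1) that by (simp add: finite_simple_graph_def)
    show "finite (image \<pi> ` ?B)" using fB by simp
    show "2 \<le> card L" if "L \<in> image \<pi> ` ?B" for L
      using that sub H(3) by (auto simp: bodies_def card_image inj_on_subset)
    show "\<exists>L\<in>image \<pi> ` ?B. e \<subseteq> L" if e: "e \<in> edges H" for e
    proof -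
      obtain a b where ab: "a \<in> V" "b \<in> V" "e = {\<pi> (\<phi> a), \<pi> (\<phi> b)}" "p a \<noteq> p b"
        "cross2 (p a - p b) (z a - z b) = 0" using edge[OF e] by blast
      have ne: "p a - p b \<noteq> 0" using ab(4) by simp
      obtain c where c: "z a - z b = c *\<^sub>R (p a - p b)" using parallel_imp_scaleR[OF ne ab(5)] by blast
      define K where "K = {x \<in> V'. z x = c *\<^sub>R p x + (z a - c *\<^sub>R p a)}"
      have K: "\<phi> a \<in> K" "\<phi> b \<in> K" using \<phi>[OF ab(1)] \<phi>[OF ab(2)] c by (auto simp: K_def algebra_simps)
      have "\<phi> a \<noteq> \<phi> b" using \<phi>[OF ab(1)] \<phi>[OF ab(2)] ab(4) by metis
      moreover have "finite K" using fV' by (simp add: K_def)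
      ultimately have "2 \<le> card K" using K card_mono[of K "{\<phi> a, \<phi> b}"] by auto
      then have "K \<in> ?B" unfolding bodies_def K_def by blast
      then show ?thesis using K ab(3) by blast
    qed
  qed
  moreover have "(\<Sum>K\<in>image \<pi> ` ?B. 2 * card K - 3) = (\<Sum>K\<in>?B. 2 * card K - 3)"
  proof -
    have "inj_on (image \<pi>) ?B" using H(3) sub by (meson inj_on_image_eq_iff inj_onI)
    then have "(\<Sum>K\<in>image \<pi> ` ?B. 2 * card K - 3) = (\<Sum>K\<in>?B. 2 * card (\<pi> ` K) - 3)" by (simp add: sum.reindex)
    also have "\<dots> = (\<Sum>K\<in>?B. 2 * card K - 3)"
      using sub H(3) by (intro sum.cong refl) (simp add: card_image inj_on_subset)
    finally show ?thesis .
  qed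
  moreover have "card (verts H) = card V'" using H by (simp add: card_image)
  ultimately show False using rig V'(2) by (simp add: infinitesimally_rigid_def)
qed

lemma finite_simple_graph_contract:
  "finite_simple_graph G \<Longrightarrow> finite_simple_graph (contract G S)"
  unfolding finite_simple_graph_def contract_def by auto

lemma contract_not_rigid:
  fixes G' :: "'a sgraph"
  assumes G': "finite_simple_graph G'" and T: "finite T" "card T \<le> 3"
    and p: "coincident T p" "general_position (verts G') T p" "force_generic (verts G') T p"
    and edge: "\<And>x y. {x, y} \<in> edges G' \<Longrightarrow> x \<noteq> y \<Longrightarrow> p x \<noteq> p y \<and> cross2 (p x - p y) (z x - z y) = 0"
    and nontriv: "\<nexists>\<gamma> \<tau>. \<forall>x\<in>verts G'. z x = \<gamma> *\<^sub>R p x + \<tau>"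
    and S: "S \<subseteq> T" "S \<subseteq> verts G'" "2 \<le> card S" "r \<in> S" "\<And>x. x \<in> S \<Longrightarrow> z x = z r"
    and inj: "inj_on z (T - (S - {r}))" and x0: "x0 \<in> verts G' - T"
  shows "\<not> infinitesimally_rigid (contract G' S) q"
proof -
  let ?V = "verts G'"
  let ?V' = "?V - (S - {r})"
  let ?\<phi> = "\<lambda>x. if x \<in> S then r else x"
  have fV: "finite ?V" using G' by (simp add: finite_simple_graph_def)
  have S1: "S \<noteq> {x}" for x using S(3) by auto
  have cv: "contract_vertex S (?\<phi> x) = contract_vertex S x" for x
    using S(4) by (simp add: contract_vertex_def)
  show ?thesis
  proof (rule redrawing_obstructs_rigidity[where V' = ?V' and \<phi> = ?\<phi> and \<pi> = "contract_vertex S", OF fV T p nontriv])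
    show "2 \<le> card ?V'"
    proof -
      have "{r, x0} \<subseteq> ?V'" "r \<noteq> x0" using S x0 by auto
      then show ?thesis using fV card_mono[of ?V' "{r, x0}"] by simp
    qed
    show "inj_on z (T \<inter> ?V')" using inj by (rule inj_on_subset) blast
    show "?\<phi> x \<in> ?V' \<and> p (?\<phi> x) = p x \<and> z (?\<phi> x) = z x" if "x \<in> ?V" for x
    proof (cases "x \<in> S")
      case True
      then have "p r = p x" using p(1) S(1,4) unfolding coincident_def by blast
      moreover have "z x = z r" using S(5)[OF True] .
      moreover have "r \<in> ?V'" using S(2,4) by blast
      ultimately show ?thesis using True by (simp only: if_True)
    qed (use that in simp)
    show "finite_simple_graph (contract G' S)" using G' by (rule finite_simple_graph_contract)
    show "verts (contract G' S) = contract_vertex S ` ?V'"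
    proof
      show "verts (contract G' S) \<subseteq> contract_vertex S ` ?V'"
      proof
        fix X assume "X \<in> verts (contract G' S)"
        then obtain x where "x \<in> ?V" "X = contract_vertex S x" by (auto simp: contract_def)
        then show "X \<in> contract_vertex S ` ?V'" using cv[of x] S by (intro image_eqI[of _ _ "?\<phi> x"]) auto
      qed
    qed (auto simp: contract_def)
    show "inj_on (contract_vertex S) ?V'"
    proof (rule inj_onI)
      fix x y assume "x \<in> ?V'" "y \<in> ?V'" "contract_vertex S x = contract_vertex S y"
      then show "x = y" using S1[of x] S1[of y]
        by (cases "x \<in> S"; cases "y \<in> S") (simp_all add: contract_vertex_def)
    qed
    show "\<exists>a\<in>?V. \<exists>b\<in>?V. e = {contract_vertex S (?\<phi> a), contract_vertex S (?\<phi> b)} \<and> p a \<noteq> p b \<and>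
        cross2 (p a - p b) (z a - z b) = 0" if "e \<in> edges (contract G' S)" for e
    proof -
      obtain e0 where e0: "e0 \<in> edges G'" "e = contract_vertex S ` e0" using \<open>e \<in> _\<close> by (auto simp: contract_def)
      then obtain a b where ab: "e0 = {a, b}" "a \<noteq> b" "a \<in> ?V" "b \<in> ?V"
        using edgeE[OF G'] by metis
      have "p a \<noteq> p b \<and> cross2 (p a - p b) (z a - z b) = 0" using edge e0(1) ab by blast
      moreover have "e = {contract_vertex S (?\<phi> a), contract_vertex S (?\<phi> b)}" unfolding cv using e0(2) ab(1) by simp
      ultimately show ?thesis using ab by blast
    qed
  qed auto
qed

lemma matrix_rank_empty: "matrix_rank {} M = 0"
  using matrix_rank_le[of "{}" "{}" M M] by simp

lemma card_edges_if_small: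
  assumes "finite_simple_graph G" "card (verts G) < 2"
  shows "edges G = {}"
proof (rule ccontr)
  assume "edges G \<noteq> {}"
  then obtain e where "e \<subseteq> verts G" "card e = 2" using assms(1) by (auto simp: finite_simple_graph_def)
  then show False using assms card_mono[of "verts G" e] by (simp add: finite_simple_graph_def)
qed

theorem coincident_rigid_if_contractions_rigid:
  fixes G G' :: "'a sgraph" and u v w :: 'a
  assumes G: "finite_simple_graph G"
    and uvw: "u \<in> verts G" "v \<in> verts G" "w \<in> verts G" "u \<noteq> v" "u \<noteq> w" "v \<noteq> w"
    and G'_def: "G' = delete_edge (delete_edge (delete_edge G u v) u w) v w"
    and rigid: "infinitesimally_rigid G' q"
    and contr: "\<And>S. S \<subseteq> {u, v, w} \<Longrightarrow> 2 \<le> card S \<Longrightarrow> \<exists>q. infinitesimally_rigid (contract G' S) q"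
  shows "\<exists>p. coincident {u, v, w} p \<and> infinitesimally_rigid G p"
proof -
  let ?V = "verts G" and ?T = "{u, v, w}"
  have V': "verts G' = ?V" and E': "edges G' = edges G - {{u, v}, {u, w}, {v, w}}"
    by (auto simp: G'_def delete_edge_def)
  have G': "finite_simple_graph G'" using G by (auto simp: finite_simple_graph_def V' E')
  have fV: "finite ?V" using G by (simp add: finite_simple_graph_def)
  have cT: "card ?T = 3" using uvw by simp
  have "?T \<subseteq> ?V" using uvw by simp
  then have c3: "3 \<le> card ?V" using cT fV card_mono by metis
  have not_in_T: "\<not> (x \<in> ?T \<and> y \<in> ?T)" if "{x, y} \<in> edges G'" "x \<noteq> y" for x y
    using that unfolding E' by (auto simp: insert_commute)
  obtain x0 where x0: "x0 \<in> ?V - ?T"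
  proof -
    have "edges G' \<noteq> {}"
      using rigid c3 unfolding infinitesimally_rigid_def V' by (auto simp: matrix_rank_empty)
    then obtain e where "e \<in> edges G'" by blast
    then obtain x y where "e = {x, y}" "x \<noteq> y" "x \<in> ?V" "y \<in> ?V"
      using edgeE[OF G'] V' by metis
    then show ?thesis using not_in_T[of x y] \<open>e \<in> edges G'\<close> that by blast
  qed
  obtain p where p: "coincident ?T p" "general_position ?V ?T p" "force_generic ?V ?T p"
    using exists_generic_coincident[OF fV] by blast
  have "infinitesimally_rigid G p"
  proof (rule ccontr)
    assume not: "\<not> infinitesimally_rigid G p"
    have "matrix_rank (edges G) (rigidity_matrix p) \<le> 2 * card ?V - 3"
      using rigidity_rank_le[OF G] c3 by simp
    then have small: "matrix_rank (edges G) (rigidity_matrix p) < 2 * card ?V - 3"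
      using not c3 unfolding infinitesimally_rigid_def by auto
    have "p x0 \<noteq> p u" using p(2) x0 uvw unfolding general_position_def by blast
    then obtain z where z: "\<And>x y. {x, y} \<in> edges G \<Longrightarrow> x \<noteq> y \<Longrightarrow> cross2 (p x - p y) (z x - z y) = 0"
      and nontriv: "\<nexists>\<gamma> \<tau>. \<forall>x\<in>?V. z x = \<gamma> *\<^sub>R p x + \<tau>"
      using exists_nontrivial_redrawing[OF G small, of x0 u] x0 uvw by blast
    have edge: "p x \<noteq> p y \<and> cross2 (p x - p y) (z x - z y) = 0" if "{x, y} \<in> edges G'" "x \<noteq> y" for x y
    proof -
      have "x \<in> ?V" "y \<in> ?V" using that G' V' by (auto simp: finite_simple_graph_def)
      moreover have "x \<notin> ?T \<or> y \<notin> ?T" using not_in_T that by blast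
      ultimately have "p x \<noteq> p y" using p(2) that(2) unfolding general_position_def by (metis DiffI)
      then show ?thesis using z that E' by blast
    qed
    have contr': False if "S \<subseteq> ?T" "2 \<le> card S" "r \<in> S" "\<And>x. x \<in> S \<Longrightarrow> z x = z r"
      "inj_on z (?T - (S - {r}))" for S r
    proof -
      obtain q' where q': "infinitesimally_rigid (contract G' S) q'" using contr \<open>S \<subseteq> ?T\<close> \<open>2 \<le> card S\<close> by blast
      have "\<not> infinitesimally_rigid (contract G' S) q'"
      proof (rule contract_not_rigid[OF G' _ _ p(1), where z = z and r = r and ?x0.0 = x0])
        show "finite ?T" "card ?T \<le> 3" using cT by simp_all
        show "general_position (verts G') ?T p" "force_generic (verts G') ?T p" "x0 \<in> verts G' - ?T"
          using p(2,3) x0 by (simp_all only: V')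
        show "\<nexists>\<gamma> \<tau>. \<forall>x\<in>verts G'. z x = \<gamma> *\<^sub>R p x + \<tau>" unfolding V' by (rule nontriv)
        show "S \<subseteq> verts G'" using that(1) \<open>?T \<subseteq> ?V\<close> V' by blast
      qed (fact edge that)+
      then show False using q' by blast
    qed
    have whole: False if "inj_on z ?T"
    proof -
      have "\<not> infinitesimally_rigid G' q"
      proof (rule redrawing_obstructs_rigidity[where V = ?V and T = ?T and V' = ?V and \<phi> = "\<lambda>x. x" and \<pi> = "\<lambda>x. x" and p = p and z = z])
        show "\<exists>a\<in>?V. \<exists>b\<in>?V. e = {a, b} \<and> p a \<noteq> p b \<and> cross2 (p a - p b) (z a - z b) = 0" if "e \<in> edges G'" for e
        proof -
          obtain x y where "e = {x, y}" "x \<noteq> y" "x \<in> ?V" "y \<in> ?V"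
            using edgeE[OF G' \<open>e \<in> edges G'\<close>] V' by metis
          then show ?thesis using edge that by blast
        qed
        show "inj_on z (?T \<inter> ?V)" using that by (rule inj_on_subset) blast
      qed (use fV p nontriv c3 G' V' cT in auto)
      then show False using rigid by blast
    qed
    \<comment> \<open>A level set with exactly two elements contradicts the rigidity of the corresponding contraction.\<close>
    have pair: False if abc: "?T = {a, b, c}" "a \<noteq> b" "a \<noteq> c" "b \<noteq> c" and z_eq: "z a = z b" "z a \<noteq> z c" for a b c
    proof (rule contr'[of "{a, b}" a])
      show "{a, b} \<subseteq> ?T" unfolding abc(1) by blast
      show "2 \<le> card {a, b}" "a \<in> {a, b}" using abc(2) by simp_all
      show "z x = z a" if "x \<in> {a, b}" for x using that z_eq(1) by (elim insertE) auto
      have eq: "?T - ({a, b} - {a}) = {a, c}" unfolding abc(1) using abc(2-4) by blast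
      show "inj_on z (?T - ({a, b} - {a}))" unfolding eq using z_eq(2) by (auto simp: inj_on_def)
    qed
    have T_perm: "?T = {u, w, v}" "?T = {v, w, u}" by blast+
    consider "z u = z v" "z u = z w" | "z u = z v" "z u \<noteq> z w" | "z u = z w" "z u \<noteq> z v"
      | "z v = z w" "z v \<noteq> z u" | "z u \<noteq> z v" "z u \<noteq> z w" "z v \<noteq> z w" by metis
    then show False
    proof cases
      case 1
      have "?T - (?T - {u}) = {u}" by blast
      then have inj: "inj_on z (?T - (?T - {u}))" by simp
      show False
      proof (rule contr'[OF order_refl _ _ _ inj])
        show "z x = z u" if "x \<in> ?T" for x using that 1 by (elim insertE) auto
      qed (use cT in auto)
    next
      case 2
      then show False using pair[of u v w] uvw by blast
    next
      case 3
      then show False using pair[OF T_perm(1)] uvw by blast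
    next
      case 4
      then show False using pair[OF T_perm(2)] uvw by metis
    next
      case 5
      then have "inj_on z ?T" by (auto simp: inj_on_def)
      then show False by (rule whole)
    qed
  qed
  then show ?thesis using p(1) by blast
qed

section \<open>Density of algebraically independent families\<close>

text \<open>
  Used twice: for monomials in finitely many variables, and for polynomials in these monomials.
\<close>

lemma countable_poly_mapping:
  fixes A :: "'k set"
  assumes "countable A"
  shows "countable {f :: 'k \<Rightarrow>\<^sub>0 'v :: {zero, countable}. Poly_Mapping.keys f \<subseteq> A}" (is "countable ?F")
proof -
  define graph :: "('k \<Rightarrow>\<^sub>0 'v) \<Rightarrow> ('k \<times> 'v) set" where
    "graph f = (\<lambda>k. (k, Poly_Mapping.lookup f k)) ` Poly_Mapping.keys f" for f
  have "graph ` ?F \<subseteq> {X. finite X \<and> X \<subseteq> A \<times> UNIV}" by (auto simp: graph_def)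
  moreover have "countable {X. finite X \<and> X \<subseteq> A \<times> (UNIV :: 'v set)}"
    using assms by (intro countable_Collect_finite_subset) auto
  ultimately have "countable (graph ` ?F)" by (rule countable_subset)
  moreover have "inj_on graph ?F"
  proof (rule inj_onI)
    fix f h :: "'k \<Rightarrow>\<^sub>0 'v" assume eq: "graph f = graph h"
    have mem: "(k, v) \<in> graph f \<longleftrightarrow> v \<noteq> 0 \<and> Poly_Mapping.lookup f k = v" for f k v
      by (auto simp: graph_def Poly_Mapping.in_keys_iff)
    have "Poly_Mapping.lookup f k = Poly_Mapping.lookup h k" for k
      using mem[of k _ f] mem[of k _ h] eq by metis
    then show "f = h" by (simp add: poly_mapping_eqI)
  qed
  ultimately show ?thesis by (rule countable_image_inj_on)
qed

text \<open>
  The coefficient of the \<open>k\<close>-th power of the variable \<open>j\<close> in \<open>f\<close>, as a polynomial in the other variables.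
\<close>

definition coeff_at :: "'i \<Rightarrow> nat \<Rightarrow> (('i \<Rightarrow>\<^sub>0 nat) \<Rightarrow>\<^sub>0 rat) \<Rightarrow> ('i \<Rightarrow>\<^sub>0 nat) \<Rightarrow>\<^sub>0 rat" where
  "coeff_at j k f = Abs_poly_mapping (\<lambda>n. if j \<in> Poly_Mapping.keys n then 0
     else Poly_Mapping.lookup f (Poly_Mapping.update j k n))"

lemma update_cancel:
  "j \<notin> Poly_Mapping.keys n \<Longrightarrow> Poly_Mapping.update j 0 (Poly_Mapping.update j k n) = n"
  "Poly_Mapping.update j (Poly_Mapping.lookup m j) (Poly_Mapping.update j 0 m) = m"
  by (auto intro!: poly_mapping_eqI simp: Poly_Mapping.lookup_update Poly_Mapping.in_keys_iff)

lemma lookup_coeff_at: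
  "Poly_Mapping.lookup (coeff_at j k f) n = (if j \<in> Poly_Mapping.keys n then 0
     else Poly_Mapping.lookup f (Poly_Mapping.update j k n))"
proof -
  let ?g = "\<lambda>n. if j \<in> Poly_Mapping.keys n then 0 else Poly_Mapping.lookup f (Poly_Mapping.update j k n)"
  have "{n. ?g n \<noteq> 0} \<subseteq> Poly_Mapping.update j 0 ` Poly_Mapping.keys f"
  proof
    fix n assume "n \<in> {n. ?g n \<noteq> 0}"
    then have n: "j \<notin> Poly_Mapping.keys n" "Poly_Mapping.update j k n \<in> Poly_Mapping.keys f"
      by (auto simp: Poly_Mapping.in_keys_iff split: if_splits)
    have "n = Poly_Mapping.update j 0 (Poly_Mapping.update j k n)" using update_cancel(1)[OF n(1)] by simp
    with n(2) show "n \<in> Poly_Mapping.update j 0 ` Poly_Mapping.keys f" by blast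
  qed
  then have "finite {n. ?g n \<noteq> 0}" by (rule finite_subset) simp
  then show ?thesis by (simp add: coeff_at_def)
qed

lemma keys_coeff_at:
  "Poly_Mapping.keys (coeff_at j k f) = Poly_Mapping.update j 0 ` {m \<in> Poly_Mapping.keys f. Poly_Mapping.lookup m j = k}"
proof (intro equalityI subsetI)
  fix n assume "n \<in> Poly_Mapping.keys (coeff_at j k f)"
  then have n: "j \<notin> Poly_Mapping.keys n" "Poly_Mapping.update j k n \<in> Poly_Mapping.keys f"
    by (auto simp: Poly_Mapping.in_keys_iff lookup_coeff_at split: if_splits)
  show "n \<in> Poly_Mapping.update j 0 ` {m \<in> Poly_Mapping.keys f. Poly_Mapping.lookup m j = k}"
    by (rule image_eqI[of _ _ "Poly_Mapping.update j k n"])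
      (use n update_cancel(1)[OF n(1)] in \<open>auto simp: Poly_Mapping.lookup_update\<close>)
next
  fix n assume "n \<in> Poly_Mapping.update j 0 ` {m \<in> Poly_Mapping.keys f. Poly_Mapping.lookup m j = k}"
  then obtain m where m: "n = Poly_Mapping.update j 0 m" "m \<in> Poly_Mapping.keys f" "Poly_Mapping.lookup m j = k" by blast
  then have "Poly_Mapping.lookup (coeff_at j k f) n = Poly_Mapping.lookup f m"
    using update_cancel(2)[of j m] by (simp add: lookup_coeff_at Poly_Mapping.keys_update)
  then show "n \<in> Poly_Mapping.keys (coeff_at j k f)" using m(2) by (simp add: Poly_Mapping.in_keys_iff)
qed

lemma poly_eval_coeff_at:
  "poly_eval x (coeff_at j k f) = (\<Sum>m | m \<in> Poly_Mapping.keys f \<and> Poly_Mapping.lookup m j = k.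
     of_rat (Poly_Mapping.lookup f m) * (\<Prod>i\<in>Poly_Mapping.keys m - {j}. x i ^ Poly_Mapping.lookup m i))"
proof -
  let ?M = "{m \<in> Poly_Mapping.keys f. Poly_Mapping.lookup m j = k}"
  have inj: "inj_on (Poly_Mapping.update j 0) ?M"
    by (rule inj_onI) (metis (mono_tags, lifting) mem_Collect_eq update_cancel(2))
  show ?thesis unfolding poly_eval_def keys_coeff_at sum.reindex[OF inj] o_def
  proof (intro sum.cong refl)
    fix m assume m: "m \<in> ?M"
    have "(\<Prod>i\<in>Poly_Mapping.keys m - {j}. x i ^ Poly_Mapping.lookup (Poly_Mapping.update j 0 m) i) =
        (\<Prod>i\<in>Poly_Mapping.keys m - {j}. x i ^ Poly_Mapping.lookup m i)"
      by (intro prod.cong) (auto simp: Poly_Mapping.lookup_update)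
    then show "of_rat (Poly_Mapping.lookup (coeff_at j k f) (Poly_Mapping.update j 0 m)) *
        (\<Prod>i\<in>Poly_Mapping.keys (Poly_Mapping.update j 0 m). x i ^ Poly_Mapping.lookup (Poly_Mapping.update j 0 m) i) =
        of_rat (Poly_Mapping.lookup f m) * (\<Prod>i\<in>Poly_Mapping.keys m - {j}. x i ^ Poly_Mapping.lookup m i)"
      using m update_cancel(2)[of j m] by (simp add: lookup_coeff_at Poly_Mapping.keys_update)
  qed
qed

lemma poly_eval_update:
  assumes "\<And>m. m \<in> Poly_Mapping.keys f \<Longrightarrow> Poly_Mapping.lookup m j \<le> N"
  shows "poly_eval (x(j := t)) f = (\<Sum>k\<le>N. poly_eval x (coeff_at j k f) * t ^ k)"
proof -
  let ?r = "\<lambda>m. of_rat (Poly_Mapping.lookup f m) * (\<Prod>i\<in>Poly_Mapping.keys m - {j}. x i ^ Poly_Mapping.lookup m i)"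
  have "poly_eval (x(j := t)) f = (\<Sum>m\<in>Poly_Mapping.keys f. ?r m * t ^ Poly_Mapping.lookup m j)"
    unfolding poly_eval_def
  proof (intro sum.cong refl)
    fix m
    have "(\<Prod>i\<in>Poly_Mapping.keys m. (x(j := t)) i ^ Poly_Mapping.lookup m i) =
        (\<Prod>i\<in>Poly_Mapping.keys m - {j}. (x(j := t)) i ^ Poly_Mapping.lookup m i) * t ^ Poly_Mapping.lookup m j"
      by (cases "j \<in> Poly_Mapping.keys m")
        (auto simp: prod.remove[of "Poly_Mapping.keys m" j] Poly_Mapping.in_keys_iff mult.commute)
    also have "(\<Prod>i\<in>Poly_Mapping.keys m - {j}. (x(j := t)) i ^ Poly_Mapping.lookup m i) =
        (\<Prod>i\<in>Poly_Mapping.keys m - {j}. x i ^ Poly_Mapping.lookup m i)"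
      by (intro prod.cong) auto
    finally show "of_rat (Poly_Mapping.lookup f m) * (\<Prod>i\<in>Poly_Mapping.keys m. (x(j := t)) i ^ Poly_Mapping.lookup m i) =
        ?r m * t ^ Poly_Mapping.lookup m j" by (simp add: mult.assoc)
  qed
  also have "\<dots> = (\<Sum>k\<le>N. \<Sum>m | m \<in> Poly_Mapping.keys f \<and> Poly_Mapping.lookup m j = k. ?r m * t ^ Poly_Mapping.lookup m j)"
    using assms by (intro sum.group[symmetric]) auto
  also have "\<dots> = (\<Sum>k\<le>N. poly_eval x (coeff_at j k f) * t ^ k)"
    unfolding poly_eval_coeff_at sum_distrib_right by (intro sum.cong refl) auto
  finally show ?thesis .
qed

lemma finite_roots_new_coordinate:
  assumes ind: "algebraically_independent_over_rat I x"
    and f: "f \<noteq> 0" "\<And>m. m \<in> Poly_Mapping.keys f \<Longrightarrow> Poly_Mapping.keys m \<subseteq> insert j I"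
  shows "finite {t. poly_eval (x(j := t)) f = 0}"
proof -
  define N where "N = Max ((\<lambda>m. Poly_Mapping.lookup m j) ` Poly_Mapping.keys f)"
  have N: "Poly_Mapping.lookup m j \<le> N" if "m \<in> Poly_Mapping.keys f" for m
    unfolding N_def using that by (intro Max_ge) auto
  obtain m0 where m0: "m0 \<in> Poly_Mapping.keys f" using f(1) by fastforce
  let ?k = "Poly_Mapping.lookup m0 j"
  have "Poly_Mapping.update j 0 m0 \<in> Poly_Mapping.keys (coeff_at j ?k f)" using m0 by (auto simp: keys_coeff_at)
  then have "coeff_at j ?k f \<noteq> 0" by auto
  moreover have "\<forall>n\<in>Poly_Mapping.keys (coeff_at j ?k f). Poly_Mapping.keys n \<subseteq> I"
    using f(2) by (fastforce simp: keys_coeff_at Poly_Mapping.keys_update)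
  ultimately have "poly_eval x (coeff_at j ?k f) \<noteq> 0"
    using ind unfolding algebraically_independent_over_rat_def by blast
  then have "finite {t. (\<Sum>k\<le>N. poly_eval x (coeff_at j k f) * t ^ k) = 0}"
    using N[OF m0] polyfun_finite_roots[of "\<lambda>k. poly_eval x (coeff_at j k f)" N] by blast
  then show ?thesis using poly_eval_update[of f j N x] N by simp
qed

text \<open>
  The coordinates are chosen one after the other. Each of the countably many polynomials excludes only finitely many
  values of the next coordinate, and an interval is uncountable.
\<close>

lemma exists_algebraically_independent_near:
  fixes x0 :: "'i \<Rightarrow> real"
  assumes "finite I" "0 < \<delta>"
  shows "\<exists>x. algebraically_independent_over_rat I x \<and> (\<forall>i\<in>I. \<bar>x i - x0 i\<bar> < \<delta>)"
  using assms(1)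
proof (induction I)
  case empty
  have "f = 0" if f: "\<forall>m\<in>Poly_Mapping.keys f. Poly_Mapping.keys m \<subseteq> {}" "poly_eval x0 f = 0"
    for f :: "('i \<Rightarrow>\<^sub>0 nat) \<Rightarrow>\<^sub>0 rat"
  proof (rule ccontr)
    assume "f \<noteq> 0"
    moreover have "Poly_Mapping.keys f \<subseteq> {0}" using f(1) by auto
    ultimately have k: "Poly_Mapping.keys f = {0}" using Poly_Mapping.keys_eq_empty[of f] by blast
    then have "Poly_Mapping.lookup f 0 \<noteq> 0" by (metis Poly_Mapping.in_keys_iff insertI1)
    then show False using f(2) k by (simp add: poly_eval_def)
  qed
  then have "algebraically_independent_over_rat {} x0" unfolding algebraically_independent_over_rat_def by blast
  then show ?case by blast
next
  case (insert j I)
  then obtain x where x: "algebraically_independent_over_rat I x" "\<forall>i\<in>I. \<bar>x i - x0 i\<bar> < \<delta>" by blast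
  define M where "M = {m :: 'i \<Rightarrow>\<^sub>0 nat. Poly_Mapping.keys m \<subseteq> insert j I}"
  define F where "F = {f :: ('i \<Rightarrow>\<^sub>0 nat) \<Rightarrow>\<^sub>0 rat. Poly_Mapping.keys f \<subseteq> M}"
  have "countable M" unfolding M_def using insert.hyps by (intro countable_poly_mapping) (simp add: countable_finite)
  then have cF: "countable F" unfolding F_def by (rule countable_poly_mapping)
  define bad where "bad = (\<Union>f\<in>F - {0}. {t. poly_eval (x(j := t)) f = 0})"
  have "countable bad" unfolding bad_def
  proof (intro countable_UN)
    show "countable (F - {0})" using cF by simp
    fix f assume "f \<in> F - {0}"
    then show "countable {t. poly_eval (x(j := t)) f = 0}"
      by (intro countable_finite finite_roots_new_coordinate[OF x(1)]) (auto simp: F_def M_def)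
  qed
  moreover have "uncountable {x0 j - \<delta><..<x0 j + \<delta>}" using assms(2) by (simp add: uncountable_open_interval)
  ultimately have "\<not> {x0 j - \<delta><..<x0 j + \<delta>} \<subseteq> bad" using countable_subset by blast
  then obtain t where t: "t \<in> {x0 j - \<delta><..<x0 j + \<delta>}" "t \<notin> bad" by blast
  have "algebraically_independent_over_rat (insert j I) (x(j := t))"
    unfolding algebraically_independent_over_rat_def
  proof (intro allI impI, rule ccontr)
    fix f :: "('i \<Rightarrow>\<^sub>0 nat) \<Rightarrow>\<^sub>0 rat"
    assume "\<forall>m\<in>Poly_Mapping.keys f. Poly_Mapping.keys m \<subseteq> insert j I" "poly_eval (x(j := t)) f = 0" "f \<noteq> 0"
    then have "t \<in> bad" unfolding bad_def F_def M_def by blast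
    then show False using t(2) by blast
  qed
  moreover have "\<forall>i\<in>insert j I. \<bar>(x(j := t)) i - x0 i\<bar> < \<delta>" using x(2) t(1) by (auto simp: abs_less_iff)
  ultimately show ?case by blast
qed

section \<open>Necessity\<close>

text \<open>
  The rank of an infinitesimally rigid realisation is the largest possible one, so by semicontinuity it is attained
  at every generic realisation nearby.
\<close>

lemma rigid_if_infinitesimally_rigid:
  assumes G: "finite_simple_graph G" and p: "infinitesimally_rigid G p"
  shows "rigid G"
proof -
  let ?C = "verts G \<times> (UNIV :: 2 set)"
  have fC: "finite ?C" using G by (simp add: finite_simple_graph_def)
  have outside: "rigidity_matrix p e c = 0" if "e \<in> edges G" "c \<notin> ?C" for e c
    using that G by (cases c) (auto simp: finite_simple_graph_def intro!: rigidity_matrix_outside)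
  obtain \<delta> where d: "\<delta> > 0" "\<And>M'. (\<And>e c. e \<in> edges G \<Longrightarrow> c \<in> ?C \<Longrightarrow> \<bar>M' e c - rigidity_matrix p e c\<bar> \<le> \<delta>) \<Longrightarrow>
      matrix_rank (edges G) (rigidity_matrix p) \<le> matrix_rank (edges G) M'"
    using matrix_rank_lower_semicontinuous[OF finite_edges[OF G] fC, of "rigidity_matrix p"] outside by metis
  obtain x where x: "algebraically_independent_over_rat ?C x"
    "\<forall>i\<in>?C. \<bar>x i - p (fst i) $ snd i\<bar> < \<delta> / 2"
    using exists_algebraically_independent_near[OF fC, of "\<delta> / 2" "\<lambda>i. p (fst i) $ snd i"] d(1) by auto
  define q :: "'a \<Rightarrow> real ^ 2" where "q = (\<lambda>v. \<chi> i. x (v, i))"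
  have "(\<lambda>(v, i). q v $ i) = x" by (auto simp: q_def)
  then have gen: "generic G q" using x(1) by (simp add: generic_def)
  have near: "\<bar>q v $ i - p v $ i\<bar> < \<delta> / 2" if "v \<in> verts G" for v i
    using x(2) that by (auto simp: q_def)
  have le: "matrix_rank (edges G) (rigidity_matrix p) \<le> matrix_rank (edges G) (rigidity_matrix q)"
  proof (rule d(2))
    fix e c assume e: "e \<in> edges G" and c: "c \<in> ?C"
    obtain v i where vi: "c = (v, i)" by (cases c)
    obtain a b where ab: "e = {a, b}" "a \<noteq> b" "a \<in> verts G" "b \<in> verts G" using edgeE[OF G e] by metis
    have "\<bar>q a $ i - p a $ i\<bar> < \<delta> / 2" "\<bar>q b $ i - p b $ i\<bar> < \<delta> / 2" using near ab by auto
    then show "\<bar>rigidity_matrix q e c - rigidity_matrix p e c\<bar> \<le> \<delta>"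
      unfolding vi ab(1) rigidity_matrix_edge[OF ab(2)] vector_minus_component using d(1)
      by (simp split: if_split, intro conjI impI; linarith)
  qed
  have "infinitesimally_rigid G q"
  proof (cases "2 \<le> card (verts G)")
    case True
    then show ?thesis using le p rigidity_rank_le[OF G True, of q] unfolding infinitesimally_rigid_def by simp
  next
    case False
    then have "edges G = {}" using card_edges_if_small[OF G] by simp
    then show ?thesis using False by (simp add: infinitesimally_rigid_def matrix_rank_empty)
  qed
  then show ?thesis using gen unfolding rigid_def by blast
qed

lemma contract_row:
  assumes ab: "a \<noteq> b" "\<not> (a \<in> S \<and> b \<in> S)" and S: "r \<in> S" "2 \<le> card S"
    and q: "\<And>x. x \<in> {a, b} \<Longrightarrow> q (contract_vertex S x) = p x"
  shows "x \<notin> S \<Longrightarrow> rigidity_matrix q (contract_vertex S ` {a, b}) (contract_vertex S x, l) = rigidity_matrix p {a, b} (x, l)"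
    and "rigidity_matrix q (contract_vertex S ` {a, b}) (contract_vertex S r, l) = (\<Sum>s\<in>S. rigidity_matrix p {a, b} (s, l))"
proof -
  have fS: "finite S" using S(2) card.infinite by fastforce
  have S1: "S \<noteq> {x}" "{x} \<noteq> S" for x using S(2) by auto
  have ne: "contract_vertex S a \<noteq> contract_vertex S b" using ab S1[of a] S1[of b] by (auto simp: contract_vertex_def)
  have row: "rigidity_matrix q (contract_vertex S ` {a, b}) (X, l) =
     (if X = contract_vertex S a then (p a - p b) $ l else if X = contract_vertex S b then (p b - p a) $ l else 0)" for X
    using rigidity_matrix_edge[OF ne, of q X l] q by simp
  show "rigidity_matrix q (contract_vertex S ` {a, b}) (contract_vertex S x, l) = rigidity_matrix p {a, b} (x, l)" if "x \<notin> S"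
  proof -
    have "contract_vertex S x = contract_vertex S y \<longleftrightarrow> x = y" for y
      using that S1[of x] by (auto simp: contract_vertex_def)
    then show ?thesis unfolding row rigidity_matrix_edge[OF ab(1)] by simp
  qed
  have r: "contract_vertex S r = contract_vertex S y \<longleftrightarrow> y \<in> S" for y
    using S(1) S1[of y] by (auto simp: contract_vertex_def)
  have "(\<Sum>s\<in>S. rigidity_matrix p {a, b} (s, l)) = (\<Sum>s\<in>S. (if s = a then (p a - p b) $ l else 0) + (if s = b then (p b - p a) $ l else 0))"
    unfolding rigidity_matrix_edge[OF ab(1)] using ab(1) by (intro sum.cong) auto
  also have "\<dots> = (if a \<in> S then (p a - p b) $ l else 0) + (if b \<in> S then (p b - p a) $ l else 0)"
    using fS by (simp add: sum.distrib)
  also have "\<dots> = rigidity_matrix q (contract_vertex S ` {a, b}) (contract_vertex S r, l)"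
    unfolding row r using ab(2) by auto
  finally show "rigidity_matrix q (contract_vertex S ` {a, b}) (contract_vertex S r, l) = (\<Sum>s\<in>S. rigidity_matrix p {a, b} (s, l))" ..
qed

text \<open>
  The rows of \<open>G\<close> are spanned by lifts of a row basis of \<open>G/S\<close> and by the \<open>2 (|S| - 1)\<close> vectors that move an entry
  between the representative \<open>r\<close> and another vertex of \<open>S\<close>. The lift puts the column of the contracted vertex at
  \<open>r\<close>.
\<close>

lemma rank_le_contract_rank:
  fixes G :: "'a sgraph"
  assumes G: "finite_simple_graph G" and S: "S \<subseteq> verts G" "2 \<le> card S"
    and p: "coincident S p" and noloop: "\<And>a b. {a, b} \<in> edges G \<Longrightarrow> a \<noteq> b \<Longrightarrow> \<not> (a \<in> S \<and> b \<in> S)"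
  obtains q where "matrix_rank (edges G) (rigidity_matrix p) \<le>
      matrix_rank (edges (contract G S)) (rigidity_matrix q) + 2 * (card S - 1)"
proof -
  have fS: "finite S" using S(2) card.infinite by fastforce
  obtain r where r: "r \<in> S" using S(2) by fastforce
  have S1: "S \<noteq> {x}" "{x} \<noteq> S" for x using S(2) by auto
  define q :: "'a set \<Rightarrow> real ^ 2" where "q X = p (if X = S then r else the_elem X)" for X
  have q: "q (contract_vertex S x) = p x" for x
  proof (cases "x \<in> S")
    case True
    then have "p r = p x" using p r unfolding coincident_def by blast
    then show ?thesis using True by (simp add: q_def contract_vertex_def)
  qed (use S1(2)[of x] in \<open>simp add: q_def contract_vertex_def\<close>)
  let ?H = "contract G S"
  have H: "finite_simple_graph ?H" by (rule finite_simple_graph_contract[OF G])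
  obtain D where D: "D \<subseteq> edges ?H" "card D = matrix_rank (edges ?H) (rigidity_matrix q)"
    and span: "\<And>e. e \<in> edges ?H \<Longrightarrow> \<exists>f. \<forall>c. rigidity_matrix q e c = (\<Sum>d\<in>D. f d * rigidity_matrix q d c)"
    using matrix_rank_basis[OF finite_edges[OF H], of "rigidity_matrix q"] by metis
  have fD: "finite D" using D(1) finite_edges[OF H] finite_subset by blast
  define N :: "'a set set + 'a \<times> 2 \<Rightarrow> 'a \<times> 2 \<Rightarrow> real" where
    "N = (\<lambda>i c. case i of
        Inl d \<Rightarrow> if fst c \<in> S \<and> fst c \<noteq> r then 0 else rigidity_matrix q d (contract_vertex S (fst c), snd c)
      | Inr s \<Rightarrow> (if c = s then 1 else 0) - (if c = (r, snd s) then 1 else 0))"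
  let ?S' = "(S - {r}) \<times> (UNIV :: 2 set)"
  let ?I = "D <+> ?S'"
  have fI: "finite ?I" using fD fS by simp
  have "matrix_rank (edges G) (rigidity_matrix p) \<le> card ?I"
  proof (rule matrix_rank_le[OF fI])
    fix e assume e: "e \<in> edges G"
    then obtain a b where ab: "e = {a, b}" "a \<noteq> b" using edgeE[OF G e] by metis
    then have nl: "\<not> (a \<in> S \<and> b \<in> S)" using noloop e by blast
    note row = contract_row[OF ab(2) nl r S(2), of q p, OF q]
    have "contract_vertex S a \<noteq> contract_vertex S b" using ab(2) nl S1[of a] S1[of b] by (auto simp: contract_vertex_def)
    then have "card (contract_vertex S ` e) = 2" by (simp add: ab(1))
    then have "contract_vertex S ` e \<in> edges ?H" using e by (auto simp: contract_def)
    then obtain f where f: "\<And>c. rigidity_matrix q (contract_vertex S ` e) c = (\<Sum>d\<in>D. f d * rigidity_matrix q d c)"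
      using span by blast
    define h where "h = (\<lambda>i. case i of Inl d \<Rightarrow> f d | Inr s \<Rightarrow> rigidity_matrix p e s)"
    have "rigidity_matrix p e (x, l) = (\<Sum>i\<in>?I. h i * N i (x, l))" for x l
    proof -
      let ?R = "\<Sum>s\<in>?S'. rigidity_matrix p e s * ((if (x, l) = s then 1 else 0) - (if (x, l) = (r, snd s) then 1 else 0))"
      have NInl: "N (Inl d) (x, l) = (if x \<in> S \<and> x \<noteq> r then 0 else rigidity_matrix q d (contract_vertex S x, l))" for d
        by (simp add: N_def)
      have "(\<Sum>i\<in>?I. h i * N i (x, l)) = (\<Sum>d\<in>D. f d * N (Inl d) (x, l)) + ?R"
        using fD fS by (simp add: sum.Plus h_def N_def)
      also have "(\<Sum>d\<in>D. f d * N (Inl d) (x, l)) =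
          (if x \<in> S \<and> x \<noteq> r then 0 else rigidity_matrix q (contract_vertex S ` e) (contract_vertex S x, l))"
      proof (cases "x \<in> S \<and> x \<noteq> r")
        case True
        show ?thesis unfolding NInl if_P[OF True] by simp
      next
        case False
        show ?thesis unfolding NInl if_not_P[OF False] f ..
      qed
      also have "?R = (if x \<in> S - {r} then rigidity_matrix p e (x, l) else 0) -
          (if x = r then \<Sum>s\<in>S - {r}. rigidity_matrix p e (s, l) else 0)"
      proof -
        have "?R = (\<Sum>s\<in>?S'. if s = (x, l) then rigidity_matrix p e s else 0) -
            (\<Sum>s\<in>?S'. if x = r \<and> snd s = l then rigidity_matrix p e s else 0)"
          unfolding sum_subtractf[symmetric] by (intro sum.cong) auto
        also have "(\<Sum>s\<in>?S'. if s = (x, l) then rigidity_matrix p e s else 0) =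
            (if x \<in> S - {r} then rigidity_matrix p e (x, l) else 0)"
          using fS by simp
        also have "(\<Sum>s\<in>?S'. if x = r \<and> snd s = l then rigidity_matrix p e s else 0) =
            (\<Sum>s\<in>S - {r}. \<Sum>m\<in>UNIV. if m = l then (if x = r then rigidity_matrix p e (s, m) else 0) else 0)"
          unfolding sum.cartesian_product' by (intro sum.cong) auto
        also have "\<dots> = (if x = r then \<Sum>s\<in>S - {r}. rigidity_matrix p e (s, l) else 0)" by simp
        finally show ?thesis .
      qed
      finally have eq: "(\<Sum>i\<in>?I. h i * N i (x, l)) =
        (if x \<in> S \<and> x \<noteq> r then 0 else rigidity_matrix q (contract_vertex S ` e) (contract_vertex S x, l)) +
        ((if x \<in> S - {r} then rigidity_matrix p e (x, l) else 0) -
          (if x = r then \<Sum>s\<in>S - {r}. rigidity_matrix p e (s, l) else 0))" .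
      show ?thesis
      proof (cases "x = r")
        case True
        then show ?thesis unfolding eq using row(2)[of l] r fS
          by (simp add: ab(1)[symmetric] sum.remove[of S r])
      next
        case False
        then show ?thesis unfolding eq using row(1)[of x l] by (cases "x \<in> S") (simp_all add: ab(1)[symmetric])
      qed
    qed
    then show "\<exists>a. \<forall>c. rigidity_matrix p e c = (\<Sum>d\<in>?I. a d * N d c)" by (intro exI[of _ h]) auto
  qed
  also have "card ?I = card D + 2 * (card S - 1)"
    using fD fS r by (simp add: card_Plus card_cartesian_product)
  finally show ?thesis using that D(2) by simp
qed

lemma contract_infinitesimally_rigid:
  fixes G :: "'a sgraph"
  assumes G: "finite_simple_graph G" and S: "S \<subseteq> verts G" "2 \<le> card S"
    and p: "coincident S p" "infinitesimally_rigid G p"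
    and noloop: "\<And>a b. {a, b} \<in> edges G \<Longrightarrow> a \<noteq> b \<Longrightarrow> \<not> (a \<in> S \<and> b \<in> S)"
  shows "\<exists>q. infinitesimally_rigid (contract G S) q"
proof -
  let ?H = "contract G S"
  have H: "finite_simple_graph ?H" by (rule finite_simple_graph_contract[OF G])
  have fV: "finite (verts G)" using G by (simp add: finite_simple_graph_def)
  have SV: "card S \<le> card (verts G)" using card_mono[OF fV S(1)] .
  obtain q where q: "matrix_rank (edges G) (rigidity_matrix p) \<le>
      matrix_rank (edges ?H) (rigidity_matrix q) + 2 * (card S - 1)"
    using rank_le_contract_rank[OF G S p(1) noloop] by blast
  have "verts ?H = insert S ((\<lambda>x. {x}) ` (verts G - S))"
  proof -
    have "contract_vertex S ` verts G = contract_vertex S ` S \<union> contract_vertex S ` (verts G - S)"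
      using S(1) by blast
    moreover have "S \<noteq> {}" using S(2) by auto
    then have "contract_vertex S ` S = {S}" by (auto simp: contract_vertex_def)
    moreover have "contract_vertex S ` (verts G - S) = (\<lambda>x. {x}) ` (verts G - S)"
      by (intro image_cong) (auto simp: contract_vertex_def)
    ultimately show ?thesis by (simp add: contract_def)
  qed
  moreover have "S \<notin> (\<lambda>x. {x}) ` (verts G - S)" using S(2) by auto
  ultimately have cH: "card (verts ?H) = Suc (card (verts G) - card S)"
    using fV S(1) by (simp add: card_image card_Diff_subset finite_subset)
  have "infinitesimally_rigid ?H q"
  proof (cases "2 \<le> card (verts ?H)")
    case True
    then show ?thesis using q p(2) SV S(2) cH rigidity_rank_le[OF H True, of q]
      unfolding infinitesimally_rigid_def by simp
  next
    case False
    then have "edges ?H = {}" using card_edges_if_small[OF H] by simp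
    then show ?thesis using False by (simp add: infinitesimally_rigid_def matrix_rank_empty)
  qed
  then show ?thesis by blast
qed

section \<open>The characterisation\<close>

theorem theorem1p2:
  fixes G G' :: "'a sgraph" and u v w :: 'a
  assumes "finite_simple_graph G"
    and "u \<in> verts G" and "v \<in> verts G" and "w \<in> verts G"
    and "u \<noteq> v" and "u \<noteq> w" and "v \<noteq> w"
    and "G' = delete_edge (delete_edge (delete_edge G u v) u w) v w"
  shows "(\<exists>p. coincident {u, v, w} p \<and> infinitesimally_rigid G p) \<longleftrightarrow>
    rigid G' \<and> (\<forall>S. S \<subseteq> {u, v, w} \<and> card S \<ge> 2 \<longrightarrow> rigid (contract G' S))"
proof
  have V': "verts G' = verts G" and E': "edges G' = edges G - {{u, v}, {u, w}, {v, w}}"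
    by (auto simp: assms(8) delete_edge_def)
  have G': "finite_simple_graph G'" using assms(1) by (auto simp: finite_simple_graph_def V' E')
  have not_in_T: "\<not> (x \<in> {u, v, w} \<and> y \<in> {u, v, w})" if "{x, y} \<in> edges G'" "x \<noteq> y" for x y
    using that unfolding E' by (auto simp: insert_commute)
  assume "\<exists>p. coincident {u, v, w} p \<and> infinitesimally_rigid G p"
  then obtain p where p: "coincident {u, v, w} p" "infinitesimally_rigid G p" by blast
  have fE': "finite (edges G')" by (rule finite_edges[OF G'])
  have puvw: "p u = p v" "p u = p w" "p v = p w" using p(1) unfolding coincident_def by blast+
  have zero: "rigidity_matrix p e c = 0" if "e \<in> {{u, v}, {u, w}, {v, w}}" for e c
    using that assms(5-7) puvw by (cases c) (auto simp: rigidity_matrix_edge)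
  have "matrix_rank (edges G) (rigidity_matrix p) \<le> matrix_rank (edges G') (rigidity_matrix p)"
  proof (rule matrix_rank_le_if_spanned[OF fE'])
    fix e assume e: "e \<in> edges G"
    show "\<exists>a. \<forall>c. rigidity_matrix p e c = (\<Sum>s\<in>edges G'. a s * rigidity_matrix p s c)"
    proof (cases "e \<in> edges G'")
      case True
      then show ?thesis using fE' by (intro exI[of _ "\<lambda>s. if s = e then 1 else 0"]) (simp add: sum_delta_mult)
    next
      case False
      then have "e \<in> {{u, v}, {u, w}, {v, w}}" using e E' by blast
      then show ?thesis using zero by (intro exI[of _ "\<lambda>_. 0"]) simp
    qed
  qed
  moreover have "matrix_rank (edges G') (rigidity_matrix p) \<le> matrix_rank (edges G) (rigidity_matrix p)"
  proof (rule matrix_rank_le_if_spanned[OF finite_edges[OF assms(1)]])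
    fix e assume "e \<in> edges G'"
    then have "e \<in> edges G" using E' by blast
    then show "\<exists>a. \<forall>c. rigidity_matrix p e c = (\<Sum>s\<in>edges G. a s * rigidity_matrix p s c)"
      using finite_edges[OF assms(1)] by (intro exI[of _ "\<lambda>s. if s = e then 1 else 0"]) (simp add: sum_delta_mult)
  qed
  ultimately have p': "infinitesimally_rigid G' p" using p(2) by (simp add: infinitesimally_rigid_def V')
  have "rigid (contract G' S)" if S: "S \<subseteq> {u, v, w}" "2 \<le> card S" for S
  proof -
    have "S \<subseteq> verts G'" using S(1) assms(2-4) V' by blast
    moreover have "coincident S p" using p(1) S(1) unfolding coincident_def by blast
    moreover have "\<not> (a \<in> S \<and> b \<in> S)" if "{a, b} \<in> edges G'" "a \<noteq> b" for a b
      using not_in_T[OF that] S(1) by blast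
    ultimately obtain q where "infinitesimally_rigid (contract G' S) q"
      using contract_infinitesimally_rigid[OF G' _ S(2) _ p', of] by blast
    then show ?thesis using rigid_if_infinitesimally_rigid[OF finite_simple_graph_contract[OF G']] by blast
  qed
  then show "rigid G' \<and> (\<forall>S. S \<subseteq> {u, v, w} \<and> card S \<ge> 2 \<longrightarrow> rigid (contract G' S))"
    using rigid_if_infinitesimally_rigid[OF G' p'] by blast
next
  assume r: "rigid G' \<and> (\<forall>S. S \<subseteq> {u, v, w} \<and> card S \<ge> 2 \<longrightarrow> rigid (contract G' S))"
  then obtain q where "infinitesimally_rigid G' q" unfolding rigid_def by blast
  moreover have "\<exists>q. infinitesimally_rigid (contract G' S) q" if "S \<subseteq> {u, v, w}" "2 \<le> card S" for S
    using r that unfolding rigid_def by blast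
  ultimately show "\<exists>p. coincident {u, v, w} p \<and> infinitesimally_rigid G p"
    by (rule coincident_rigid_if_contractions_rigid[OF assms])
qed

end
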